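(* Let $d\ge 3$ and let $\mathcal K$ be a chiral $d$-polytope whose facets are regular, with automorphism group $\Gamma=\langle\sigma_1,\dots,\sigma_{d-1}\rangle$ generated by its abstract rotations. Let $\tau$ be the involution on $\Gamma\times\{0,1\}$ constructed below, let $\eta_k$ ($1\le k\le d-1$) be the permutation $(g,e)\mapsto(g\sigma_k,e)$ of $\Gamma\times\{0,1\}$, and let $\eta_d:=\eta_{d-1}^{-1}\tau$. Then the group $\langle\eta_1,\dots,\eta_d\rangle$, with generators $\eta_1,\dots,\eta_d$, is the automorphism group of a chiral $(d+1)$-polytope $\mathcal P$ having $\eta_1,\dots,\eta_d$ as its abstract rotations, and the facets of $\mathcal P$ are isomorphic to $\mathcal K$. (Equivalently, the graph consisting of two disjoint copies of the Cayley GPR graph of $\mathcal K$ together with the matching $\tau$ is a GPR graph of such a $\mathcal P$, with the matching representing $\eta_{d-1}\eta_d$.) This holds for every admissible choice made in the construction.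
   Context: Abstract rotations: for a chiral polytope with base flag $\Phi$, $\sigma_i$ is the automorphism sending $\Phi$ to $(\Phi^i)^{i-1}$. Let $\Gamma_F:=\langle\sigma_1,\dots,\sigma_{d-2}\rangle$ (the rotation group of the base facet). Since the facets are regular, there is an automorphism $\alpha\mapsto\bar\alpha$ of $\Gamma_F$ (conjugation by the reflection $\rho_{d-2}$ of the facet) with $\bar\sigma_{d-2}=\sigma_{d-2}^{-1}$, $\bar\sigma_{d-3}=\sigma_{d-3}\sigma_{d-2}^2$ (if $d\ge4$), and $\bar\sigma_j=\sigma_j$ for $j<d-3$. Construction of $\tau$ (a perfect matching between $\Gamma\times\{0\}$ and $\Gamma\times\{1\}$, two copies of the Cayley GPR graph of $\mathcal K$, whose $k$-arrows go from $(g,e)$ to $(g\sigma_k,e)$): (i) for every integer $k$, match $(\sigma_{d-1}^k,0)$ with $(\sigma_{d-1}^{-k},1)$. (ii) For $k=1,\dots,d-1$ let $E_k:=\langle\sigma_k,\dots,\sigma_{d-1}\rangle\subseteq\Gamma$; the $(1,d-2)$-components correspond to the cosets $g\Gamma_F$. For $k=1,\dots,d-2$ let $\mathcal C_k$ be the set of cosets $A=g\Gamma_F$ meeting $E_k$ but not $E_{k+1}$; for each $A\in\mathcal C_k$ choose some $g_A\in A\cap E_k$ and match $(g_A,0)$ with $(g_A,1)$. After (i) and (ii) every coset $g\Gamma_F$ in copy $0$ has exactly one matched vertex, and the induced correspondence of cosets is a bijection. (iii) Whenever $(g,0)$ has been matched in (i) or (ii) with $(h,1)$, match $(g\alpha,0)$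 with $(h\bar\alpha,1)$ for every $\alpha\in\Gamma_F$. The resulting perfect matching is viewed as the involution $\tau$ of $\Gamma\times\{0,1\}$ swapping matched vertices. *)

theory Defs
  imports
    "HOL-Algebra.Left_Coset"
    "HOL-Algebra.Generated_Groups"
    "HOL-Combinatorics.Permutations"
begin

section \<open>Abstract polytopes\<close>

text \<open>
  A poset is given by its reflexive order relation \<open>r\<close>; its faces are the elements of \<open>Field r\<close>.
\<close>

definition flags :: "'a rel \<Rightarrow> 'a set set" where
  "flags r = {C \<in> Chains r. \<forall>D \<in> Chains r. C \<subseteq> D \<longrightarrow> D = C}"

text \<open>
  The rank of a face is one less than the number of faces strictly below it in any flag
  through it, so the least face has rank \<open>-1\<close>. When all flags have the same finite length, this
  number does not depend on the flag.
\<close>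

definition face_rank :: "'a rel \<Rightarrow> 'a \<Rightarrow> int" where
  "face_rank r F = (THE i. \<forall>C \<in> flags r. F \<in> C \<longrightarrow> int (card (underS r F \<inter> C)) = i + 1)"

definition i_adjacent :: "'a rel \<Rightarrow> int \<Rightarrow> 'a set \<Rightarrow> 'a set \<Rightarrow> bool" where
  "i_adjacent r i C D \<longleftrightarrow> C \<in> flags r \<and> D \<in> flags r \<and> C \<noteq> D \<and>
     {F \<in> C. face_rank r F \<noteq> i} = {F \<in> D. face_rank r F \<noteq> i}"

definition strongly_flag_connected :: "'a rel \<Rightarrow> bool" where
  "strongly_flag_connected r \<longleftrightarrow>
     (\<forall>C \<in> flags r. \<forall>D \<in> flags r.
        (C, D) \<in> {(X, Y). (\<exists>i. i_adjacent r i X Y) \<and> C \<inter> D \<subseteq> X \<and> C \<inter> D \<subseteq> Y}\<^sup>*)"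

definition polytope :: "nat \<Rightarrow> 'a rel \<Rightarrow> bool" where
  "polytope n r \<longleftrightarrow>
     Partial_order r \<and>
     (\<exists>b \<in> Field r. \<forall>F \<in> Field r. (b, F) \<in> r) \<and>
     (\<exists>t \<in> Field r. \<forall>F \<in> Field r. (F, t) \<in> r) \<and>
     (\<forall>C \<in> flags r. card C = n + 2) \<and>
     (\<forall>F G. (F, G) \<in> r \<and> face_rank r G = face_rank r F + 2 \<longrightarrow>
        card {H. H \<noteq> F \<and> H \<noteq> G \<and> (F, H) \<in> r \<and> (H, G) \<in> r} = 2) \<and>
     strongly_flag_connected r"

definition adj_flag :: "'a rel \<Rightarrow> int \<Rightarrow> 'a set \<Rightarrow> 'a set" where
  "adj_flag r i C = (THE D. i_adjacent r i C D)"

definition facets :: "nat \<Rightarrow> 'a rel \<Rightarrow> 'a set" where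
  "facets n r = {F \<in> Field r. face_rank r F = int n - 1}"

text \<open>A face \<open>F\<close> regarded as a poset, i.e. the section between the least face and \<open>F\<close>.\<close>

definition face_section :: "'a rel \<Rightarrow> 'a \<Rightarrow> 'a rel" where
  "face_section r F = Restr r (under r F)"

definition poset_isomorphic :: "'a rel \<Rightarrow> 'b rel \<Rightarrow> bool" where
  "poset_isomorphic r s \<longleftrightarrow>
     (\<exists>f. bij_betw f (Field r) (Field s) \<and>
          (\<forall>x \<in> Field r. \<forall>y \<in> Field r. (x, y) \<in> r \<longleftrightarrow> (f x, f y) \<in> s))"


section \<open>Automorphisms\<close>

text \<open>
  Permutations act on the right: the product of \<open>f\<close> and \<open>g\<close> is ``first \<open>f\<close>, then \<open>g\<close>''.
  They are extended by the identity outside the set they act on.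
\<close>

definition perm_group :: "'a set \<Rightarrow> ('a \<Rightarrow> 'a) monoid" where
  "perm_group S = \<lparr>carrier = {f. f permutes S}, monoid.mult = (\<lambda>f g. g \<circ> f), one = id\<rparr>"

definition aut_group :: "'a rel \<Rightarrow> ('a \<Rightarrow> 'a) monoid" where
  "aut_group r = (perm_group (Field r))
     \<lparr>carrier := {f. f permutes Field r \<and>
        (\<forall>x \<in> Field r. \<forall>y \<in> Field r. (x, y) \<in> r \<longleftrightarrow> (f x, f y) \<in> r)}\<rparr>"

definition flag_orbit :: "'a rel \<Rightarrow> 'a set \<Rightarrow> 'a set set" where
  "flag_orbit r C = {f ` C | f. f \<in> carrier (aut_group r)}"

definition regular_polytope :: "nat \<Rightarrow> 'a rel \<Rightarrow> bool" where
  "regular_polytope n r \<longleftrightarrow> polytope n r \<and> (\<forall>C \<in> flags r. flag_orbit r C = flags r)"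

definition chiral_polytope :: "nat \<Rightarrow> 'a rel \<Rightarrow> bool" where
  "chiral_polytope n r \<longleftrightarrow> polytope n r \<and>
     card (flag_orbit r ` flags r) = 2 \<and>
     (\<forall>i C D. i_adjacent r i C D \<longrightarrow> flag_orbit r C \<noteq> flag_orbit r D)"

definition abstract_rotations :: "nat \<Rightarrow> 'a rel \<Rightarrow> 'a set \<Rightarrow> (nat \<Rightarrow> 'a \<Rightarrow> 'a) \<Rightarrow> bool" where
  "abstract_rotations n r C \<sigma> \<longleftrightarrow>
     (\<forall>i \<in> {1..<n}. \<sigma> i \<in> carrier (aut_group r) \<and>
        \<sigma> i ` C = adj_flag r (int i - 1) (adj_flag r (int i) C))"


section \<open>The matching and the permutations of two copies of the group\<close>

text \<open>
  Below, \<open>G\<close> is the automorphism group of a \<open>d\<close>-polytope and \<open>\<sigma> 1, \<dots>, \<sigma> (d - 1)\<close> are its abstract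
  rotations; the other values of \<open>\<sigma>\<close> are irrelevant.
\<close>

definition facet_group :: "('g, 'm) monoid_scheme \<Rightarrow> nat \<Rightarrow> (nat \<Rightarrow> 'g) \<Rightarrow> 'g set" where
  "facet_group G d \<sigma> = generate G (\<sigma> ` {1..d - 2})"

definition tail_group :: "('g, 'm) monoid_scheme \<Rightarrow> nat \<Rightarrow> (nat \<Rightarrow> 'g) \<Rightarrow> nat \<Rightarrow> 'g set" where
  "tail_group G d \<sigma> k = generate G (\<sigma> ` {k..d - 1})"

text \<open>
  The automorphism of the facet group induced by conjugation with the last reflection of the
  facet. Its values on the generators determine it on the facet group; it exists if the facets
  are regular, and its values elsewhere are never used.
\<close>

definition facet_bar :: "('g, 'm) monoid_scheme \<Rightarrow> nat \<Rightarrow> (nat \<Rightarrow> 'g) \<Rightarrow> 'g \<Rightarrow> 'g" where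
  "facet_bar G d \<sigma> = (SOME \<beta>.
     \<beta> \<in> iso (G\<lparr>carrier := facet_group G d \<sigma>\<rparr>) (G\<lparr>carrier := facet_group G d \<sigma>\<rparr>) \<and>
     \<beta> (\<sigma> (d - 2)) = inv\<^bsub>G\<^esub> (\<sigma> (d - 2)) \<and>
     (d \<ge> 4 \<longrightarrow> \<beta> (\<sigma> (d - 3)) = \<sigma> (d - 3) \<otimes>\<^bsub>G\<^esub> \<sigma> (d - 2) [^]\<^bsub>G\<^esub> (2::nat)) \<and>
     (\<forall>j. 1 \<le> j \<and> j < d - 3 \<longrightarrow> \<beta> (\<sigma> j) = \<sigma> j))"

definition coset_class :: "('g, 'm) monoid_scheme \<Rightarrow> nat \<Rightarrow> (nat \<Rightarrow> 'g) \<Rightarrow> nat \<Rightarrow> 'g set set" where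
  "coset_class G d \<sigma> k = {A \<in> lcosets\<^bsub>G\<^esub> (facet_group G d \<sigma>).
     A \<inter> tail_group G d \<sigma> k \<noteq> {} \<and> A \<inter> tail_group G d \<sigma> (k + 1) = {}}"

text \<open>
  The choice of the elements \<open>g\<^sub>A\<close> is a function \<open>c\<close> on cosets.
\<close>

definition admissible_choice ::
  "('g, 'm) monoid_scheme \<Rightarrow> nat \<Rightarrow> (nat \<Rightarrow> 'g) \<Rightarrow> ('g set \<Rightarrow> 'g) \<Rightarrow> bool" where
  "admissible_choice G d \<sigma> c \<longleftrightarrow>
     (\<forall>k \<in> {1..d - 2}. \<forall>A \<in> coset_class G d \<sigma> k. c A \<in> A \<inter> tail_group G d \<sigma> k)"

definition seed_matching ::
  "('g, 'm) monoid_scheme \<Rightarrow> nat \<Rightarrow> (nat \<Rightarrow> 'g) \<Rightarrow> ('g set \<Rightarrow> 'g) \<Rightarrow> ('g \<times> 'g) set" where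
  "seed_matching G d \<sigma> c =
     {(\<sigma> (d - 1) [^]\<^bsub>G\<^esub> k, \<sigma> (d - 1) [^]\<^bsub>G\<^esub> (- k)) | k :: int. True} \<union>
     {(c A, c A) | k A. k \<in> {1..d - 2} \<and> A \<in> coset_class G d \<sigma> k}"

text \<open>A pair \<open>(g, h)\<close> stands for the matching edge between \<open>(g, 0)\<close> and \<open>(h, 1)\<close>.\<close>

definition full_matching ::
  "('g, 'm) monoid_scheme \<Rightarrow> nat \<Rightarrow> (nat \<Rightarrow> 'g) \<Rightarrow> ('g set \<Rightarrow> 'g) \<Rightarrow> ('g \<times> 'g) set" where
  "full_matching G d \<sigma> c =
     {(g \<otimes>\<^bsub>G\<^esub> \<alpha>, h \<otimes>\<^bsub>G\<^esub> facet_bar G d \<sigma> \<alpha>) | g h \<alpha>.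
        (g, h) \<in> seed_matching G d \<sigma> c \<and> \<alpha> \<in> facet_group G d \<sigma>}"

text \<open>The copies \<open>0\<close> and \<open>1\<close> of the group are labelled by \<open>False\<close> and \<open>True\<close>.\<close>

definition two_copies :: "('g, 'm) monoid_scheme \<Rightarrow> ('g \<times> bool) set" where
  "two_copies G = carrier G \<times> UNIV"

definition tau ::
  "('g, 'm) monoid_scheme \<Rightarrow> nat \<Rightarrow> (nat \<Rightarrow> 'g) \<Rightarrow> ('g set \<Rightarrow> 'g) \<Rightarrow> 'g \<times> bool \<Rightarrow> 'g \<times> bool" where
  "tau G d \<sigma> c = (\<lambda>(g, e).
     if g \<notin> carrier G then (g, e)
     else if \<not> e then (THE h. (g, h) \<in> full_matching G d \<sigma> c, True)
     else (THE h. (h, g) \<in> full_matching G d \<sigma> c, False))"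

definition eta ::
  "('g, 'm) monoid_scheme \<Rightarrow> nat \<Rightarrow> (nat \<Rightarrow> 'g) \<Rightarrow> ('g set \<Rightarrow> 'g) \<Rightarrow> nat \<Rightarrow> 'g \<times> bool \<Rightarrow> 'g \<times> bool"
  where
  "eta G d \<sigma> c k =
     (let shift = (\<lambda>j (g, e). if g \<in> carrier G then (g \<otimes>\<^bsub>G\<^esub> \<sigma> j, e) else (g, e));
          S = perm_group (two_copies G)
      in if k = d then inv\<^bsub>S\<^esub> (shift (d - 1)) \<otimes>\<^bsub>S\<^esub> tau G d \<sigma> c else shift k)"

definition eta_group ::
  "('g, 'm) monoid_scheme \<Rightarrow> nat \<Rightarrow> (nat \<Rightarrow> 'g) \<Rightarrow> ('g set \<Rightarrow> 'g) \<Rightarrow> ('g \<times> bool \<Rightarrow> 'g \<times> bool) monoid"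
  where
  "eta_group G d \<sigma> c = (perm_group (two_copies G))
     \<lparr>carrier := generate (perm_group (two_copies G)) (eta G d \<sigma> c ` {1..d})\<rparr>"

text \<open>
  Since HOL cannot quantify existentially over types, an existence statement has to name the type
  of faces. A polytope with automorphism group \<open>eta_group G d \<sigma> c\<close> whose faces are the cosets of
  the stabilisers of base faces has its faces in the following type. The type is infinite, and
  every chiral polytope has only countably many faces, so no polytope is excluded up to isomorphism.
\<close>

type_synonym 'g coset_face = "int \<times> ('g \<times> bool \<Rightarrow> 'g \<times> bool) set"

end

theory Submission
  imports Defs
begin

text \<open>
  A polytope is recovered from its flags and the adjacency involutions: its faces of rank \<open>i\<close> are the
  components left after removing the colour \<open>i\<close>. Conversely, a connected system of involutions
  yields a polytope if involutions with distant colours commute and a pair of flags joined both by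
  colours at most \<open>k\<close> and by colours at least \<open>j\<close> is joined by colours between \<open>j\<close> and \<open>k\<close>. For two
  copies of a group with rotation generators these conditions become the relations
  \<open>(s (i + 1) \<dots> s j)\<^sup>2 = 1\<close> and the intersection property.

  For the extended group the relations that involve the matching say that the matching conjugates
  \<open>s (i + 1) \<dots> s (d - 2)\<close> to its inverse, and this is what \<open>facet_bar\<close> achieves. Every set
  \<open>E \<times> UNIV\<close>, with \<open>E\<close> generated by \<open>s j, \<dots>, s (d - 1)\<close>, is invariant under the matching, and
  \<open>(\<one>, False)\<close> and \<open>(s (d - 1), True)\<close> are swapped by \<open>\<eta> d\<close>; both facts together give the
  intersection property. A reflection of the new polytope would fix its base facet, a copy of \<open>K\<close>,
  against the chirality of \<open>K\<close>.
\<close>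

section \<open>Flag models of posets\<close>

text \<open>The relations prescribe how the matching behaves under right multiplication by the facet
  group, so the freedom left is one matched pair for each left coset of that group. The intersection
  property guides the choice of these pairs. Every \<open>E j\<close> has to be respected, hence the
  pair of a coset is taken in the tail group of largest index that the coset meets. Powers of the
  last rotation are matched with their inverses because \<open>\<eta> d\<close> first multiplies by
  the inverse of that rotation: the two inversions cancel on the way back to the base vertex, which
  thus has an orbit of only two vertices, one in each copy. If each power were matched with itself,
  the square of \<open>\<eta> d\<close> would move the base vertex exactly as a shift by a power of
  the last rotation does, and the orbit would no longer separate the two. The second copy also
  distinguishes products that contain the matching once from all shifts. Flags and colours are
  preferred to faces because the passage from a polytope to one of its facets then amounts to
  dropping the last colour, and no finiteness of the group is involved.\<close>

definition reach :: "(nat \<Rightarrow> 'w \<Rightarrow> 'w) \<Rightarrow> nat set \<Rightarrow> 'w \<Rightarrow> 'w \<Rightarrow> bool" where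
  "reach a I = (\<lambda>x y. \<exists>i \<in> I. y = a i x)\<^sup>*\<^sup>*"

lemma reach_refl [simp]: "reach a I x x"
  by (simp add: reach_def)

lemma reach_trans: "reach a I x y \<Longrightarrow> reach a I y z \<Longrightarrow> reach a I x z"
  unfolding reach_def by (rule rtranclp_trans)

lemma reach_step: "reach a I x y \<Longrightarrow> i \<in> I \<Longrightarrow> reach a I x (a i y)"
  unfolding reach_def by (rule rtranclp.rtrancl_into_rtrancl) auto

lemma reach_single: "i \<in> I \<Longrightarrow> reach a I x (a i x)"
  by (rule reach_step) auto

lemma reach_induct [consumes 1, case_names refl step]:
  assumes "reach a I x y" "Q x" "\<And>y i. reach a I x y \<Longrightarrow> Q y \<Longrightarrow> i \<in> I \<Longrightarrow> Q (a i y)"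
  shows "Q y"
  using assms(1) unfolding reach_def
  by (induction rule: rtranclp_induct) (use assms(2,3) in \<open>auto simp: reach_def\<close>)

lemma reach_mono: "reach a I x y \<Longrightarrow> I \<subseteq> J \<Longrightarrow> reach a J x y"
  by (induction rule: reach_induct) (auto intro: reach_step)

lemma reach_empty: "reach a {} x y \<Longrightarrow> y = x"
  by (induction rule: reach_induct) auto

locale flag_system =
  fixes n :: nat and W :: "'w set" and a :: "nat \<Rightarrow> 'w \<Rightarrow> 'w"
  assumes closed: "w \<in> W \<Longrightarrow> i < n \<Longrightarrow> a i w \<in> W"
    and invol: "w \<in> W \<Longrightarrow> i < n \<Longrightarrow> a i (a i w) = w"
    and comm: "w \<in> W \<Longrightarrow> j < n \<Longrightarrow> i + 2 \<le> j \<Longrightarrow> a i (a j w) = a j (a i w)"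
begin

lemma comm': "w \<in> W \<Longrightarrow> i < n \<Longrightarrow> j < n \<Longrightarrow> i + 2 \<le> j \<or> j + 2 \<le> i \<Longrightarrow> a i (a j w) = a j (a i w)"
  using comm by metis

lemma reach_closed: "reach a I x y \<Longrightarrow> I \<subseteq> {..<n} \<Longrightarrow> x \<in> W \<Longrightarrow> y \<in> W"
  by (induction rule: reach_induct) (auto intro: closed)

lemma reach_sym:
  assumes "reach a I x y" "I \<subseteq> {..<n}" "x \<in> W"
  shows "reach a I y x"
  using assms
proof (induction rule: reach_induct)
  case (step y i)
  then have "a i (a i y) = y"
    using reach_closed invol by blast
  then have "reach a I (a i y) y"
    using reach_single[of i I a "a i y"] step by simp
  then show ?case
    by (rule reach_trans) (use step in simp)
qed auto

lemma reach_step_commute: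
  assumes "reach a I x y" "I \<subseteq> {..<n}" "x \<in> W" "j < n"
    and "\<And>i. i \<in> I \<Longrightarrow> i + 2 \<le> j \<or> j + 2 \<le> i"
  shows "reach a I (a j x) (a j y)"
  using assms
proof (induction rule: reach_induct)
  case (step y i)
  then have "a j (a i y) = a i (a j y)"
    using reach_closed comm'[of y j i] by (metis lessThan_iff subsetD)
  with step show ?case
    using reach_step by metis
qed auto

text \<open>Colours from \<open>L\<close> commute with colours from \<open>U\<close>, so a path can
  be sorted. The induction appends one colour at the end; a colour of \<open>U\<close> is pulled
  back across the \<open>L\<close> part by \<open>reach_step_commute\<close>.\<close>

lemma reach_split:
  assumes "reach a (L \<union> U) x y" "L \<union> U \<subseteq> {..<n}" "x \<in> W"
    and far: "\<And>i j. i \<in> L \<Longrightarrow> j \<in> U \<Longrightarrow> i + 2 \<le> j"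
  shows "\<exists>z. reach a U x z \<and> reach a L z y"
  using assms(1-3)
proof (induction rule: reach_induct)
  case refl
  show ?case by (intro exI[of _ x] conjI reach_refl)
next
  case (step y i)
  obtain z where z: "reach a U x z" "reach a L z y" using step.IH[OF step.prems] by blast
  have zW: "z \<in> W" using reach_closed[OF z(1)] step.prems by simp
  show ?case
  proof (cases "i \<in> L")
    case True
    show ?thesis by (intro exI[of _ z] conjI z(1) reach_step[OF z(2) True])
  next
    case False
    then have i: "i \<in> U" using step.hyps by simp
    have "reach a L (a i z) (a i y)"
      by (rule reach_step_commute[OF z(2)]) (use zW far i step.prems in auto)
    then show ?thesis by (intro exI[of _ "a i z"] conjI reach_step[OF z(1) i])
  qed
qed

end

text \<open>
  The elements of \<open>W\<close> stand for the flags, \<open>a i\<close> passes to the \<open>i\<close>-adjacent flag, and \<open>fc k w\<close> is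
  the face of rank \<open>k - 1\<close> of the flag \<open>w\<close>, so \<open>a i\<close> changes exactly the face number \<open>Suc i\<close>.
\<close>

locale flag_model = flag_system n W a
  for n :: nat and W :: "'w set" and a :: "nat \<Rightarrow> 'w \<Rightarrow> 'w" +
  fixes r :: "'f rel" and fc :: "nat \<Rightarrow> 'w \<Rightarrow> 'f"
  assumes nonempty: "W \<noteq> {}"
    and rel_iff: "(x, y) \<in> r \<longleftrightarrow> (\<exists>w \<in> W. \<exists>j k. j \<le> k \<and> k \<le> n + 1 \<and> x = fc j w \<and> y = fc k w)"
    and fc_rank: "\<lbrakk>w \<in> W; w' \<in> W; j \<le> n + 1; k \<le> n + 1; fc j w = fc k w'\<rbrakk> \<Longrightarrow> j = k"
    and fc_bot: "\<lbrakk>w \<in> W; w' \<in> W\<rbrakk> \<Longrightarrow> fc 0 w = fc 0 w'"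
    and fc_top: "\<lbrakk>w \<in> W; w' \<in> W\<rbrakk> \<Longrightarrow> fc (n + 1) w = fc (n + 1) w'"
    and fc_step: "\<lbrakk>w \<in> W; i < n; k \<le> n + 1\<rbrakk> \<Longrightarrow> fc k (a i w) = fc k w \<longleftrightarrow> k \<noteq> Suc i"
    and fc_reach: "\<lbrakk>w \<in> W; w' \<in> W; J \<subseteq> {..<n}; \<And>i. i \<in> J \<Longrightarrow> fc (Suc i) w = fc (Suc i) w'\<rbrakk>
                     \<Longrightarrow> reach a ({..<n} - J) w w'"
begin

definition fl :: "'w \<Rightarrow> 'f set" where
  "fl w = (\<lambda>k. fc k w) ` {..n + 1}"

lemma fc_in_fl: "k \<le> n + 1 \<Longrightarrow> fc k w \<in> fl w"
  by (auto simp: fl_def)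

lemma fl_cases:
  assumes "x \<in> fl w"
  obtains k where "k \<le> n + 1" "x = fc k w"
  using assms by (auto simp: fl_def)

lemma fc_const: "reach a I w w' \<Longrightarrow> I \<subseteq> {..<n} \<Longrightarrow> w \<in> W \<Longrightarrow> k \<le> n + 1
    \<Longrightarrow> (\<And>i. i \<in> I \<Longrightarrow> k \<noteq> Suc i) \<Longrightarrow> fc k w' = fc k w"
proof (induction rule: reach_induct)
  case (step y i)
  then have "y \<in> W" using reach_closed by blast
  then have "fc k (a i y) = fc k y" using fc_step[of y i k] step by blast
  then show ?case using step by metis
qed simp

lemma fc_eqI:
  assumes "w \<in> W" "w' \<in> W" "\<And>k. 1 \<le> k \<Longrightarrow> k \<le> n \<Longrightarrow> fc k w = fc k w'"
  shows "w = w'"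
proof -
  have "reach a ({..<n} - {..<n}) w w'"
    by (rule fc_reach) (use assms in auto)
  then show ?thesis using reach_empty by fastforce
qed

lemma reach_one:
  assumes "reach a {i} w w'" "w \<in> W" "i < n"
  shows "w' = w \<or> w' = a i w"
  using assms by (induction rule: reach_induct) (auto simp: invol)

lemma fc_eq_but_one:
  assumes "w \<in> W" "w' \<in> W" "i < n" "\<And>k. 1 \<le> k \<Longrightarrow> k \<le> n \<Longrightarrow> k \<noteq> Suc i \<Longrightarrow> fc k w = fc k w'"
  shows "w' = w \<or> w' = a i w"
proof -
  have "reach a ({..<n} - ({..<n} - {i})) w w'"
    by (rule fc_reach) (use assms in auto)
  moreover have "{..<n} - ({..<n} - {i}) = {i}" using assms by auto
  ultimately show ?thesis using reach_one assms by simp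
qed

lemma a_neq: "w \<in> W \<Longrightarrow> i < n \<Longrightarrow> a i w \<noteq> w"
  using fc_step[of w i "Suc i"] by auto

text \<open>The colours that keep face number \<open>k\<close> split into those below and those
  above it, and colours from different sides commute. Sorting a path from \<open>w\<close> to
  \<open>w'\<close> changes all higher faces first; the flag halfway is the glued one.\<close>

lemma glue:
  assumes "w \<in> W" "w' \<in> W" "k \<le> n + 1" "fc k w = fc k w'"
  obtains z where "z \<in> W" "\<And>j. j \<le> k \<Longrightarrow> fc j z = fc j w"
    "\<And>j. k \<le> j \<Longrightarrow> j \<le> n + 1 \<Longrightarrow> fc j z = fc j w'"
proof -
  \<comment> \<open>Colour \<open>k - 1\<close> changes face number \<open>k\<close>; the least and
    the greatest face are changed by no colour, so nothing is excluded for them.\<close>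
  let ?J = "if k = 0 \<or> k = n + 1 then {} else {k - 1}"
  let ?U = "{i. i < n \<and> k < Suc i}" and ?L = "{i. i < n \<and> Suc i < k}"
  have "reach a ({..<n} - ?J) w w'"
    by (rule fc_reach) (use assms in \<open>auto split: if_splits\<close>)
  moreover have "{..<n} - ?J \<subseteq> ?L \<union> ?U" using assms by (auto split: if_splits)
  ultimately have "reach a (?L \<union> ?U) w w'" by (rule reach_mono)
  then obtain z where z: "reach a ?U w z" "reach a ?L z w'"
    using reach_split[of ?L ?U w w'] assms by auto
  have zW: "z \<in> W" using reach_closed[OF z(1)] assms by auto
  show thesis
  proof
    show "z \<in> W" by (rule zW)
    show "fc j z = fc j w" if "j \<le> k" for j
      by (rule fc_const[OF z(1)]) (use assms that in auto)
    show "fc j z = fc j w'" if "k \<le> j" "j \<le> n + 1" for j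
    proof -
      have "fc j w' = fc j z" by (rule fc_const[OF z(2)]) (use zW that in auto)
      then show ?thesis by simp
    qed
  qed
qed

section \<open>The order relation of a flag model\<close>

lemma Field_eq: "Field r = {fc k w | k w. k \<le> n + 1 \<and> w \<in> W}"
proof (intro equalityI subsetI)
  fix x assume "x \<in> Field r"
  then obtain y where "(x, y) \<in> r \<or> (y, x) \<in> r" by (auto simp: Field_def)
  then obtain w j k where "w \<in> W" "j \<le> k" "k \<le> n + 1" "x = fc j w \<or> x = fc k w"
    using rel_iff by metis
  then show "x \<in> {fc k w | k w. k \<le> n + 1 \<and> w \<in> W}" using le_trans by blast
next
  fix x assume "x \<in> {fc k w | k w. k \<le> n + 1 \<and> w \<in> W}"
  then obtain k w where "k \<le> n + 1" "w \<in> W" "x = fc k w" by auto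
  then have "(x, x) \<in> r" using rel_iff by blast
  then show "x \<in> Field r" by (auto simp: Field_def)
qed

lemma FieldE:
  assumes "x \<in> Field r"
  obtains k w where "k \<le> n + 1" "w \<in> W" "x = fc k w"
  using assms Field_eq by auto

lemma rel_fcI: "w \<in> W \<Longrightarrow> j \<le> k \<Longrightarrow> k \<le> n + 1 \<Longrightarrow> (fc j w, fc k w) \<in> r"
  using rel_iff by auto

lemma rel_fcD:
  assumes "(fc j w, fc k w') \<in> r" "w \<in> W" "w' \<in> W" "j \<le> n + 1" "k \<le> n + 1"
  obtains z where "z \<in> W" "j \<le> k" "fc j z = fc j w" "fc k z = fc k w'"
proof -
  obtain z j' k' where z: "z \<in> W" "j' \<le> k'" "k' \<le> n + 1" "fc j w = fc j' z" "fc k w' = fc k' z"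
    using assms(1) rel_iff by auto
  then have "j = j'" "k = k'" using fc_rank assms by (metis le_trans)+
  then show thesis using z that by metis
qed

lemma rel_same_rank:
  assumes "(fc k w, fc k w') \<in> r" "w \<in> W" "w' \<in> W" "k \<le> n + 1"
  shows "fc k w = fc k w'"
  using rel_fcD[OF assms assms(4)] by metis

text \<open>Two comparable pairs come from two flags with the middle face in common; gluing them
  there puts all three faces into a single flag.\<close>

lemma rel_trans: "(x, y) \<in> r \<Longrightarrow> (y, z) \<in> r \<Longrightarrow> \<exists>w \<in> W. \<exists>i j k. i \<le> j \<and> j \<le> k \<and> k \<le> n + 1 \<and>
    x = fc i w \<and> y = fc j w \<and> z = fc k w"
proof -
  assume "(x, y) \<in> r" "(y, z) \<in> r"
  then obtain w w' i j j' k where *: "w \<in> W" "w' \<in> W" "i \<le> j" "j \<le> n + 1" "x = fc i w" "y = fc j w"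
     "j' \<le> k" "k \<le> n + 1" "y = fc j' w'" "z = fc k w'"
    by (auto simp: rel_iff)
  then have "j' = j" using fc_rank by (metis le_trans)
  then obtain v where "v \<in> W" "\<And>i. i \<le> j \<Longrightarrow> fc i v = fc i w"
    "\<And>i. j \<le> i \<Longrightarrow> i \<le> n + 1 \<Longrightarrow> fc i v = fc i w'"
    using glue[of w w' j] * by metis
  then show ?thesis using * \<open>j' = j\<close> by (metis order_refl)
qed

lemma partial_order: "Partial_order r"
proof -
  have "r \<subseteq> Field r \<times> Field r" by (auto simp: Field_def)
  moreover have "refl_on (Field r) r"
    unfolding refl_on_def by (metis FieldE order_refl rel_fcI)
  moreover have "trans r"
  proof (rule transI)
    fix x y z assume "(x, y) \<in> r" "(y, z) \<in> r"
    then show "(x, z) \<in> r" using rel_trans[of x y z] by (metis le_trans rel_fcI)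
  qed
  moreover have "antisym r"
  proof (rule antisymI)
    fix x y assume "(x, y) \<in> r" "(y, x) \<in> r"
    then obtain w i j k where "w \<in> W" "i \<le> j" "j \<le> k" "k \<le> n + 1" "x = fc i w" "y = fc j w" "x = fc k w"
      using rel_trans[of x y x] by auto
    then show "x = y" using fc_rank[of w w i k] by auto
  qed
  ultimately show ?thesis by (simp add: partial_order_on_def preorder_on_def)
qed

section \<open>Maximal chains\<close>

lemma fl_chain: "w \<in> W \<Longrightarrow> fl w \<in> Chains r"
  unfolding Chains_def
  by (intro CollectI ballI, elim fl_cases, hypsubst) (metis nle_le rel_fcI)

lemma chain_comparable:
  assumes "C \<in> Chains r" "fc j w \<in> C" "fc k w' \<in> C" "w \<in> W" "w' \<in> W" "j \<le> k" "k \<le> n + 1"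
  shows "(fc j w, fc k w') \<in> r"
proof -
  consider "(fc j w, fc k w') \<in> r" | "(fc k w', fc j w) \<in> r"
    using assms(1-3) by (auto simp: Chains_def)
  then show ?thesis
  proof cases
    case 2
    then have "k \<le> j" using rel_fcD[OF 2 assms(5,4)] assms(6,7) by (metis le_trans)
    then have "k = j" using assms by simp
    then show ?thesis using rel_same_rank[of k w' w] 2 assms by simp
  qed
qed

text \<open>The chain need not be known to be finite: the induction is on the bound \<open>m\<close>
  for the face numbers considered. The flag \<open>w\<close> contains all faces of \<open>C\<close>
  with number at most \<open>m\<close>, and \<open>j\<close> records the largest such number, so
  that a new face has to be compared with a single old one. The value \<open>j = 0\<close> also
  stands for no face at all, which is harmless as all flags share the least face.\<close>

lemma chain_in_fl:
  assumes C: "C \<in> Chains r"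
  shows "\<exists>w \<in> W. C \<subseteq> fl w"
proof -
  have CF: "C \<subseteq> Field r" using C by (auto simp: Chains_def Field_def)
  have "\<exists>w \<in> W. \<exists>j \<le> m. (j = 0 \<or> fc j w \<in> C) \<and> (\<forall>k v. k \<le> m \<and> v \<in> W \<and> fc k v \<in> C \<longrightarrow> fc k v = fc k w \<and> k \<le> j)"
    if "m \<le> n + 1" for m
    using that
  proof (induction m)
    case 0
    then show ?case using nonempty fc_bot by blast
  next
    case (Suc m)
    then obtain w j where w: "w \<in> W" "j \<le> m" "j = 0 \<or> fc j w \<in> C"
      and wk: "\<And>k v. k \<le> m \<Longrightarrow> v \<in> W \<Longrightarrow> fc k v \<in> C \<Longrightarrow> fc k v = fc k w \<and> k \<le> j"
      by auto
    show ?case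
    proof (cases "\<exists>v \<in> W. fc (Suc m) v \<in> C")
      case False
      then show ?thesis using w wk by (metis le_Suc_eq)
    next
      case True
      then obtain v where v: "v \<in> W" "fc (Suc m) v \<in> C" by auto
      \<comment> \<open>\<open>u\<close> joins the topmost old face to the new face; gluing
        \<open>w\<close> below and \<open>u\<close> above keeps all old faces.\<close>
      obtain u where u: "u \<in> W" "fc j u = fc j w" "fc (Suc m) u = fc (Suc m) v"
      proof (cases "j = 0")
        case True
        then show ?thesis using that v fc_bot w by metis
      next
        case False
        then have "(fc j w, fc (Suc m) v) \<in> r"
          using chain_comparable[OF C, of j w "Suc m" v] v w Suc.prems by auto
        then show ?thesis using that rel_fcD[of j w "Suc m" v] v w Suc.prems
          by (metis Suc_leD le_trans)
      qed
      obtain z where z: "z \<in> W" "\<And>i. i \<le> j \<Longrightarrow> fc i z = fc i w"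
         "\<And>i. j \<le> i \<Longrightarrow> i \<le> n + 1 \<Longrightarrow> fc i z = fc i u"
        using glue[of w u j] w u Suc.prems by auto
      have zm: "fc (Suc m) z = fc (Suc m) v"
        using z(3)[of "Suc m"] u w Suc.prems by auto
      have "fc k x = fc k z \<and> k \<le> Suc m" if "k \<le> Suc m" "x \<in> W" "fc k x \<in> C" for k x
      proof (cases "k = Suc m")
        case True
        then have "(fc k x, fc k v) \<in> r"
          using chain_comparable[OF C, of k x k v] that v Suc.prems by auto
        then show ?thesis using rel_same_rank[of k x v] True that v zm Suc.prems by auto
      next
        case False
        then show ?thesis using wk[of k x] that z(2) by auto
      qed
      then show ?thesis using z zm v by (metis order_refl)
    qed
  qed
  from this[of "n + 1"] obtain w j where "w \<in> W"
    and w: "\<forall>k v. k \<le> n + 1 \<and> v \<in> W \<and> fc k v \<in> C \<longrightarrow> fc k v = fc k w \<and> k \<le> j" by blast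
  have "C \<subseteq> fl w"
  proof
    fix x assume "x \<in> C"
    then obtain k v where "k \<le> n + 1" "v \<in> W" "x = fc k v" using CF FieldE by blast
    then show "x \<in> fl w" using w \<open>x \<in> C\<close> fc_in_fl[of k w] by metis
  qed
  then show ?thesis using \<open>w \<in> W\<close> by auto
qed

lemma fl_eqD:
  assumes "fl w \<subseteq> fl w'" "w \<in> W" "w' \<in> W"
  shows "w = w'"
proof (rule fc_eqI[OF assms(2,3)])
  fix k assume "1 \<le> k" "k \<le> n"
  then have "fc k w \<in> fl w'" using assms fc_in_fl[of k w] by auto
  then show "fc k w = fc k w'"
    using fc_rank assms \<open>k \<le> n\<close> by (metis fl_cases trans_le_add1)
qed

lemma flags_eq: "flags r = fl ` W"
proof (intro equalityI subsetI)
  fix C assume "C \<in> flags r"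
  then obtain w where "w \<in> W" "C \<subseteq> fl w" "C = fl w"
    using chain_in_fl[of C] fl_chain unfolding flags_def by blast
  then show "C \<in> fl ` W" by auto
next
  fix C assume "C \<in> fl ` W"
  then obtain w where w: "w \<in> W" "C = fl w" by auto
  have "D = C" if D: "D \<in> Chains r" "C \<subseteq> D" for D
  proof -
    obtain w' where "w' \<in> W" "D \<subseteq> fl w'" using chain_in_fl[OF D(1)] by auto
    then show ?thesis using fl_eqD[of w w'] w D by auto
  qed
  then show "C \<in> flags r" using w fl_chain by (auto simp: flags_def)
qed

lemma inj_fl: "inj_on fl W"
  using fl_eqD by (auto intro: inj_onI)

lemma inj_fc: "w \<in> W \<Longrightarrow> inj_on (\<lambda>k. fc k w) {..n + 1}"
  by (rule inj_onI) (metis atMost_iff fc_rank)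

lemma card_fl: "w \<in> W \<Longrightarrow> card (fl w) = n + 2"
  using card_image[OF inj_fc[of w]] by (simp add: fl_def)

lemma fc_mem_fl:
  assumes "fc k w \<in> fl w'" "w \<in> W" "w' \<in> W" "k \<le> n + 1"
  shows "fc k w = fc k w'"
  using assms fc_rank by (metis fl_cases)

section \<open>Ranks, adjacency and the polytope axioms\<close>

lemma face_rank_fc:
  assumes "w \<in> W" "k \<le> n + 1"
  shows "face_rank r (fc k w) = int k - 1"
proof -
  have *: "int (card (underS r (fc k w) \<inter> fl w')) = int k - 1 + 1" if "w' \<in> W" "fc k w \<in> fl w'" for w'
  proof -
    have e: "fc k w = fc k w'" using fc_mem_fl that assms by auto
    have "underS r (fc k w) \<inter> fl w' = (\<lambda>j. fc j w') ` {..<k}"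
    proof (intro equalityI subsetI)
      fix x assume "x \<in> underS r (fc k w) \<inter> fl w'"
      then obtain j where "j \<le> n + 1" "x = fc j w'" "x \<noteq> fc k w'" "(fc j w', fc k w') \<in> r"
        using e by (auto simp: underS_def elim!: fl_cases)
      then show "x \<in> (\<lambda>j. fc j w') ` {..<k}"
        using rel_fcD[of j w' k w'] that assms(2) by (metis image_eqI lessThan_iff nless_le)
    next
      fix x assume "x \<in> (\<lambda>j. fc j w') ` {..<k}"
      then obtain j where j: "j < k" "x = fc j w'" by auto
      moreover have "fc j w' \<noteq> fc k w'" using fc_rank[of w' w' j k] that j assms by auto
      ultimately show "x \<in> underS r (fc k w) \<inter> fl w'"
        using rel_fcI[of w' j k] that assms e fc_in_fl[of j w'] by (auto simp: underS_def)
    qed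
    also have "card \<dots> = k"
      by (subst card_image) (use inj_fc[OF that(1)] assms in \<open>auto intro: inj_on_subset\<close>)
    finally show ?thesis by simp
  qed
  show ?thesis
    unfolding face_rank_def
  proof (rule the_equality)
    show "\<forall>C\<in>flags r. fc k w \<in> C \<longrightarrow> int (card (underS r (fc k w) \<inter> C)) = int k - 1 + 1"
      using * by (auto simp: flags_eq)
    fix i assume "\<forall>C\<in>flags r. fc k w \<in> C \<longrightarrow> int (card (underS r (fc k w) \<inter> C)) = i + 1"
    then have "int (card (underS r (fc k w) \<inter> fl w)) = i + 1"
      using assms fc_in_fl[of k w] by (auto simp: flags_eq)
    then show "i = int k - 1"
      using *[of w] assms fc_in_fl by simp
  qed
qed

lemma rank_part_fl:
  assumes "w \<in> W"
  shows "{F \<in> fl w. face_rank r F \<noteq> i} = (\<lambda>k. fc k w) ` {k. k \<le> n + 1 \<and> int k - 1 \<noteq> i}"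
proof (intro equalityI subsetI)
  fix x assume x: "x \<in> {F \<in> fl w. face_rank r F \<noteq> i}"
  then obtain k where "k \<le> n + 1" "x = fc k w" by (blast elim: fl_cases)
  then show "x \<in> (\<lambda>k. fc k w) ` {k. k \<le> n + 1 \<and> int k - 1 \<noteq> i}"
    using x face_rank_fc[OF assms, of k] by blast
next
  fix x assume "x \<in> (\<lambda>k. fc k w) ` {k. k \<le> n + 1 \<and> int k - 1 \<noteq> i}"
  then obtain k where "k \<le> n + 1" "x = fc k w" "int k - 1 \<noteq> i" by blast
  then show "x \<in> {F \<in> fl w. face_rank r F \<noteq> i}"
    using face_rank_fc[OF assms, of k] fc_in_fl[of k w] by simp
qed

lemma i_adjacent_iff:
  "i_adjacent r i C D \<longleftrightarrow> (\<exists>w \<in> W. \<exists>j < n. i = int j \<and> C = fl w \<and> D = fl (a j w))"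
proof
  assume adj: "i_adjacent r i C D"
  then have e: "{F \<in> C. face_rank r F \<noteq> i} = {F \<in> D. face_rank r F \<noteq> i}"
    unfolding i_adjacent_def by blast
  from adj have CD: "C \<in> fl ` W" "D \<in> fl ` W" "C \<noteq> D"
    unfolding i_adjacent_def flags_eq by blast+
  then obtain w w' where w: "w \<in> W" "w' \<in> W" "C = fl w" "D = fl w'" "w \<noteq> w'"
    by (metis imageE)
  have eq: "fc k w = fc k w'" if "k \<le> n + 1" "int k - 1 \<noteq> i" for k
  proof -
    have "fc k w \<in> {F \<in> D. face_rank r F \<noteq> i}"
      using e rank_part_fl[OF w(1), of i] w(3) that by auto
    then show ?thesis using fc_mem_fl w that by auto
  qed
  have "\<exists>j < n. i = int j"
  proof (rule ccontr)
    assume "\<not> (\<exists>j<n. i = int j)"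
    have "int k - 1 \<noteq> i" if "1 \<le> k" "k \<le> n" for k
    proof
      assume "int k - 1 = i"
      then have "i = int (k - 1)" "k - 1 < n" using that by auto
      then show False using \<open>\<not> (\<exists>j<n. i = int j)\<close> by blast
    qed
    then have "w = w'" using fc_eqI[OF w(1,2)] eq by simp
    then show False using w by simp
  qed
  then obtain j where j: "j < n" "i = int j" by auto
  have "w' = w \<or> w' = a j w"
    by (rule fc_eq_but_one) (use w j eq in auto)
  then show "\<exists>w \<in> W. \<exists>j < n. i = int j \<and> C = fl w \<and> D = fl (a j w)"
    using w j by auto
next
  assume "\<exists>w \<in> W. \<exists>j < n. i = int j \<and> C = fl w \<and> D = fl (a j w)"
  then obtain w j where w: "w \<in> W" "j < n" "i = int j" "C = fl w" "D = fl (a j w)" by auto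
  have "fl w \<noteq> fl (a j w)" using fl_eqD[of w "a j w"] a_neq[of w j] w closed by auto
  moreover have "(\<lambda>k. fc k w) ` {k. k \<le> n + 1 \<and> int k - 1 \<noteq> i} =
      (\<lambda>k. fc k (a j w)) ` {k. k \<le> n + 1 \<and> int k - 1 \<noteq> i}"
    using w fc_step[of w j] by (intro image_cong) (auto intro: sym)
  ultimately show "i_adjacent r i C D"
    using w closed by (auto simp: i_adjacent_def flags_eq rank_part_fl)
qed

lemma adj_flag_fl:
  assumes "w \<in> W" "i < n"
  shows "adj_flag r (int i) (fl w) = fl (a i w)"
  unfolding adj_flag_def
proof (rule the_equality)
  show "i_adjacent r (int i) (fl w) (fl (a i w))" using i_adjacent_iff assms by blast
  fix D assume "i_adjacent r (int i) (fl w) D"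
  then show "D = fl (a i w)"
    using assms inj_fl by (auto simp: i_adjacent_iff inj_on_def)
qed

text \<open>Two intermediate faces come from a flag and its \<open>j\<close>-adjacent flag. That
  there are no others follows from connectivity: every flag through \<open>F\<close> and
  \<open>G\<close> is reached by colours that keep both, and none of these alters the unordered pair
  of intermediate faces.\<close>

lemma diamond:
  assumes "(F, G) \<in> r" "face_rank r G = face_rank r F + 2"
  shows "card {H. H \<noteq> F \<and> H \<noteq> G \<and> (F, H) \<in> r \<and> (H, G) \<in> r} = 2"
proof -
  obtain w j k where w: "w \<in> W" "j \<le> k" "k \<le> n + 1" "F = fc j w" "G = fc k w"
    using assms(1) rel_iff by auto
  then have k: "k = j + 2" using assms(2) face_rank_fc[of w j] face_rank_fc[of w k] by auto
  have jn: "j < n" using w k by auto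
  let ?A = "fc (Suc j) w" and ?B = "fc (Suc j) (a j w)"
  have AB: "?A \<noteq> ?B" using fc_step[of w j "Suc j"] w jn by auto
  have "{H. H \<noteq> F \<and> H \<noteq> G \<and> (F, H) \<in> r \<and> (H, G) \<in> r} = {?A, ?B}"
  proof (intro equalityI subsetI)
    fix H assume "H \<in> {?A, ?B}"
    then have H: "H = ?A \<or> H = ?B" by blast
    have aj: "a j w \<in> W" "fc j (a j w) = F" "fc k (a j w) = G"
      using fc_step[of w j j] fc_step[of w j k] closed w jn k by auto
    obtain v where v: "v \<in> W" "H = fc (Suc j) v" "fc j v = F" "fc k v = G"
    proof (cases "H = ?A")
      case True
      show ?thesis by (rule that[of w]) (simp_all add: True w)
    next
      case False
      show ?thesis by (rule that[of "a j w"]) (use False H aj in simp_all)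
    qed
    then show "H \<in> {H. H \<noteq> F \<and> H \<noteq> G \<and> (F, H) \<in> r \<and> (H, G) \<in> r}"
      using rel_fcI[OF v(1), of j "Suc j"] rel_fcI[OF v(1), of "Suc j" k] k jn
        fc_rank[of v v "Suc j" j] fc_rank[of v v "Suc j" k] by auto
  next
    fix H assume "H \<in> {H. H \<noteq> F \<and> H \<noteq> G \<and> (F, H) \<in> r \<and> (H, G) \<in> r}"
    then have H: "H \<noteq> F" "H \<noteq> G" "(F, H) \<in> r" "(H, G) \<in> r" by auto
    then obtain v i l m where v: "v \<in> W" "i \<le> l" "l \<le> m" "m \<le> n + 1" "F = fc i v" "H = fc l v" "G = fc m v"
      using rel_trans by metis
    then have im: "i = j" "m = k" using w fc_rank by (metis le_trans)+
    then have "l = Suc j" using v H k by (metis Suc_leI add_2_eq_Suc' le_antisym nless_le not_less_eq_eq)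
    have "reach a ({..<n} - {i. i < n \<and> (Suc i = j \<or> Suc i = k)}) w v"
      by (rule fc_reach) (use w v im in auto)
    \<comment> \<open>Colour \<open>j\<close> exchanges the two members of the pair; any other
      admissible colour is distant from \<open>j\<close>, hence commutes with \<open>a j\<close> and
      fixes both members.\<close>
    then have "{fc (Suc j) v, fc (Suc j) (a j v)} = {?A, ?B}"
    proof (induction rule: reach_induct)
      case (step y i)
      have yW: "y \<in> W" using reach_closed[OF step.hyps(1)] w by auto
      have i: "i < n" using step by auto
      show ?case
      proof (cases "i = j")
        case True
        then show ?thesis using step.IH invol[of y j] yW jn by (simp add: insert_commute)
      next
        case False
        then have "i + 2 \<le> j \<or> j + 2 \<le> i" using step.hyps(2) k i by auto
        then have "a j (a i y) = a i (a j y)" using comm'[of y j i] yW jn i by auto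
        moreover have "fc (Suc j) (a i y) = fc (Suc j) y" "fc (Suc j) (a i (a j y)) = fc (Suc j) (a j y)"
          using fc_step[of y i "Suc j"] fc_step[of "a j y" i "Suc j"] yW jn i False closed by auto
        ultimately show ?thesis using step.IH by simp
      qed
    qed auto
    then show "H \<in> {?A, ?B}" using v(6) \<open>l = Suc j\<close> by auto
  qed
  then show ?thesis using AB by simp
qed

text \<open>The path given by \<open>fc_reach\<close> avoids the colours of all common faces, so
  each flag on it retains these faces.\<close>

lemma strong_connectivity: "strongly_flag_connected r"
  unfolding strongly_flag_connected_def
proof (intro ballI)
  fix C D assume "C \<in> flags r" "D \<in> flags r"
  then obtain w w' where w: "w \<in> W" "w' \<in> W" "C = fl w" "D = fl w'" by (auto simp: flags_eq)
  let ?J = "{i. i < n \<and> fc (Suc i) w = fc (Suc i) w'}"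
  let ?R = "{(X, Y). (\<exists>i. i_adjacent r i X Y) \<and> C \<inter> D \<subseteq> X \<and> C \<inter> D \<subseteq> Y}"
  have inc: "C \<inter> D \<subseteq> fl y" if y: "reach a ({..<n} - ?J) w y" for y
  proof
    fix x assume x: "x \<in> C \<inter> D"
    then obtain k where k: "k \<le> n + 1" "x = fc k w" using w by (auto elim: fl_cases)
    then have "fc k w = fc k w'" using fc_mem_fl[of k w w'] x w by auto
    then have "fc k y = fc k w"
      using fc_const[OF y, of k] w k by auto
    then show "x \<in> fl y" using k fc_in_fl[of k y] by auto
  qed
  have "reach a ({..<n} - ?J) w w'"
    by (rule fc_reach) (use w in auto)
  then have "(fl w, fl w') \<in> ?R\<^sup>*"
  proof (induction rule: reach_induct)
    case (step y i)
    have yW: "y \<in> W" using reach_closed[OF step.hyps(1)] w by auto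
    have "i_adjacent r (int i) (fl y) (fl (a i y))"
      using yW step.hyps(2) i_adjacent_iff by blast
    moreover have "C \<inter> D \<subseteq> fl y" "C \<inter> D \<subseteq> fl (a i y)"
      using inc step.hyps(1) reach_step[OF step.hyps] by auto
    ultimately have "(fl y, fl (a i y)) \<in> ?R" by blast
    then show ?case using step.IH by (rule rtrancl_into_rtrancl[rotated])
  qed auto
  then show "(C, D) \<in> ?R\<^sup>*" using w by simp
qed

lemma polytope: "polytope n r"
  unfolding polytope_def
proof (intro conjI)
  obtain w where w: "w \<in> W" using nonempty by auto
  show "Partial_order r" by (rule partial_order)
  show "\<exists>b\<in>Field r. \<forall>F\<in>Field r. (b, F) \<in> r"
  proof (intro bexI ballI)
    show "fc 0 w \<in> Field r" using w Field_eq by auto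
    fix F assume "F \<in> Field r"
    then show "(fc 0 w, F) \<in> r" using fc_bot[OF w] rel_fcI by (metis FieldE le0)
  qed
  show "\<exists>t\<in>Field r. \<forall>F\<in>Field r. (F, t) \<in> r"
  proof (intro bexI ballI)
    show "fc (n + 1) w \<in> Field r" using w Field_eq by auto
    fix F assume "F \<in> Field r"
    then show "(F, fc (n + 1) w) \<in> r" using fc_top[OF w] rel_fcI by (metis FieldE order_refl)
  qed
  show "\<forall>C\<in>flags r. card C = n + 2" by (auto simp: flags_eq card_fl)
  show "strongly_flag_connected r" by (rule strong_connectivity)
qed (use diamond in auto)

end

section \<open>Maps between flag models\<close>

lemma reach_hom:
  assumes "reach a I w w'" "flag_system n W a" "I \<subseteq> {..<n}" "w \<in> W"
    and "\<And>w i. w \<in> W \<Longrightarrow> i < n \<Longrightarrow> \<theta> (a i w) = a' i (\<theta> w)"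
  shows "reach a' I (\<theta> w) (\<theta> w')"
  using assms(1)
proof (induction rule: reach_induct)
  case (step y i)
  have "y \<in> W" using flag_system.reach_closed[OF assms(2) step.hyps(1) assms(3,4)] .
  then have "\<theta> (a i y) = a' i (\<theta> y)" using assms(3,5) step.hyps by blast
  then show ?case using reach_step[OF step.IH step.hyps(2)] by simp
qed simp

context flag_model
begin

text \<open>Equality of faces is thereby expressed by the colour action alone, with no reference to
  the poset; this is what makes maps between flags descend to faces.\<close>

lemma fc_eq_iff:
  assumes "w \<in> W" "w' \<in> W" "k \<le> n + 1"
  shows "fc k w = fc k w' \<longleftrightarrow> reach a {i. i < n \<and> Suc i \<noteq> k} w w'"
proof
  assume e: "fc k w = fc k w'"
  let ?J = "{i. i < n \<and> Suc i = k}"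
  have "reach a ({..<n} - ?J) w w'"
    by (rule fc_reach) (use assms e in auto)
  moreover have "{..<n} - ?J = {i. i < n \<and> Suc i \<noteq> k}" by auto
  ultimately show "reach a {i. i < n \<and> Suc i \<noteq> k} w w'" by simp
next
  assume "reach a {i. i < n \<and> Suc i \<noteq> k} w w'"
  then have "fc k w' = fc k w" by (rule fc_const) (use assms in auto)
  then show "fc k w = fc k w'" by simp
qed

lemma connected: "w \<in> W \<Longrightarrow> w' \<in> W \<Longrightarrow> reach a {..<n} w w'"
  using fc_reach[of w w' "{}"] by simp

lemma rel_fc_iff:
  assumes "w \<in> W" "w' \<in> W" "j \<le> n + 1" "k \<le> n + 1"
  shows "(fc j w, fc k w') \<in> r \<longleftrightarrow> j \<le> k \<and> (\<exists>z \<in> W. fc j z = fc j w \<and> fc k z = fc k w')"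
  using rel_fcD[OF _ assms] rel_fcI assms(4) by metis

text \<open>A face below a facet shares a flag with it and with every face below it, by \<open>glue\<close>.\<close>

lemma section_model:
  assumes n: "n = Suc m" and w0: "w0 \<in> W"
  shows "flag_model m {w \<in> W. fc n w = fc n w0} a (face_section r (fc n w0)) fc"
proof
  let ?W = "{w \<in> W. fc n w = fc n w0}"
  show "a i w \<in> ?W" if "w \<in> ?W" "i < m" for w i
    using that closed fc_step[of w i n] n by auto
  show "a i (a i w) = w" if "w \<in> ?W" "i < m" for w i
    using that invol n by auto
  show "a i (a j w) = a j (a i w)" if "w \<in> ?W" "j < m" "i + 2 \<le> j" for w i j
    using that comm[of w j i] n by auto
  show "?W \<noteq> {}" using w0 by auto
  show "(x, y) \<in> face_section r (fc n w0) \<longleftrightarrow>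
    (\<exists>w\<in>?W. \<exists>j k. j \<le> k \<and> k \<le> m + 1 \<and> x = fc j w \<and> y = fc k w)" for x y
  proof
    assume "(x, y) \<in> face_section r (fc n w0)"
    then have xy: "(x, y) \<in> r" "(y, fc n w0) \<in> r"
      by (auto simp: face_section_def under_def)
    then obtain w i j k where w: "w \<in> W" "i \<le> j" "j \<le> k" "k \<le> n + 1" "x = fc i w" "y = fc j w" "fc n w0 = fc k w"
      using rel_trans by metis
    then have "k = n" using fc_rank[of w0 w n k] w0 by auto
    then show "\<exists>w\<in>?W. \<exists>j k. j \<le> k \<and> k \<le> m + 1 \<and> x = fc j w \<and> y = fc k w"
      using w n by auto
  next
    assume "\<exists>w\<in>?W. \<exists>j k. j \<le> k \<and> k \<le> m + 1 \<and> x = fc j w \<and> y = fc k w"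
    then obtain w j k where w: "w \<in> W" "fc n w = fc n w0" "j \<le> k" "k \<le> n" "x = fc j w" "y = fc k w"
      using n by auto
    then show "(x, y) \<in> face_section r (fc n w0)"
      using rel_fcI[of w j k] rel_fcI[of w j n] rel_fcI[of w k n]
      by (auto simp: face_section_def under_def)
  qed
  show "j = k" if "w \<in> ?W" "w' \<in> ?W" "j \<le> m + 1" "k \<le> m + 1" "fc j w = fc k w'" for w w' j k
    using that fc_rank n by auto
  show "fc 0 w = fc 0 w'" if "w \<in> ?W" "w' \<in> ?W" for w w' using that fc_bot by auto
  show "fc (m + 1) w = fc (m + 1) w'" if "w \<in> ?W" "w' \<in> ?W" for w w' using that n by auto
  show "fc k (a i w) = fc k w \<longleftrightarrow> k \<noteq> Suc i" if "w \<in> ?W" "i < m" "k \<le> m + 1" for w i k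
    using that fc_step n by auto
  show "reach a ({..<m} - J) w w'"
    if "w \<in> ?W" "w' \<in> ?W" "J \<subseteq> {..<m}" "\<And>i. i \<in> J \<Longrightarrow> fc (Suc i) w = fc (Suc i) w'" for w w' J
  proof -
    have "reach a ({..<n} - insert m J) w w'"
      by (rule fc_reach) (use that n in auto)
    moreover have "{..<n} - insert m J = {..<m} - J" using n by auto
    ultimately show ?thesis by simp
  qed
qed

end

text \<open>The poset stays the same and only its flags are renamed; later the flags of the given
  polytope are renamed by pairs of a group element and a copy.\<close>

lemma flag_model_transport:
  assumes M: "flag_model n W a r fc" and S: "flag_system n W' a'" and b: "bij_betw \<theta> W' W"
    and eq: "\<And>w i. w \<in> W' \<Longrightarrow> i < n \<Longrightarrow> \<theta> (a' i w) = a i (\<theta> w)"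
  shows "flag_model n W' a' r (\<lambda>k w. fc k (\<theta> w))"
proof -
  interpret M: flag_model n W a r fc by (rule M)
  interpret S: flag_system n W' a' by (rule S)
  have im: "\<theta> ` W' = W" using b by (simp add: bij_betw_def)
  define \<theta>' where "\<theta>' = inv_into W' \<theta>"
  have \<theta>': "\<theta>' x \<in> W'" "\<theta> (\<theta>' x) = x" if "x \<in> W" for x
    using that im unfolding \<theta>'_def by (auto intro: inv_into_into f_inv_into_f)
  have \<theta>'\<theta>: "\<theta>' (\<theta> w) = w" if "w \<in> W'" for w
    using that b unfolding \<theta>'_def by (simp add: bij_betw_def)
  have \<theta>'eq: "\<theta>' (a i x) = a' i (\<theta>' x)" if "x \<in> W" "i < n" for x i
    using eq[of "\<theta>' x" i] \<theta>'[OF that(1)] \<theta>'\<theta>[of "a' i (\<theta>' x)"] S.closed that by auto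
  have W: "\<theta> w \<in> W" if "w \<in> W'" for w using im that by auto
  show ?thesis
  proof
    show "W' \<noteq> {}" using im M.nonempty by auto
    show "((x, y) \<in> r) = (\<exists>w\<in>W'. \<exists>j k. j \<le> k \<and> k \<le> n + 1 \<and> x = fc j (\<theta> w) \<and> y = fc k (\<theta> w))" for x y
      unfolding M.rel_iff im[symmetric] by (simp only: Set.bex_simps)
    show "j = k" if "w \<in> W'" "w' \<in> W'" "j \<le> n + 1" "k \<le> n + 1" "fc j (\<theta> w) = fc k (\<theta> w')" for w w' j k
      using M.fc_rank[OF W W] that by blast
    show "fc 0 (\<theta> w) = fc 0 (\<theta> w')" if "w \<in> W'" "w' \<in> W'" for w w'
      using M.fc_bot[OF W W] that by blast
    show "fc (n + 1) (\<theta> w) = fc (n + 1) (\<theta> w')" if "w \<in> W'" "w' \<in> W'" for w w'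
      using M.fc_top[OF W W] that by blast
    show "(fc k (\<theta> (a' i w)) = fc k (\<theta> w)) = (k \<noteq> Suc i)" if "w \<in> W'" "i < n" "k \<le> n + 1" for w i k
      using M.fc_step[OF W] that eq by simp
    show "reach a' ({..<n} - J) w w'"
      if "w \<in> W'" "w' \<in> W'" "J \<subseteq> {..<n}" "\<And>i. i \<in> J \<Longrightarrow> fc (Suc i) (\<theta> w) = fc (Suc i) (\<theta> w')" for w w' J
    proof -
      have "reach a ({..<n} - J) (\<theta> w) (\<theta> w')"
        by (rule M.fc_reach) (use that W in auto)
      then have "reach a' ({..<n} - J) (\<theta>' (\<theta> w)) (\<theta>' (\<theta> w'))"
        by (rule reach_hom[OF _ M.flag_system_axioms]) (use W that \<theta>'eq in auto)
      then show ?thesis using \<theta>'\<theta> that by simp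
    qed
  qed
qed

lemma flag_model_iso:
  assumes M: "flag_model n W a r fc" and M': "flag_model n W' a' r' fc'" and b: "bij_betw \<theta> W W'"
    and eq: "\<And>w i. w \<in> W \<Longrightarrow> i < n \<Longrightarrow> \<theta> (a i w) = a' i (\<theta> w)"
  obtains f where "bij_betw f (Field r) (Field r')"
    "\<And>x y. x \<in> Field r \<Longrightarrow> y \<in> Field r \<Longrightarrow> (x, y) \<in> r \<longleftrightarrow> (f x, f y) \<in> r'"
    "\<And>w k. w \<in> W \<Longrightarrow> k \<le> n + 1 \<Longrightarrow> f (fc k w) = fc' k (\<theta> w)"
proof -
  interpret M: flag_model n W a r fc by (rule M)
  \<comment> \<open>Both posets become models over the same flags and the same action, so
    \<open>fc_eq_iff\<close> expresses equality of faces by one condition for both.\<close>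
  interpret M': flag_model n W a r' "\<lambda>k w. fc' k (\<theta> w)"
    by (rule flag_model_transport[OF M' M.flag_system_axioms b eq])
  have same: "fc k w = fc k w' \<longleftrightarrow> fc' k (\<theta> w) = fc' k (\<theta> w')" if "w \<in> W" "w' \<in> W" "k \<le> n + 1" for w w' k
    using M.fc_eq_iff M'.fc_eq_iff that by simp
  define f where "f x = (THE y. \<exists>w \<in> W. \<exists>k \<le> n + 1. x = fc k w \<and> y = fc' k (\<theta> w))" for x
  have f: "f (fc k w) = fc' k (\<theta> w)" if w: "w \<in> W" and k: "k \<le> n + 1" for k w
    unfolding f_def
  proof (rule the_equality)
    show "\<exists>v\<in>W. \<exists>j\<le>n + 1. fc k w = fc j v \<and> fc' k (\<theta> w) = fc' j (\<theta> v)" using w k by blast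
    fix y assume "\<exists>v\<in>W. \<exists>j\<le>n + 1. fc k w = fc j v \<and> y = fc' j (\<theta> v)"
    then obtain v j where v: "v \<in> W" "j \<le> n + 1" "fc k w = fc j v" "y = fc' j (\<theta> v)" by blast
    then have "j = k" using M.fc_rank w k by metis
    then show "y = fc' k (\<theta> w)" using same[of w v k] v w k by simp
  qed
  have inj: "inj_on f (Field r)"
  proof (rule inj_onI)
    fix x y assume xy: "x \<in> Field r" "y \<in> Field r" and e: "f x = f y"
    obtain j v where v: "j \<le> n + 1" "v \<in> W" "x = fc j v" using xy(1) by (rule M.FieldE)
    obtain k w where w: "k \<le> n + 1" "w \<in> W" "y = fc k w" using xy(2) by (rule M.FieldE)
    note * = v(1) w(1) v(2) w(2) v(3) w(3)
    then have e': "fc' j (\<theta> v) = fc' k (\<theta> w)" using e f by metis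
    then have "j = k" by (rule M'.fc_rank[OF *(3,4,1,2)])
    then show "x = y" using same[of v w k] * e' by simp
  qed
  have surj: "f ` Field r = Field r'"
    unfolding M.Field_eq M'.Field_eq by (force simp: f image_iff)
  have rel: "(x, y) \<in> r \<longleftrightarrow> (f x, f y) \<in> r'" if xy: "x \<in> Field r" "y \<in> Field r" for x y
  proof -
    obtain j v where v: "j \<le> n + 1" "v \<in> W" "x = fc j v" using xy(1) by (rule M.FieldE)
    obtain k w where w: "k \<le> n + 1" "w \<in> W" "y = fc k w" using xy(2) by (rule M.FieldE)
    note * = v(1) w(1) v(2) w(2) v(3) w(3)
    show ?thesis
      using M.rel_fc_iff[OF *(3,4,1,2)] M'.rel_fc_iff[OF *(3,4,1,2)] same * f by auto
  qed
  show thesis using that inj surj rel f by (simp add: bij_betw_def)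
qed

text \<open>Used for an automorphism, where \<open>g\<close> tells at which position of the image
  flag a face of the original flag lands: the positions increase strictly and there is no room to
  skip one, so ranks are preserved.\<close>

lemma strict_increasing_bounded:
  fixes g :: "nat \<Rightarrow> nat"
  assumes "\<And>k. k < N \<Longrightarrow> g k < g (Suc k)" "g N \<le> N" "k \<le> N"
  shows "g k = k"
proof -
  have "k \<le> g k" if "k \<le> N" for k
    using that
  proof (induction k)
    case (Suc k)
    then show ?case using assms(1)[of k] by linarith
  qed simp
  moreover have "g (N - k) \<le> N - k" if "k \<le> N" for k
    using that
  proof (induction k)
    case (Suc k)
    then have "g (N - Suc k) < g (N - k)"
      using assms(1)[of "N - Suc k"] Suc_diff_Suc[of k N] by simp
    then show ?case using Suc by simp
  qed (use assms in simp)
  from this[of "N - k"] have "g k \<le> k" using assms by simp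
  ultimately show ?thesis using assms(3) by (simp add: le_antisym)
qed

section \<open>Automorphism groups and their action on flags\<close>

lemma perm_group_group: "group (perm_group S)"
proof (rule groupI)
  fix x assume "x \<in> carrier (perm_group S)"
  then show "\<exists>y\<in>carrier (perm_group S). y \<otimes>\<^bsub>perm_group S\<^esub> x = \<one>\<^bsub>perm_group S\<^esub>"
    using permutes_inv[of x S] permutes_inv_o[of x S] by (auto simp: perm_group_def)
qed (auto simp: perm_group_def permutes_compose permutes_id o_assoc)

lemma mult_perm_group: "x \<otimes>\<^bsub>perm_group S\<^esub> y = y \<circ> x"
  and one_perm_group: "\<one>\<^bsub>perm_group S\<^esub> = id"
  and carrier_perm_group: "f \<in> carrier (perm_group S) \<longleftrightarrow> f permutes S"
  by (auto simp: perm_group_def)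

lemma carrier_aut_group: "f \<in> carrier (aut_group r) \<longleftrightarrow> f permutes Field r \<and>
    (\<forall>x \<in> Field r. \<forall>y \<in> Field r. (x, y) \<in> r \<longleftrightarrow> (f x, f y) \<in> r)"
  and mult_aut_group: "f \<otimes>\<^bsub>aut_group r\<^esub> g = g \<circ> f"
  and one_aut_group: "\<one>\<^bsub>aut_group r\<^esub> = id"
  by (auto simp: aut_group_def perm_group_def)

lemma aut_group_group: "group (aut_group r)"
proof -
  interpret S: group "perm_group (Field r)" by (rule perm_group_group)
  have "subgroup (carrier (aut_group r)) (perm_group (Field r))"
  proof (rule S.subgroupI)
    show "carrier (aut_group r) \<subseteq> carrier (perm_group (Field r))"
      by (auto simp: carrier_aut_group carrier_perm_group)
    have "id \<in> carrier (aut_group r)" by (simp add: carrier_aut_group permutes_id)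
    then show "carrier (aut_group r) \<noteq> {}" by auto
  next
    fix f assume f: "f \<in> carrier (aut_group r)"
    then have p: "f permutes Field r" by (simp add: carrier_aut_group)
    have "inv_into UNIV f \<in> carrier (aut_group r)"
      unfolding carrier_aut_group
    proof (intro conjI ballI)
      show "inv_into UNIV f permutes Field r" using p by (rule permutes_inv)
      fix x y assume "x \<in> Field r" "y \<in> Field r"
      then have "inv_into UNIV f x \<in> Field r" "inv_into UNIV f y \<in> Field r"
        using permutes_in_image[OF permutes_inv[OF p]] by auto
      then have "(inv_into UNIV f x, inv_into UNIV f y) \<in> r \<longleftrightarrow> (f (inv_into UNIV f x), f (inv_into UNIV f y)) \<in> r"
        using f unfolding carrier_aut_group by blast
      then show "(x, y) \<in> r \<longleftrightarrow> (inv_into UNIV f x, inv_into UNIV f y) \<in> r"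
        using permutes_inverses(1)[OF p] by simp
    qed
    moreover have "inv\<^bsub>perm_group (Field r)\<^esub> f = inv_into UNIV f"
      by (rule S.inv_equality)
        (use p permutes_inv_o(1)[OF p] permutes_inv[OF p] in \<open>auto simp: mult_perm_group one_perm_group carrier_perm_group\<close>)
    ultimately show "inv\<^bsub>perm_group (Field r)\<^esub> f \<in> carrier (aut_group r)" by simp
  next
    fix f g assume fg: "f \<in> carrier (aut_group r)" "g \<in> carrier (aut_group r)"
    then have "f x \<in> Field r" if "x \<in> Field r" for x
      using that permutes_in_image[of f "Field r" x] by (simp add: carrier_aut_group)
    with fg have "g \<circ> f \<in> carrier (aut_group r)"
      unfolding carrier_aut_group by (auto intro: permutes_compose)
    then show "f \<otimes>\<^bsub>perm_group (Field r)\<^esub> g \<in> carrier (aut_group r)"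
      by (simp add: mult_perm_group)
  qed
  from S.subgroup_imp_group[OF this] show ?thesis
    by (simp add: aut_group_def)
qed

context flag_model
begin

text \<open>An automorphism maps a flag to a chain, which lies in a flag and occupies its positions
  in order. Adjacency is preserved because the images still agree in all faces but one and are
  distinct.\<close>

lemma aut_flag_map:
  assumes f: "f \<in> carrier (aut_group r)"
  obtains \<theta> where "\<And>w. w \<in> W \<Longrightarrow> \<theta> w \<in> W"
    "\<And>w k. w \<in> W \<Longrightarrow> k \<le> n + 1 \<Longrightarrow> f (fc k w) = fc k (\<theta> w)"
    "\<And>w i. w \<in> W \<Longrightarrow> i < n \<Longrightarrow> \<theta> (a i w) = a i (\<theta> w)"
proof -
  have p: "f permutes Field r" and
    rel: "\<And>x y. x \<in> Field r \<Longrightarrow> y \<in> Field r \<Longrightarrow> (x, y) \<in> r \<longleftrightarrow> (f x, f y) \<in> r"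
    using f by (auto simp: carrier_aut_group)
  have inj: "f x = f y \<Longrightarrow> x = y" for x y
    using permutes_inj[OF p] by (simp add: inj_def)
  have F: "fc k w \<in> Field r" if "w \<in> W" "k \<le> n + 1" for k w
    using that Field_eq by auto
  have ex: "\<exists>v \<in> W. \<forall>k \<le> n + 1. f (fc k w) = fc k v" if w: "w \<in> W" for w
  proof -
    have chain: "(f (fc j w), f (fc k w)) \<in> r" if "j \<le> k" "k \<le> n + 1" for j k
      using rel rel_fcI[OF w that] F[OF w] that by (metis le_trans)
    have "f ` fl w \<in> Chains r"
      unfolding Chains_def fl_def using chain by (auto simp: nle_le) (metis Suc_eq_plus1 nle_le chain)
    then obtain v where v: "v \<in> W" "f ` fl w \<subseteq> fl v" using chain_in_fl by blast
    have "\<exists>j. j \<le> n + 1 \<and> f (fc k w) = fc j v" if "k \<le> n + 1" for k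
      using v(2) fc_in_fl[OF that, of w] by (blast elim: fl_cases)
    then obtain g where g: "\<And>k. k \<le> n + 1 \<Longrightarrow> g k \<le> n + 1 \<and> f (fc k w) = fc (g k) v" by metis
    have "g k = k" if k: "k \<le> n + 1" for k
    proof (rule strict_increasing_bounded[OF _ _ k])
      show "g (n + 1) \<le> n + 1" using g by blast
      fix j assume j: "j < n + 1"
      have "(fc (g j) v, fc (g (Suc j)) v) \<in> r" using chain[of j "Suc j"] g[of j] g[of "Suc j"] j by auto
      then have "g j \<le> g (Suc j)" using rel_fcD[of "g j" v "g (Suc j)" v] g[of j] g[of "Suc j"] j v by auto
      moreover have "g j \<noteq> g (Suc j)"
      proof
        assume "g j = g (Suc j)"
        then have "fc j w = fc (Suc j) w" using g[of j] g[of "Suc j"] j inj by auto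
        then show False using fc_rank[of w w j "Suc j"] w j by auto
      qed
      ultimately show "g j < g (Suc j)" by simp
    qed
    then show ?thesis using g v by auto
  qed
  then obtain \<theta> where \<theta>: "\<And>w. w \<in> W \<Longrightarrow> \<theta> w \<in> W \<and> (\<forall>k \<le> n + 1. f (fc k w) = fc k (\<theta> w))" by metis
  have "\<theta> (a i w) = a i (\<theta> w)" if w: "w \<in> W" and i: "i < n" for w i
  proof -
    have aw: "a i w \<in> W" using closed w i .
    have "\<theta> (a i w) = \<theta> w \<or> \<theta> (a i w) = a i (\<theta> w)"
    proof (rule fc_eq_but_one)
      show "fc k (\<theta> w) = fc k (\<theta> (a i w))" if "1 \<le> k" "k \<le> n" "k \<noteq> Suc i" for k
        using \<theta>[OF w] \<theta>[OF aw] fc_step[OF w i, of k] that by (metis Suc_eq_plus1 le_SucI)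
    qed (use \<theta> w aw i in auto)
    moreover have "\<theta> (a i w) \<noteq> \<theta> w"
    proof
      assume "\<theta> (a i w) = \<theta> w"
      then have "f (fc (Suc i) (a i w)) = f (fc (Suc i) w)" using \<theta>[OF w] \<theta>[OF aw] i by auto
      then show False using inj fc_step[OF w i, of "Suc i"] i by auto
    qed
    ultimately show ?thesis by simp
  qed
  then show thesis using that \<theta> by blast
qed

lemma aut_image_fl:
  assumes "\<And>k. k \<le> n + 1 \<Longrightarrow> f (fc k w) = fc k v"
  shows "f ` fl w = fl v"
  unfolding fl_def image_image by (rule image_cong) (use assms in auto)

text \<open>The automorphism group acts freely on flags: agreement on one flag spreads along
  adjacencies to all flags, hence to all faces.\<close>

lemma aut_eqI:
  assumes f: "f \<in> carrier (aut_group r)" and g: "g \<in> carrier (aut_group r)"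
    and w: "w \<in> W" and e: "f ` fl w = g ` fl w"
  shows "f = g"
proof -
  obtain \<theta> where \<theta>: "\<And>w. w \<in> W \<Longrightarrow> \<theta> w \<in> W"
    "\<And>w k. w \<in> W \<Longrightarrow> k \<le> n + 1 \<Longrightarrow> f (fc k w) = fc k (\<theta> w)"
    "\<And>w i. w \<in> W \<Longrightarrow> i < n \<Longrightarrow> \<theta> (a i w) = a i (\<theta> w)"
    using aut_flag_map[OF f] by metis
  obtain \<eta> where \<eta>: "\<And>w. w \<in> W \<Longrightarrow> \<eta> w \<in> W"
    "\<And>w k. w \<in> W \<Longrightarrow> k \<le> n + 1 \<Longrightarrow> g (fc k w) = fc k (\<eta> w)"
    "\<And>w i. w \<in> W \<Longrightarrow> i < n \<Longrightarrow> \<eta> (a i w) = a i (\<eta> w)"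
    using aut_flag_map[OF g] by metis
  have "fl (\<theta> w) = f ` fl w" by (rule aut_image_fl[symmetric]) (rule \<theta>(2)[OF w])
  also note e
  also have "g ` fl w = fl (\<eta> w)" by (rule aut_image_fl) (rule \<eta>(2)[OF w])
  finally have "fl (\<theta> w) \<subseteq> fl (\<eta> w)" by (rule equalityD1)
  then have ew: "\<theta> w = \<eta> w" by (rule fl_eqD) (rule \<theta>(1)[OF w] \<eta>(1)[OF w])+
  have same: "\<theta> v = \<eta> v" if "v \<in> W" for v
    using connected[OF w that]
  proof (induction rule: reach_induct)
    case (step y i)
    then have "y \<in> W" using reach_closed[OF step.hyps(1)] w by simp
    then show ?case using \<theta>(3) \<eta>(3) step by simp
  qed (rule ew)
  show "f = g"
  proof
    fix x
    show "f x = g x"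
    proof (cases "x \<in> Field r")
      case True
      then obtain k v where "k \<le> n + 1" "v \<in> W" "x = fc k v" by (rule FieldE)
      then show ?thesis using \<theta>(2) \<eta>(2) same by simp
    next
      case False
      then show ?thesis using f g by (auto simp: carrier_aut_group permutes_not_in)
    qed
  qed
qed

lemma flag_map_aut:
  assumes b: "bij_betw \<theta> W W" and eq: "\<And>w i. w \<in> W \<Longrightarrow> i < n \<Longrightarrow> \<theta> (a i w) = a i (\<theta> w)"
  obtains f where "f \<in> carrier (aut_group r)"
    "\<And>w k. w \<in> W \<Longrightarrow> k \<le> n + 1 \<Longrightarrow> f (fc k w) = fc k (\<theta> w)"
proof -
  obtain f where f: "bij_betw f (Field r) (Field r)"
    "\<And>x y. x \<in> Field r \<Longrightarrow> y \<in> Field r \<Longrightarrow> (x, y) \<in> r \<longleftrightarrow> (f x, f y) \<in> r"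
    "\<And>w k. w \<in> W \<Longrightarrow> k \<le> n + 1 \<Longrightarrow> f (fc k w) = fc k (\<theta> w)"
    using flag_model_iso[OF flag_model_axioms flag_model_axioms b eq] by metis
  \<comment> \<open>Membership in the automorphism group demands the identity outside the field,
    where \<open>f\<close> is not controlled.\<close>
  define g where "g x = (if x \<in> Field r then f x else x)" for x
  have "bij_betw g (Field r) (Field r)"
    using f(1) by (rule bij_betw_cong[THEN iffD1, rotated]) (simp add: g_def)
  then have "g permutes Field r" by (rule bij_imp_permutes) (simp add: g_def)
  then have "g \<in> carrier (aut_group r)" using f(2) by (simp add: carrier_aut_group g_def)
  moreover have "g (fc k w) = fc k (\<theta> w)" if "w \<in> W" "k \<le> n + 1" for w k
    using that f(3) Field_eq by (auto simp: g_def)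
  ultimately show thesis using that by blast
qed

end

section \<open>Polytopes as flag models\<close>

text \<open>Faces are numbered by their position within one flag and not by
  \<open>face_rank\<close>: that a face has the same position in all flags through it is established
  only in \<open>pos_flag\<close>.\<close>

definition flag_face :: "'a rel \<Rightarrow> nat \<Rightarrow> 'a set \<Rightarrow> 'a" where
  "flag_face r k C = (THE x. x \<in> C \<and> card (underS r x \<inter> C) = k)"

locale polytope_flags =
  fixes n :: nat and r :: "'a rel"
  assumes poly: "polytope n r"
begin

abbreviation fc where "fc \<equiv> flag_face r"

abbreviation af where "af i \<equiv> adj_flag r (int i)"

abbreviation pos where "pos C x \<equiv> card (underS r x \<inter> C)"

lemma refl: "x \<in> Field r \<Longrightarrow> (x, x) \<in> r"
  and trans: "(x, y) \<in> r \<Longrightarrow> (y, z) \<in> r \<Longrightarrow> (x, z) \<in> r"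
  and antisym: "(x, y) \<in> r \<Longrightarrow> (y, x) \<in> r \<Longrightarrow> x = y"
  using poly unfolding polytope_def partial_order_on_def preorder_on_def refl_on_def
  by (blast, meson transD, meson antisymD)

lemma flag_chain: "C \<in> flags r \<Longrightarrow> C \<in> Chains r"
  and flag_max: "C \<in> flags r \<Longrightarrow> D \<in> Chains r \<Longrightarrow> C \<subseteq> D \<Longrightarrow> D = C"
  by (auto simp: flags_def)

lemma flag_card: "C \<in> flags r \<Longrightarrow> card C = n + 2"
  using poly by (auto simp: polytope_def)

lemma flag_finite: "C \<in> flags r \<Longrightarrow> finite C"
  using flag_card[of C] card_gt_0_iff[of C] by simp

lemma chain_total: "C \<in> Chains r \<Longrightarrow> x \<in> C \<Longrightarrow> y \<in> C \<Longrightarrow> (x, y) \<in> r \<or> (y, x) \<in> r"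
  by (auto simp: Chains_def)

lemma flag_refl: "C \<in> flags r \<Longrightarrow> x \<in> C \<Longrightarrow> (x, x) \<in> r"
  using chain_total flag_chain by blast

text \<open>Flags are the maximal chains, and a chain is known to be finite only once it lies in a
  flag; hence the appeal to Zorn.\<close>

lemma chain_in_flag:
  assumes "C \<in> Chains r"
  obtains D where "D \<in> flags r" "C \<subseteq> D"
proof -
  let ?A = "{D \<in> Chains r. C \<subseteq> D}"
  have "\<exists>M\<in>?A. \<forall>X\<in>?A. M \<subseteq> X \<longrightarrow> X = M"
  proof (rule subset_Zorn_nonempty)
    show "?A \<noteq> {}" using assms by auto
    fix X assume X: "X \<noteq> {}" "subset.chain ?A X"
    then have XA: "D \<in> Chains r" "C \<subseteq> D" if "D \<in> X" for D
      using that by (auto simp: subset.chain_def)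
    have XX: "D \<subseteq> E \<or> E \<subseteq> D" if "D \<in> X" "E \<in> X" for D E
      using X(2) that unfolding subset.chain_def by blast
    have "\<Union>X \<in> Chains r"
      unfolding Chains_def
    proof (intro CollectI ballI)
      fix x y assume "x \<in> \<Union>X" "y \<in> \<Union>X"
      then obtain D E where "D \<in> X" "E \<in> X" "x \<in> D" "y \<in> E" by blast
      then obtain D where "D \<in> X" "x \<in> D" "y \<in> D" using XX by blast
      then show "(x, y) \<in> r \<or> (y, x) \<in> r" using XA chain_total by blast
    qed
    then show "\<Union>X \<in> ?A" using XA X by blast
  qed
  then obtain M where M: "M \<in> ?A" "\<forall>X\<in>?A. M \<subseteq> X \<longrightarrow> X = M" by (rule bexE)
  then have "M \<in> flags r" "C \<subseteq> M" unfolding flags_def by (simp_all add: subset_trans[of C M])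
  then show thesis by (rule that)
qed

lemma chain_flag:
  assumes "C \<in> Chains r" "card C = n + 2"
  shows "C \<in> flags r"
proof -
  obtain D where "D \<in> flags r" "C \<subseteq> D" using chain_in_flag assms by blast
  then have "C = D" using card_subset_eq[of D C] flag_card flag_finite assms by auto
  then show ?thesis using \<open>D \<in> flags r\<close> by simp
qed

lemma pos_less:
  assumes C: "C \<in> flags r" and xy: "x \<in> C" "y \<in> C" "(x, y) \<in> r" "x \<noteq> y"
  shows "pos C x < pos C y"
proof (rule psubset_card_mono)
  show "finite (underS r y \<inter> C)" using flag_finite C by auto
  have "underS r x \<inter> C \<subseteq> underS r y \<inter> C"
    using xy trans antisym unfolding underS_def by blast
  moreover have "x \<in> underS r y \<inter> C" "x \<notin> underS r x \<inter> C"
    using xy by (auto simp: underS_def)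
  ultimately show "underS r x \<inter> C \<subset> underS r y \<inter> C" by blast
qed

lemma pos_le_iff:
  assumes C: "C \<in> flags r" and xy: "x \<in> C" "y \<in> C"
  shows "pos C x \<le> pos C y \<longleftrightarrow> (x, y) \<in> r"
proof (cases "x = y")
  case True
  then show ?thesis using flag_refl C xy by simp
next
  case False
  have "(x, y) \<in> r \<or> (y, x) \<in> r" using chain_total[OF flag_chain[OF C] xy] .
  then show ?thesis
    using pos_less[OF C xy] pos_less[OF C xy(2,1)] False by fastforce
qed

lemma pos_inj:
  assumes C: "C \<in> flags r" and xy: "x \<in> C" "y \<in> C" and e: "pos C x = pos C y"
  shows "x = y"
  using pos_le_iff[OF C xy] pos_le_iff[OF C xy(2,1)] e antisym by simp

lemma pos_bij:
  assumes C: "C \<in> flags r"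
  shows "bij_betw (pos C) C {..n + 1}"
proof -
  have inj: "inj_on (pos C) C" using pos_inj[OF C] by (rule inj_onI)
  have "pos C ` C \<subseteq> {..n + 1}"
  proof
    fix m assume "m \<in> pos C ` C"
    then obtain x where x: "x \<in> C" "m = pos C x" by blast
    have "pos C x \<le> card (C - {x})"
      by (rule card_mono) (use flag_finite[OF C] in \<open>auto simp: underS_def\<close>)
    then show "m \<in> {..n + 1}" using x flag_card[OF C] flag_finite[OF C] by simp
  qed
  moreover have "card (pos C ` C) = card {..n + 1}"
    using card_image[OF inj] flag_card[OF C] by simp
  ultimately have "pos C ` C = {..n + 1}" by (intro card_subset_eq) auto
  then show ?thesis using inj by (simp add: bij_betw_def)
qed

lemma pos_bound: "C \<in> flags r \<Longrightarrow> x \<in> C \<Longrightarrow> pos C x \<le> n + 1"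
  using bij_betwE[OF pos_bij] by auto

lemma fc_in:
  assumes C: "C \<in> flags r" and k: "k \<le> n + 1"
  shows "fc k C \<in> C" and "pos C (fc k C) = k"
proof -
  have "k \<in> pos C ` C" using pos_bij[OF C] k by (simp add: bij_betw_def)
  then obtain x where x: "x \<in> C \<and> pos C x = k" by blast
  have "fc k C \<in> C \<and> pos C (fc k C) = k"
    unfolding flag_face_def
    by (rule theI[of _ x]) (use x pos_inj[OF C] in auto)
  then show "fc k C \<in> C" "pos C (fc k C) = k" by auto
qed

lemma fc_eqI: "C \<in> flags r \<Longrightarrow> x \<in> C \<Longrightarrow> pos C x = k \<Longrightarrow> fc k C = x"
  using fc_in[of C k] pos_bound[of C x] pos_inj[of C "fc k C" x] by simp

lemma fc_pos: "C \<in> flags r \<Longrightarrow> x \<in> C \<Longrightarrow> fc (pos C x) C = x"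
  by (rule fc_eqI) auto

lemma flag_fc:
  assumes "C \<in> flags r"
  shows "C = (\<lambda>k. fc k C) ` {..n + 1}"
proof (intro equalityI subsetI)
  fix x assume "x \<in> C"
  then show "x \<in> (\<lambda>k. fc k C) ` {..n + 1}"
    using fc_pos[OF assms, of x] pos_bound[OF assms, of x] by (metis atMost_iff image_eqI)
qed (use fc_in[OF assms] in auto)

lemma flag_eqI:
  assumes "C \<in> flags r" "D \<in> flags r" "\<And>k. k \<le> n + 1 \<Longrightarrow> fc k C = fc k D"
  shows "C = D"
proof -
  have "(\<lambda>k. fc k C) ` {..n + 1} = (\<lambda>k. fc k D) ` {..n + 1}"
    by (rule image_cong) (use assms in auto)
  then show ?thesis using flag_fc[OF assms(1)] flag_fc[OF assms(2)] by simp
qed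

text \<open>The part of \<open>C\<close> below \<open>x\<close> and the part of \<open>D\<close>
  from \<open>x\<close> upwards form a chain, and every chain has at most \<open>n + 2\<close>
  elements. The part of \<open>D\<close> accounts for all but \<open>pos D x\<close> of them, so
  \<open>C\<close> cannot have more faces below \<open>x\<close>.\<close>

lemma pos_flag_le:
  assumes C: "C \<in> flags r" and D: "D \<in> flags r" and x: "x \<in> C" "x \<in> D"
  shows "pos C x \<le> pos D x"
proof -
  let ?A = "underS r x \<inter> C" and ?B = "{y \<in> D. (x, y) \<in> r}"
  have CD: "(y, z) \<in> r \<or> (z, y) \<in> r" if "y \<in> C \<and> z \<in> C \<or> y \<in> D \<and> z \<in> D" for y z
    using that chain_total flag_chain C D by blast
  have AB: "(y, z) \<in> r" if "y \<in> ?A" "z \<in> ?B" for y z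
    using that trans[of y x z] by (auto simp: underS_def)
  have "?A \<union> ?B \<in> Chains r"
    unfolding Chains_def using CD AB by blast
  then obtain E where E: "E \<in> flags r" "?A \<union> ?B \<subseteq> E" by (rule chain_in_flag)
  have fin: "finite ?A" "finite ?B" using flag_finite C D by auto
  have "?A \<inter> ?B = {}" using antisym by (auto simp: underS_def)
  then have "card ?A + card ?B = card (?A \<union> ?B)" using card_Un_disjoint[OF fin] by simp
  also have "\<dots> \<le> n + 2" using card_mono[OF flag_finite[OF E(1)] E(2)] flag_card[OF E(1)] by simp
  finally have 1: "card ?A + card ?B \<le> n + 2" .
  have "(underS r x \<inter> D) \<union> ?B = D" using CD[of x] x flag_refl[OF D x(2)] by (auto simp: underS_def)
  moreover have "(underS r x \<inter> D) \<inter> ?B = {}" using antisym by (auto simp: underS_def)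
  ultimately have "pos D x + card ?B = n + 2"
    using card_Un_disjoint[of "underS r x \<inter> D" ?B] flag_finite[OF D] flag_card[OF D] by simp
  with 1 show ?thesis by simp
qed

lemma pos_flag: "C \<in> flags r \<Longrightarrow> D \<in> flags r \<Longrightarrow> x \<in> C \<Longrightarrow> x \<in> D \<Longrightarrow> pos C x = pos D x"
  by (intro le_antisym pos_flag_le)

lemma fc_transfer:
  assumes "C \<in> flags r" "D \<in> flags r" "k \<le> n + 1" "fc k C \<in> D"
  shows "fc k D = fc k C"
  by (rule fc_eqI) (use assms pos_flag[of D C "fc k C"] fc_in[of C k] in auto)

lemma face_rank_pos:
  assumes C: "C \<in> flags r" and x: "x \<in> C"
  shows "face_rank r x = int (pos C x) - 1"
  unfolding face_rank_def
proof (rule the_equality)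
  show "\<forall>D\<in>flags r. x \<in> D \<longrightarrow> int (pos D x) = int (pos C x) - 1 + 1"
    using pos_flag[OF C] x by auto
  fix i assume "\<forall>D\<in>flags r. x \<in> D \<longrightarrow> int (pos D x) = i + 1"
  then show "i = int (pos C x) - 1" using C x by force
qed

lemma face_rank_fc: "C \<in> flags r \<Longrightarrow> k \<le> n + 1 \<Longrightarrow> face_rank r (fc k C) = int k - 1"
  using face_rank_pos fc_in by simp

lemma fc_rel_iff:
  assumes "C \<in> flags r" "j \<le> n + 1" "k \<le> n + 1"
  shows "(fc j C, fc k C) \<in> r \<longleftrightarrow> j \<le> k"
  using pos_le_iff[of C "fc j C" "fc k C"] fc_in assms by simp

lemma fc_inj:
  assumes "C \<in> flags r" "D \<in> flags r" "j \<le> n + 1" "k \<le> n + 1" "fc j C = fc k D"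
  shows "j = k"
  using face_rank_fc[OF assms(1,3)] face_rank_fc[OF assms(2,4)] assms(5) by simp

lemma rel_iff: "(x, y) \<in> r \<longleftrightarrow> (\<exists>C\<in>flags r. \<exists>j k. j \<le> k \<and> k \<le> n + 1 \<and> x = fc j C \<and> y = fc k C)"
proof
  assume xy: "(x, y) \<in> r"
  then have "(x, x) \<in> r" "(y, y) \<in> r" using refl by (auto simp: Field_def)
  then have "{x, y} \<in> Chains r" using xy by (auto simp: Chains_def)
  then obtain C where C: "C \<in> flags r" "{x, y} \<subseteq> C" by (rule chain_in_flag)
  then have "x = fc (pos C x) C" "y = fc (pos C y) C" "pos C x \<le> pos C y" "pos C y \<le> n + 1"
    using fc_pos[of C] pos_le_iff[of C x y] xy pos_bound[of C y] by auto
  then show "\<exists>C\<in>flags r. \<exists>j k. j \<le> k \<and> k \<le> n + 1 \<and> x = fc j C \<and> y = fc k C"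
    using C by blast
next
  assume "\<exists>C\<in>flags r. \<exists>j k. j \<le> k \<and> k \<le> n + 1 \<and> x = fc j C \<and> y = fc k C"
  then obtain C j k where "C \<in> flags r" "j \<le> k" "k \<le> n + 1" "x = fc j C" "y = fc k C" by blast
  then show "(x, y) \<in> r" using fc_rel_iff[of C j k] by simp
qed

lemma extremal_in_flag:
  assumes C: "C \<in> flags r" and b: "b \<in> Field r" and cmp: "\<And>x. x \<in> Field r \<Longrightarrow> (b, x) \<in> r \<or> (x, b) \<in> r"
  shows "b \<in> C"
proof -
  have "C \<subseteq> Field r" using flag_refl[OF C] by (auto simp: Field_def)
  then have "insert b C \<in> Chains r"
    using flag_chain[OF C] cmp refl[OF b] by (auto simp: Chains_def)
  then have "insert b C = C" using flag_max[OF C] by blast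
  then show ?thesis by blast
qed

lemma flag_sub_Field: "C \<in> flags r \<Longrightarrow> C \<subseteq> Field r"
  using flag_refl by (auto simp: Field_def)

lemma fc_bot:
  assumes "C \<in> flags r" "D \<in> flags r"
  shows "fc 0 C = fc 0 D"
proof -
  obtain b where b: "b \<in> Field r" "\<And>x. x \<in> Field r \<Longrightarrow> (b, x) \<in> r"
    using poly unfolding polytope_def by blast
  have "fc 0 C = b" if C: "C \<in> flags r" for C
  proof (rule fc_eqI[OF C])
    show "b \<in> C" by (rule extremal_in_flag[OF C]) (use b in auto)
    have "underS r b \<inter> C = {}"
      using b(2) antisym flag_sub_Field[OF C] unfolding underS_def by blast
    then show "pos C b = 0" by simp
  qed
  then show ?thesis using assms by simp
qed

lemma fc_top:
  assumes "C \<in> flags r" "D \<in> flags r"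
  shows "fc (n + 1) C = fc (n + 1) D"
proof -
  obtain t where t: "t \<in> Field r" "\<And>x. x \<in> Field r \<Longrightarrow> (x, t) \<in> r"
    using poly unfolding polytope_def by blast
  have "fc (n + 1) C = t" if C: "C \<in> flags r" for C
  proof (rule fc_eqI[OF C])
    show tC: "t \<in> C" by (rule extremal_in_flag[OF C]) (use t in auto)
    have "underS r t \<inter> C = C - {t}"
      using t(2) flag_sub_Field[OF C] unfolding underS_def by blast
    then show "pos C t = n + 1" using flag_card[OF C] flag_finite[OF C] tC by simp
  qed
  then show ?thesis using assms by simp
qed

section \<open>Adjacent flags from the diamond condition\<close>

definition between :: "'a set \<Rightarrow> nat \<Rightarrow> 'a set" where
  "between C i = {H. H \<noteq> fc i C \<and> H \<noteq> fc (i + 2) C \<and> (fc i C, H) \<in> r \<and> (H, fc (i + 2) C) \<in> r}"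

lemma card_between:
  assumes "C \<in> flags r" "i < n"
  shows "card (between C i) = 2"
proof -
  have "(fc i C, fc (i + 2) C) \<in> r" using fc_rel_iff assms by simp
  moreover have "face_rank r (fc (i + 2) C) = face_rank r (fc i C) + 2"
    using face_rank_fc[OF assms(1), of i] face_rank_fc[OF assms(1), of "i + 2"] assms by simp
  ultimately show ?thesis
    using poly unfolding polytope_def between_def by blast
qed

lemma fc_between:
  assumes "C \<in> flags r" "i < n"
  shows "fc (Suc i) C \<in> between C i"
  using assms fc_inj[of C C "Suc i" i] fc_inj[of C C "Suc i" "i + 2"]
  by (auto simp: between_def fc_rel_iff)

lemma between_unique:
  assumes "C \<in> flags r" "i < n" "x \<in> between C i" "y \<in> between C i" "x \<noteq> fc (Suc i) C" "y \<noteq> fc (Suc i) C"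
  shows "x = y"
proof -
  obtain u v where uv: "between C i = {u, v}"
    using card_between[OF assms(1,2)] by (auto simp: card_2_iff)
  then show ?thesis using fc_between[OF assms(1,2)] assms(3-6) by auto
qed

lemma between_cong:
  "fc i C = fc i D \<Longrightarrow> fc (i + 2) C = fc (i + 2) D \<Longrightarrow> between C i = between D i"
  by (simp add: between_def)

lemma exchange:
  assumes C: "C \<in> flags r" and i: "i < n" and y: "y \<in> between C i" "y \<noteq> fc (Suc i) C"
  obtains D where "D \<in> flags r" "fc (Suc i) D = y"
    "\<And>k. k \<le> n + 1 \<Longrightarrow> k \<noteq> Suc i \<Longrightarrow> fc k D = fc k C"
proof -
  let ?x = "fc (Suc i) C" and ?F = "fc i C" and ?G = "fc (i + 2) C"
  let ?D = "insert y (C - {?x})"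
  have xC: "?x \<in> C" using fc_in[OF C, of "Suc i"] i by simp
  have FG: "?F \<in> C" "?G \<in> C" using fc_in[OF C] i by auto
  have yb: "y \<noteq> ?F" "y \<noteq> ?G" "(?F, y) \<in> r" "(y, ?G) \<in> r" using y by (auto simp: between_def)
  have cmp: "(z, y) \<in> r \<or> (y, z) \<in> r" if z: "z \<in> C" "z \<noteq> ?x" for z
  proof -
    have "pos C z \<noteq> Suc i" using fc_pos[OF C z(1)] z(2) by metis
    then consider "pos C z \<le> i" | "i + 2 \<le> pos C z" by linarith
    then show ?thesis
    proof cases
      case 1
      then have "(z, ?F) \<in> r" using pos_le_iff[OF C z(1) FG(1)] fc_in[OF C, of i] i by simp
      then show ?thesis using trans yb by blast
    next
      case 2
      then have "(?G, z) \<in> r" using pos_le_iff[OF C FG(2) z(1)] fc_in[OF C, of "i + 2"] i by simp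
      then show ?thesis using trans yb by blast
    qed
  qed
  have yC: "y \<notin> C"
  proof
    assume yC: "y \<in> C"
    have "pos C ?F < pos C y" "pos C y < pos C ?G"
      using pos_less[OF C FG(1) yC] pos_less[OF C yC FG(2)] yb by auto
    then have "pos C y = Suc i" using fc_in[OF C, of i] fc_in[OF C, of "i + 2"] i by simp
    then show False using fc_pos[OF C yC] y by simp
  qed
  have "(y, y) \<in> r" using refl yb by (auto simp: Field_def)
  then have "?D \<in> Chains r"
    using cmp flag_chain[OF C] by (auto simp: Chains_def)
  moreover have "card ?D = n + 2"
    using yC xC flag_card[OF C] flag_finite[OF C] by simp
  ultimately have D: "?D \<in> flags r" by (rule chain_flag)
  have k: "fc k ?D = fc k C" if "k \<le> n + 1" "k \<noteq> Suc i" for k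
  proof (rule fc_transfer[OF C D that(1)])
    show "fc k C \<in> ?D" using fc_in[OF C that(1)] fc_inj[OF C C that(1), of "Suc i"] that i by auto
  qed
  \<comment> \<open>All other positions of the new flag are taken by faces of \<open>C\<close>, and
    \<open>y\<close> is not one of them.\<close>
  have "pos ?D y = Suc i"
  proof (rule ccontr)
    assume *: "pos ?D y \<noteq> Suc i"
    have "pos ?D y \<le> n + 1" using pos_bound[OF D] by simp
    then have "fc (pos ?D y) C = y" using k * fc_pos[OF D, of y] by simp
    then show False using yC fc_in(1)[OF C, of "pos ?D y"] \<open>pos ?D y \<le> n + 1\<close> by simp
  qed
  then have "fc (Suc i) ?D = y" using fc_eqI[OF D, of y] by simp
  then show thesis using that D k by blast
qed

lemma flag_unique:
  assumes C: "C \<in> flags r" and i: "i < n" and D: "D \<in> flags r" and E: "E \<in> flags r"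
    and eD: "\<And>k. k \<le> n + 1 \<Longrightarrow> k \<noteq> Suc i \<Longrightarrow> fc k D = fc k C"
    and eE: "\<And>k. k \<le> n + 1 \<Longrightarrow> k \<noteq> Suc i \<Longrightarrow> fc k E = fc k C"
    and ne: "D \<noteq> C" "E \<noteq> C"
  shows "D = E"
proof -
  have ne': "fc (Suc i) X \<noteq> fc (Suc i) C" if "X \<in> flags r" "X \<noteq> C"
    "\<And>k. k \<le> n + 1 \<Longrightarrow> k \<noteq> Suc i \<Longrightarrow> fc k X = fc k C" for X
    using flag_eqI[OF that(1) C] that by metis
  have "between D i = between C i" "between E i = between C i"
    by (rule between_cong; use eD eE i in simp)+
  then have "fc (Suc i) D = fc (Suc i) E"
    using between_unique[OF C i] fc_between[OF D i] fc_between[OF E i] ne'[OF D] ne'[OF E] ne eD eE by metis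
  then show ?thesis using flag_eqI[OF D E] eD eE by metis
qed

lemma i_adjacentI:
  assumes C: "C \<in> flags r" and D: "D \<in> flags r" and ne: "D \<noteq> C"
    and e: "\<And>k. k \<le> n + 1 \<Longrightarrow> k \<noteq> Suc i \<Longrightarrow> fc k D = fc k C"
  shows "i_adjacent r (int i) C D"
proof -
  have sub: "{F \<in> X. face_rank r F \<noteq> int i} \<subseteq> {F \<in> Y. face_rank r F \<noteq> int i}"
    if X: "X \<in> flags r" and Y: "Y \<in> flags r" and XY: "\<And>k. k \<le> n + 1 \<Longrightarrow> k \<noteq> Suc i \<Longrightarrow> fc k X = fc k Y" for X Y
  proof
    fix F assume F: "F \<in> {F \<in> X. face_rank r F \<noteq> int i}"
    then have "pos X F \<noteq> Suc i" using face_rank_pos[OF X, of F] by auto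
    then have "F = fc (pos X F) Y" using XY pos_bound[OF X, of F] fc_pos[OF X, of F] F by simp
    then have "F \<in> Y" using fc_in(1)[OF Y, of "pos X F"] pos_bound[OF X, of F] F by simp
    then show "F \<in> {F \<in> Y. face_rank r F \<noteq> int i}" using F by simp
  qed
  show ?thesis
    unfolding i_adjacent_def
  proof (intro conjI equalityI)
    show "{F \<in> C. face_rank r F \<noteq> int i} \<subseteq> {F \<in> D. face_rank r F \<noteq> int i}"
      by (rule sub[OF C D]) (use e in auto)
    show "{F \<in> D. face_rank r F \<noteq> int i} \<subseteq> {F \<in> C. face_rank r F \<noteq> int i}"
      by (rule sub[OF D C]) (use e in auto)
  qed (use assms in auto)
qed

lemma i_adjacentD:
  assumes adj: "i_adjacent r i C D"
  obtains j where "j < n" "i = int j" "\<And>k. k \<le> n + 1 \<Longrightarrow> k \<noteq> Suc j \<Longrightarrow> fc k D = fc k C"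
    "C \<in> flags r" "D \<in> flags r" "D \<noteq> C"
proof -
  have CD: "C \<in> flags r" "D \<in> flags r" "C \<noteq> D" and
    e: "{F \<in> C. face_rank r F \<noteq> i} = {F \<in> D. face_rank r F \<noteq> i}"
    using adj unfolding i_adjacent_def by blast+
  have eq: "fc k D = fc k C" if k: "k \<le> n + 1" "int k - 1 \<noteq> i" for k
  proof (rule fc_transfer[OF CD(1,2) k(1)])
    have "fc k C \<in> {F \<in> C. face_rank r F \<noteq> i}"
      using face_rank_fc[OF CD(1) k(1)] fc_in(1)[OF CD(1) k(1)] k(2) by simp
    then show "fc k C \<in> D" using e by blast
  qed
  obtain k where k: "k \<le> n + 1" "fc k D \<noteq> fc k C" using flag_eqI[OF CD(2,1)] CD(3) by metis
  then have "int k - 1 = i" "k \<noteq> 0" "k \<noteq> n + 1"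
    using eq fc_bot[OF CD(1,2)] fc_top[OF CD(1,2)] by metis+
  then have "k - 1 < n" "i = int (k - 1)" using k by auto
  then show thesis using that[of "k - 1"] eq CD by force
qed

lemma adj_flag:
  assumes C: "C \<in> flags r" and i: "i < n"
  shows "af i C \<in> flags r" (is ?A)
    and "k \<le> n + 1 \<Longrightarrow> fc k (af i C) = fc k C \<longleftrightarrow> k \<noteq> Suc i" (is "_ \<Longrightarrow> ?B")
    and "D \<in> flags r \<Longrightarrow> D \<noteq> C \<Longrightarrow> (\<And>k. k \<le> n + 1 \<Longrightarrow> k \<noteq> Suc i \<Longrightarrow> fc k D = fc k C)
      \<Longrightarrow> D = af i C"
proof -
  obtain u v where uv: "between C i = {u, v}" "u \<noteq> v"
    using card_between[OF C i] by (auto simp: card_2_iff)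
  then obtain y where y: "y \<in> between C i" "y \<noteq> fc (Suc i) C" by blast
  obtain E where E: "E \<in> flags r" "fc (Suc i) E = y"
    "\<And>k. k \<le> n + 1 \<Longrightarrow> k \<noteq> Suc i \<Longrightarrow> fc k E = fc k C"
    using exchange[OF C i y] by metis
  have EC: "E \<noteq> C" using E y by auto
  have "af i C = E"
    unfolding adj_flag_def
  proof (rule the_equality)
    show "i_adjacent r (int i) C E" by (rule i_adjacentI[OF C E(1) EC E(3)])
    fix D assume "i_adjacent r (int i) C D"
    then obtain j where "i = j" "\<And>k. k \<le> n + 1 \<Longrightarrow> k \<noteq> Suc j \<Longrightarrow> fc k D = fc k C" "D \<in> flags r" "D \<noteq> C"
      by (rule i_adjacentD) simp
    then show "D = E" using flag_unique[OF C i, of D E] E EC by blast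
  qed
  note adj = this
  show ?A using adj E by simp
  show ?B if "k \<le> n + 1" using adj E y that by auto
  show "D = af i C" if "D \<in> flags r" "D \<noteq> C" "\<And>k. k \<le> n + 1 \<Longrightarrow> k \<noteq> Suc i \<Longrightarrow> fc k D = fc k C"
    unfolding adj by (rule flag_unique[OF C i that(1) E(1)]) (use that E EC in auto)
qed

text \<open>The new face depends only on the face it replaces and on the two neighbours of that face
  in the flag. Colours at distance two or more do not touch these three faces, which is why they
  commute.\<close>

lemma adj_flag_local:
  assumes C: "C \<in> flags r" and D: "D \<in> flags r" and i: "i < n"
    and e: "fc i C = fc i D" "fc (Suc i) C = fc (Suc i) D" "fc (i + 2) C = fc (i + 2) D"
  shows "fc (Suc i) (af i C) = fc (Suc i) (af i D)"
proof (rule between_unique[OF C i])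
  have *: "fc (Suc i) (af i X) \<in> between X i"
    "fc (Suc i) (af i X) \<noteq> fc (Suc i) X" if X: "X \<in> flags r" for X
  proof -
    have "between (af i X) i = between X i"
      by (rule between_cong; use adj_flag(2)[OF X i] i in simp)
    then show "fc (Suc i) (af i X) \<in> between X i"
      using fc_between[OF adj_flag(1)[OF X i] i] by simp
    show "fc (Suc i) (af i X) \<noteq> fc (Suc i) X"
      using adj_flag(2)[OF X i, of "Suc i"] i by simp
  qed
  show "fc (Suc i) (af i C) \<in> between C i"
    "fc (Suc i) (af i C) \<noteq> fc (Suc i) C" using * C by auto
  show "fc (Suc i) (af i D) \<in> between C i" using *(1)[OF D] between_cong[OF e(1,3)] by simp
  show "fc (Suc i) (af i D) \<noteq> fc (Suc i) C" using *(2)[OF D] e by simp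
qed

lemma adj_flag_comm:
  assumes C: "C \<in> flags r" and ij: "j < n" "i + 2 \<le> j"
  shows "af i (af j C) = af j (af i C)"
proof -
  have i: "i < n" using ij by simp
  note F = adj_flag(1)[OF C i] adj_flag(1)[OF C ij(1)]
  note fcs = adj_flag(2)[OF C i] adj_flag(2)[OF C ij(1)] adj_flag(2)[OF F(1) ij(1)] adj_flag(2)[OF F(2) i]
  show ?thesis
  proof (rule flag_eqI[OF adj_flag(1)[OF F(2) i] adj_flag(1)[OF F(1) ij(1)]])
    fix k assume k: "k \<le> n + 1"
    consider "k = Suc i" | "k = Suc j" | "k \<noteq> Suc i" "k \<noteq> Suc j" by blast
    then show "fc k (af i (af j C)) = fc k (af j (af i C))"
    proof cases
      case 1
      have "fc (Suc i) (af i (af j C)) = fc (Suc i) (af i C)"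
        by (rule adj_flag_local[OF F(2) C i]; use fcs ij i in simp)
      also have "\<dots> = fc (Suc i) (af j (af i C))" using fcs(3)[of "Suc i"] i ij by simp
      finally show ?thesis using 1 by simp
    next
      case 2
      have "fc (Suc j) (af j (af i C)) = fc (Suc j) (af j C)"
        by (rule adj_flag_local[OF F(1) C ij(1)]; use fcs ij i in simp)
      also have "\<dots> = fc (Suc j) (af i (af j C))" using fcs(4)[of "Suc j"] ij by simp
      finally show ?thesis using 2 by simp
    next
      case 3
      then show ?thesis using fcs[OF k] by metis
    qed
  qed
qed

lemma adj_flag_invol:
  assumes C: "C \<in> flags r" and i: "i < n"
  shows "af i (af i C) = C"
proof (rule adj_flag(3)[OF adj_flag(1)[OF C i] i C, symmetric])
  show "C \<noteq> af i C" using adj_flag(2)[OF C i, of "Suc i"] i by auto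
  show "fc k C = fc k (af i C)" if "k \<le> n + 1" "k \<noteq> Suc i" for k
    using adj_flag(2)[OF C i that(1)] that by simp
qed

lemma flags_reach:
  assumes C: "C \<in> flags r" and D: "D \<in> flags r"
    and e: "\<And>i. i \<in> J \<Longrightarrow> fc (Suc i) C = fc (Suc i) D"
  shows "reach af ({..<n} - J) C D"
proof -
  have "(C, D) \<in> {(X, Y). (\<exists>i. i_adjacent r i X Y) \<and> C \<inter> D \<subseteq> X \<and> C \<inter> D \<subseteq> Y}\<^sup>*"
    using poly C D unfolding polytope_def strongly_flag_connected_def by blast
  then show ?thesis
  proof (induction rule: rtrancl_induct)
    case (step X Y)
    then obtain i where "i_adjacent r i X Y" and sub: "C \<inter> D \<subseteq> X" "C \<inter> D \<subseteq> Y" by blast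
    then obtain j where j: "j < n" "\<And>k. k \<le> n + 1 \<Longrightarrow> k \<noteq> Suc j \<Longrightarrow> fc k Y = fc k X"
      and XY: "X \<in> flags r" "Y \<in> flags r" "Y \<noteq> X"
      by (metis i_adjacentD)
    have "Y = af j X" using adj_flag(3)[OF XY(1) j(1) XY(2,3)] j(2) by blast
    \<comment> \<open>A step in a colour of \<open>J\<close> would replace a face that
      \<open>C\<close> and \<open>D\<close> share, but all flags on the path contain the shared
      faces.\<close>
    moreover have "j \<notin> J"
    proof
      assume "j \<in> J"
      have jn: "Suc j \<le> n + 1" using j by simp
      have "fc (Suc j) C \<in> C \<inter> D"
        using fc_in(1)[OF C jn] fc_in(1)[OF D jn] e[OF \<open>j \<in> J\<close>] by simp
      then have "fc (Suc j) X = fc (Suc j) C" "fc (Suc j) Y = fc (Suc j) C"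
        using fc_transfer[OF C XY(1) jn] fc_transfer[OF C XY(2) jn] sub by blast+
      then have "X = Y" using flag_eqI[OF XY(1,2)] j(2) by metis
      then show False using XY by simp
    qed
    ultimately show ?case using reach_step[OF step.IH, of j] j(1) by simp
  qed simp
qed

lemma flag_model: "flag_model n (flags r) af r fc"
proof
  obtain C where "C \<in> flags r" using chain_in_flag[of "{}"] by (auto simp: Chains_def)
  then show "flags r \<noteq> {}" by auto
  show "reach af ({..<n} - J) C D"
    if "C \<in> flags r" "D \<in> flags r" "J \<subseteq> {..<n}" "\<And>i. i \<in> J \<Longrightarrow> fc (Suc i) C = fc (Suc i) D" for C D J
    by (rule flags_reach) (use that in auto)
qed (fact adj_flag(1) adj_flag_invol adj_flag_comm rel_iff fc_inj fc_bot fc_top adj_flag(2))+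

lemma fl_flag: "C \<in> flags r \<Longrightarrow> flag_model.fl n fc C = C"
  using flag_fc flag_model.fl_def[OF flag_model] by metis

end

section \<open>Polytopes from rotation groups\<close>

text \<open>
  Splitting a path at the least colour of \<open>J\<close> reduces the intersection property for arbitrary sets
  of colours to the one for an initial and a final interval.
\<close>

locale interval_flag_system = flag_system +
  assumes interval_ip: "\<lbrakk>w \<in> W; w' \<in> W; k \<le> n; reach a {..<k} w w'; reach a {j..<n} w w'\<rbrakk> \<Longrightarrow> reach a {j..<k} w w'"
begin

lemma intersection_from:
  assumes "w \<in> W" "w' \<in> W" "m \<le> n" "reach a {m..<n} w w'"
    and "\<And>i. i \<in> J \<Longrightarrow> reach a ({..<n} - {i}) w w'" and J: "J \<subseteq> {..<n}"
  shows "reach a ({..<n} - J) w w'"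
  using assms(1-5)
proof (induction "n - m" arbitrary: m w rule: less_induct)
  case less
  show ?case
  proof (cases "\<exists>j \<in> J. m \<le> j")
    case False
    then have "{m..<n} \<subseteq> {..<n} - J" by auto
    then show ?thesis by (rule reach_mono[OF less.prems(4)])
  next
    case True
    define j where "j = (LEAST j. j \<in> J \<and> m \<le> j)"
    have j: "j \<in> J \<and> m \<le> j" unfolding j_def by (rule LeastI_ex) (use True in blast)
    have low: "i \<notin> J" if "m \<le> i" "i < j" for i
      using not_less_Least[of i "\<lambda>j. j \<in> J \<and> m \<le> j"] that unfolding j_def by blast
    have jn: "j < n" using j J by auto
    have "{..<n} - {j} = {..<j} \<union> {Suc j..<n}" using jn by auto
    then have "reach a ({..<j} \<union> {Suc j..<n}) w w'" using less.prems(5)[of j] j by simp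
    then have "reach a ({..<j} \<union> {Suc j..<n}) w' w"
      by (rule reach_sym) (use jn less.prems in auto)
    \<comment> \<open>The sorted path passes a flag \<open>z\<close> such that only colours below
      \<open>j\<close> occur between \<open>w\<close> and \<open>z\<close>, and only colours above
      \<open>j\<close> between \<open>z\<close> and \<open>w'\<close>. The first part is confined by
      the interval property, the second is left to the induction with \<open>Suc j\<close> in place
      of \<open>m\<close>.\<close>
    then have "\<exists>z. reach a {Suc j..<n} w' z \<and> reach a {..<j} z w"
      by (rule reach_split) (use less.prems jn in auto)
    then obtain z where z: "reach a {Suc j..<n} w' z" "reach a {..<j} z w" by blast
    have zW: "z \<in> W" by (rule reach_closed[OF z(1)]) (use less.prems in auto)
    have wz: "reach a {..<j} w z" by (rule reach_sym[OF z(2)]) (use zW jn in auto)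
    have zw': "reach a {Suc j..<n} z w'" by (rule reach_sym[OF z(1)]) (use less.prems in auto)
    have "reach a {m..<n} w' z" by (rule reach_mono[OF z(1)]) (use j in auto)
    then have "reach a {m..<n} w z" by (rule reach_trans[OF less.prems(4)])
    then have wz': "reach a {m..<j} w z" using interval_ip[OF less.prems(1) zW _ wz] jn by simp
    have zw: "reach a {m..<j} z w" by (rule reach_sym[OF wz']) (use less.prems jn in auto)
    have 1: "reach a ({..<n} - J) w z" by (rule reach_mono[OF wz']) (use low jn in auto)
    have 2: "reach a ({..<n} - J) z w'"
    proof (rule less.hyps[OF _ zW less.prems(2) _ zw'])
      show "n - Suc j < n - m" using j jn by linarith
      show "Suc j \<le> n" using jn by simp
      fix i assume i: "i \<in> J"
      have "{m..<j} \<subseteq> {..<n} - {i}" using low i jn by auto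
      then have "reach a ({..<n} - {i}) z w" by (rule reach_mono[OF zw])
      then show "reach a ({..<n} - {i}) z w'" using less.prems(5)[OF i] by (rule reach_trans)
    qed
    show ?thesis using 1 2 by (rule reach_trans)
  qed
qed

end

section \<open>Flags as two copies of a rotation group\<close>

primrec rot_prod :: "('g, 'm) monoid_scheme \<Rightarrow> (nat \<Rightarrow> 'g) \<Rightarrow> nat \<Rightarrow> 'g" where
  "rot_prod G s 0 = \<one>\<^bsub>G\<^esub>"
| "rot_prod G s (Suc i) = rot_prod G s i \<otimes>\<^bsub>G\<^esub> s (Suc i)"

text \<open>
  The flags are the images \<open>(g, False)\<close> of the base flag \<open>\<Phi>\<close> and the images \<open>(g, True)\<close> of its
  \<open>0\<close>-adjacent flag. The product \<open>s 1 \<dots> s i\<close> maps \<open>\<Phi>\<close> to the \<open>0\<close>-adjacent flag of the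
  \<open>i\<close>-adjacent flag of \<open>\<Phi>\<close>.
\<close>

definition rot_adj :: "('g, 'm) monoid_scheme \<Rightarrow> (nat \<Rightarrow> 'g) \<Rightarrow> nat \<Rightarrow> 'g \<times> bool \<Rightarrow> 'g \<times> bool" where
  "rot_adj G s i = (\<lambda>(g, e). if e then (inv\<^bsub>G\<^esub> (rot_prod G s i) \<otimes>\<^bsub>G\<^esub> g, False)
     else (rot_prod G s i \<otimes>\<^bsub>G\<^esub> g, True))"

lemma rot_adj_simps [simp]:
  "rot_adj G s i (g, False) = (rot_prod G s i \<otimes>\<^bsub>G\<^esub> g, True)"
  "rot_adj G s i (g, True) = (inv\<^bsub>G\<^esub> (rot_prod G s i) \<otimes>\<^bsub>G\<^esub> g, False)"
  by (simp_all add: rot_adj_def)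

lemma (in group) rot_prod_closed:
  "(\<And>j. 1 \<le> j \<Longrightarrow> j \<le> i \<Longrightarrow> s j \<in> carrier G) \<Longrightarrow> rot_prod G s i \<in> carrier G"
  by (induction i) auto

lemma (in group) inv_mult_cancel:
  "x \<in> carrier G \<Longrightarrow> y \<in> carrier G \<Longrightarrow> inv x \<otimes> (x \<otimes> y) = y"
  "x \<in> carrier G \<Longrightarrow> y \<in> carrier G \<Longrightarrow> x \<otimes> (inv x \<otimes> y) = y"
  by (simp_all add: m_assoc[symmetric])

locale rotation_data = group G for G (structure) +
  fixes n :: nat and s :: "nat \<Rightarrow> 'a"
  assumes s_closed: "1 \<le> i \<Longrightarrow> i < n \<Longrightarrow> s i \<in> carrier G"
begin

abbreviation t where "t \<equiv> rot_prod G s"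
abbreviation adj where "adj \<equiv> rot_adj G s"
abbreviation base_flag where "base_flag e \<equiv> (\<one>, e)"
abbreviation W :: "('a \<times> bool) set" where "W \<equiv> carrier G \<times> UNIV"

lemma t_closed: "i < n \<Longrightarrow> t i \<in> carrier G"
  by (rule rot_prod_closed) (auto intro: s_closed)

lemma gens_closed: "k < n \<Longrightarrow> s ` {Suc b..k} \<subseteq> carrier G"
  by (auto intro: s_closed)

lemma prod_in_generate:
  assumes "b \<le> i" "i \<le> k" "k < n"
  shows "inv (t b) \<otimes> t i \<in> generate G (s ` {Suc b..k})"
  using assms(1,2)
proof (induction i rule: dec_induct)
  case base
  then show ?case using t_closed[of b] assms by (simp add: generate.one)
next
  case (step i)
  have "inv (t b) \<otimes> t (Suc i) = (inv (t b) \<otimes> t i) \<otimes> s (Suc i)"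
    using t_closed[of b] t_closed[of i] s_closed[of "Suc i"] step assms by (simp add: m_assoc)
  moreover have "s (Suc i) \<in> generate G (s ` {Suc b..k})"
    using step by (intro generate.incl) auto
  ultimately show ?case using step by (simp add: generate.eng)
qed

text \<open>Colour \<open>b\<close> leads from \<open>(h, True)\<close> to
  \<open>(inv (t b) \<otimes> h, False)\<close>. With the copy \<open>True\<close> normalised in
  this way, each step of colour \<open>i\<close> multiplies on the left by
  \<open>inv (t b) \<otimes> t i\<close> or by its inverse.\<close>

lemma reach_interval:
  assumes "g \<in> carrier G" "b \<le> k" "k < n" and H: "H = generate G (s ` {Suc b..k})"
    and r: "reach adj {b..k} (g, False) (h, e)"
  shows "h \<in> carrier G \<and> (if e then inv (t b) \<otimes> h else h) \<otimes> inv g \<in> H"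
proof -
  interpret H: subgroup H G unfolding H by (rule generate_is_subgroup) (use gens_closed assms in simp)
  have tb: "t b \<in> carrier G" using t_closed assms by simp
  define Q where "Q w \<longleftrightarrow> fst w \<in> carrier G \<and>
    (if snd w then inv (t b) \<otimes> fst w else fst w) \<otimes> inv g \<in> H" for w :: "'a \<times> bool"
  from r have "Q (h, e)"
  proof (induction rule: reach_induct)
    case refl
    show ?case using assms(1) by (simp add: Q_def)
  next
    case (step w i)
    then have i: "b \<le> i" "i \<le> k" by auto
    have ti: "t i \<in> carrier G" using t_closed i assms by simp
    have x: "inv (t b) \<otimes> t i \<in> H" unfolding H by (rule prod_in_generate) (use i assms in auto)
    obtain h e where w: "w = (h, e)" by fastforce
    show ?case
    proof (cases e)
      case True
      then have h: "h \<in> carrier G" "inv (t b) \<otimes> h \<otimes> inv g \<in> H" using step.IH w by (auto simp: Q_def)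
      have "inv (inv (t b) \<otimes> t i) \<otimes> (inv (t b) \<otimes> h \<otimes> inv g) \<in> H"
        by (rule H.m_closed[OF H.m_inv_closed[OF x] h(2)])
      also have "inv (inv (t b) \<otimes> t i) \<otimes> (inv (t b) \<otimes> h \<otimes> inv g) = inv (t i) \<otimes> h \<otimes> inv g"
        using h(1) ti tb assms(1) by (simp add: inv_mult_group m_assoc inv_mult_cancel)
      finally show ?thesis using True w h ti by (simp add: Q_def)
    next
      case False
      then have h: "h \<in> carrier G" "h \<otimes> inv g \<in> H" using step.IH w by (auto simp: Q_def)
      have "inv (t b) \<otimes> t i \<otimes> (h \<otimes> inv g) \<in> H" using x h(2) by (rule H.m_closed)
      then show ?thesis using False w h ti tb assms(1) by (simp add: Q_def m_assoc)
    qed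
  qed
  then show ?thesis by (cases e) (simp_all add: Q_def)
qed

text \<open>Two steps, first in colour \<open>Suc i\<close> and then in colour \<open>i\<close>,
  multiply by \<open>inv (t i) \<otimes> t (Suc i) = s (Suc i)\<close>; the reverse order gives the
  inverse.\<close>

lemma reach_generate:
  assumes x: "x \<in> generate G (s ` {Suc b..k})" and k: "k < n" and g: "g \<in> carrier G"
  shows "reach adj {b..k} (g, False) (x \<otimes> g, False)"
  using x g
proof (induction arbitrary: g rule: generate.induct)
  case one
  then show ?case by simp
next
  case (incl h)
  then obtain j where j: "j \<in> {Suc b..k}" "h = s j" by blast
  then obtain i where "j = Suc i" by (cases j) auto
  with j have i: "Suc b \<le> Suc i" "Suc i \<le> k" "h = s (Suc i)" by auto
  have c: "t i \<in> carrier G" "s (Suc i) \<in> carrier G" using t_closed[of i] s_closed[of "Suc i"] i k by auto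
  have "adj i (adj (Suc i) (g, False)) = (h \<otimes> g, False)"
    using c i incl.prems by (simp add: m_assoc inv_mult_cancel)
  moreover have "reach adj {b..k} (g, False) (adj i (adj (Suc i) (g, False)))"
    using i by (intro reach_step reach_refl) auto
  ultimately show ?case by simp
next
  case (inv h)
  then obtain j where j: "j \<in> {Suc b..k}" "h = s j" by blast
  then obtain i where "j = Suc i" by (cases j) auto
  with j have i: "Suc b \<le> Suc i" "Suc i \<le> k" "h = s (Suc i)" by auto
  have c: "t i \<in> carrier G" "s (Suc i) \<in> carrier G" using t_closed[of i] s_closed[of "Suc i"] i k by auto
  have "adj (Suc i) (adj i (g, False)) = (inv h \<otimes> g, False)"
    using c i inv.prems by (simp add: m_assoc inv_mult_cancel inv_mult_group)
  moreover have "reach adj {b..k} (g, False) (adj (Suc i) (adj i (g, False)))"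
    using i by (intro reach_step reach_refl) auto
  ultimately show ?case by simp
next
  case (eng x y)
  have c: "x \<in> carrier G" "y \<in> carrier G"
    using eng.hyps generate_in_carrier[OF gens_closed[OF k]] by auto
  have "reach adj {b..k} (g, False) (x \<otimes> (y \<otimes> g), False)"
    by (rule reach_trans[OF eng.IH(2)[OF eng.prems] eng.IH(1)]) (use c eng.prems in simp)
  then show ?case using c eng.prems by (simp add: m_assoc)
qed

end

text \<open>\<open>ip\<close> compares subgroups, that is, flags in the copy \<open>False\<close>,
  and only for colour intervals with a common colour. For disjoint intervals \<open>prod_inj\<close>
  supplies what is missing, namely that different colours lead to different flags.\<close>

locale rotation_group = rotation_data +
  assumes n2: "n \<ge> 2"
    and gen: "generate G (s ` {1..<n}) = carrier G"
    and rel: "i + 2 \<le> j \<Longrightarrow> j < n \<Longrightarrow> inv (t i) \<otimes> t j = inv (t j) \<otimes> t i"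
    and prod_inj: "i < j \<Longrightarrow> j < n \<Longrightarrow> t i \<noteq> t j"
    and ip: "b \<le> k \<Longrightarrow> k < n \<Longrightarrow>
      generate G (s ` {1..k}) \<inter> generate G (s ` {Suc b..<n}) \<subseteq> generate G (s ` {Suc b..k})"
begin

sublocale flag_system n W adj
proof
  show "adj i w \<in> W" if "w \<in> W" "i < n" for w i
    using that t_closed by (auto simp: rot_adj_def)
  show "adj i (adj i w) = w" if "w \<in> W" "i < n" for w i
    using that t_closed[of i] by (auto simp: rot_adj_def inv_mult_cancel)
  show "adj i (adj j w) = adj j (adj i w)" if w: "w \<in> W" and ij: "j < n" "i + 2 \<le> j" for w i j
  proof -
    obtain g e where g: "w = (g, e)" "g \<in> carrier G" using w by auto
    have c: "t i \<in> carrier G" "t j \<in> carrier G" using t_closed ij by auto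
    have r: "inv (t i) \<otimes> t j = inv (t j) \<otimes> t i" using rel ij by simp
    have "t i \<otimes> inv (t j) = t j \<otimes> (inv (t j) \<otimes> t i) \<otimes> inv (t j)"
      using c by (simp add: inv_mult_cancel)
    also have "\<dots> = t j \<otimes> (inv (t i) \<otimes> t j) \<otimes> inv (t j)" using r by simp
    also have "\<dots> = t j \<otimes> inv (t i)" using c by (simp add: m_assoc)
    finally have r': "t i \<otimes> inv (t j) = t j \<otimes> inv (t i)" .
    show ?thesis using r r' g c by (cases e) (simp_all add: m_assoc[symmetric])
  qed
qed

lemma rot_connected:
  assumes "w \<in> W" "w' \<in> W"
  shows "reach adj {..<n} w w'"
proof -
  have n0: "0 < n" and N: "{..<n} = {0..n - 1}" "{1..<n} = {Suc 0..n - 1}" using n2 by auto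
  have base: "\<exists>g \<in> carrier G. reach adj {..<n} w (g, False)" if w: "w \<in> W" for w
  proof -
    obtain g e where g: "w = (g, e)" "g \<in> carrier G" using w by auto
    show ?thesis
    proof (cases e)
      case True
      have "reach adj {..<n} w (adj 0 w)" using n0 by (intro reach_single) simp
      then show ?thesis using True g by auto
    next
      case False
      then show ?thesis using g by (intro bexI[of _ g]) simp_all
    qed
  qed
  obtain g where g: "g \<in> carrier G" "reach adj {..<n} w (g, False)"
    using base[OF assms(1)] by (rule bexE)
  obtain h where h: "h \<in> carrier G" "reach adj {..<n} w' (h, False)"
    using base[OF assms(2)] by (rule bexE)
  have "h \<otimes> inv g \<in> generate G (s ` {Suc 0..n - 1})"
    using gen N g h by simp
  then have "reach adj {..<n} (g, False) (h \<otimes> inv g \<otimes> g, False)"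
    unfolding N using reach_generate[of "h \<otimes> inv g" 0 "n - 1" g] g n0 by simp
  then have "reach adj {..<n} (g, False) (h, False)" using g h by (simp add: m_assoc)
  moreover have "reach adj {..<n} (h, False) w'" using reach_sym[OF h(2)] assms by simp
  ultimately show ?thesis using reach_trans[OF g(2)] reach_trans by metis
qed

text \<open>Colour \<open>b\<close> belongs to both intervals, so both ends can be moved into the
  copy \<open>False\<close> without leaving either; there the paths give group elements and
  \<open>ip\<close> applies.\<close>

lemma interval_ip_aux:
  assumes W: "w \<in> W" "w' \<in> W" and bk: "b \<le> k" "k < n"
    and r: "reach adj {..<Suc k} w w'" "reach adj {b..<n} w w'"
  shows "reach adj {b..<Suc k} w w'"
proof -
  have base: "\<exists>g \<in> carrier G. reach adj {b} w (g, False)" if w: "w \<in> W" for w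
  proof -
    obtain g e where g: "w = (g, e)" "g \<in> carrier G" using w by auto
    show ?thesis
    proof (cases e)
      case True
      have "reach adj {b} w (adj b w)" by (intro reach_single) simp
      then show ?thesis using True g t_closed[of b] bk by auto
    next
      case False
      then show ?thesis using g by (intro bexI[of _ g]) simp_all
    qed
  qed
  obtain g where g: "g \<in> carrier G" "reach adj {b} w (g, False)"
    using base[OF W(1)] by (rule bexE)
  obtain h where h: "h \<in> carrier G" "reach adj {b} w' (h, False)"
    using base[OF W(2)] by (rule bexE)
  have gw: "reach adj {b} (g, False) w" using reach_sym[OF g(2)] W bk by simp
  have hw: "reach adj {b} (h, False) w'" using reach_sym[OF h(2)] W bk by simp
  have gh: "reach adj I (g, False) (h, False)" if "reach adj I w w'" "b \<in> I" for I
    by (rule reach_trans[OF reach_trans[OF reach_mono[OF gw] that(1)] reach_mono[OF h(2)]]) (use that in auto)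
  have "reach adj {0..k} (g, False) (h, False)"
    by (rule reach_mono[OF gh[OF r(1)]]) (use bk in auto)
  from reach_interval[OF g(1) _ bk(2) refl this]
  have 1: "h \<otimes> inv g \<in> generate G (s ` {1..k})" by simp
  have "reach adj {b..n - 1} (g, False) (h, False)"
    by (rule reach_mono[OF gh[OF r(2)]]) (use bk in auto)
  from reach_interval[OF g(1) _ _ refl this]
  have "h \<otimes> inv g \<in> generate G (s ` {Suc b..n - 1})" using bk by simp
  moreover have "{Suc b..n - 1} = {Suc b..<n}" using bk by auto
  ultimately have 2: "h \<otimes> inv g \<in> generate G (s ` {Suc b..<n})" by argo
  have "h \<otimes> inv g \<in> generate G (s ` {Suc b..k})" using ip[OF bk] IntI[OF 1 2] by (rule subsetD)
  then have "reach adj {b..k} (g, False) (h \<otimes> inv g \<otimes> g, False)"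
    by (rule reach_generate) (use bk g in auto)
  then have "reach adj {b..k} (g, False) (h, False)" using g h by (simp add: m_assoc)
  moreover have "reach adj {b..k} w (g, False)" "reach adj {b..k} (h, False) w'"
    by (rule reach_mono[OF g(2)], use bk in simp, rule reach_mono[OF hw], use bk in simp)
  moreover have "{b..<Suc k} = {b..k}" by auto
  ultimately show ?thesis by (metis reach_trans)
qed

lemma adj_inj:
  assumes "w \<in> W" "i < n" "j < n" "adj i w = adj j w"
  shows "i = j"
proof -
  obtain g e where g: "w = (g, e)" "g \<in> carrier G" using assms by auto
  have "t i = t j"
    using assms g t_closed[of i] t_closed[of j] by (cases e) (auto dest: inv_inj[THEN inj_onD])
  then show ?thesis using prod_inj[of i j] prod_inj[of j i] assms by (metis linorder_neqE_nat)
qed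

sublocale interval_flag_system n W adj
proof
  fix w w' j k
  assume W: "w \<in> W" "w' \<in> W" and k: "k \<le> n" and r: "reach adj {..<k} w w'" "reach adj {j..<n} w w'"
  consider "k = 0" | "n \<le> j" | "j < k" | l where "k = Suc l" "l < j" "j < n"
    by (metis not_less_eq linorder_not_less not0_implies_Suc)
  then show "reach adj {j..<k} w w'"
  proof cases
    case 1
    then show ?thesis using reach_empty[of adj w w'] r by simp
  next
    case 2
    then show ?thesis using reach_empty[of adj w w'] r by simp
  next
    case 3
    then obtain l where "k = Suc l" "j \<le> l" by (metis less_Suc_eq_le not_less_eq old.nat.exhaust less_nat_zero_code)
    then show ?thesis using interval_ip_aux[OF W, of j l] r k by simp
  next
    case 4
    \<comment> \<open>The intervals are disjoint here. Enlarging both until they share just the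
      colour \<open>i\<close> leaves at most one step of colour \<open>i\<close>; the choices
      \<open>l\<close> and \<open>j\<close> for \<open>i\<close> together leave none.\<close>
    have one: "w' = w \<or> w' = adj i w" if "i < n" "l \<le> i" "i \<le> j" for i
    proof -
      have "reach adj {..<Suc i} w w'" by (rule reach_mono[OF r(1)]) (use 4 that in auto)
      moreover have "reach adj {i..<n} w w'" by (rule reach_mono[OF r(2)]) (use 4 that in auto)
      ultimately have "reach adj {i..<Suc i} w w'" using interval_ip_aux[OF W, of i i] that by simp
      then have "reach adj {i} w w'" by (simp add: atLeastLessThanSuc)
      then show ?thesis
        by (induction rule: reach_induct) (use invol[OF W(1) that(1)] in auto)
    qed
    have "w' = w"
      using one[of l] one[of j] adj_inj[OF W(1), of l j] 4 by auto
    then show ?thesis by simp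
  qed
qed

text \<open>
  A face is a connected component after removing one colour. Since \<open>n \<ge> 2\<close>, the component is
  determined by its elements of the form \<open>(g, False)\<close>.
\<close>

definition rot_face :: "nat \<Rightarrow> 'a \<times> bool \<Rightarrow> int \<times> 'a set" where
  "rot_face k w = (int k - 1, {g. reach adj {i. i < n \<and> Suc i \<noteq> k} w (g, False)})"

definition rot_poset :: "(int \<times> 'a set) rel" where
  "rot_poset = {(rot_face j w, rot_face k w) | j k w. w \<in> W \<and> j \<le> k \<and> k \<le> n + 1}"

lemma rot_face_eq_iff:
  assumes "w \<in> W" "w' \<in> W"
  shows "rot_face j w = rot_face k w' \<longleftrightarrow> j = k \<and> reach adj {i. i < n \<and> Suc i \<noteq> k} w w'"
proof
  assume e: "rot_face j w = rot_face k w'"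
  let ?I = "{i. i < n \<and> Suc i \<noteq> k}"
  have jk: "j = k" and eq: "{g. reach adj ?I w (g, False)} = {g. reach adj ?I w' (g, False)}"
    using e by (auto simp: rot_face_def)
  obtain i where i: "i \<in> ?I" using n2 by (cases "k = 1") (auto intro: that[of 0] that[of 1])
  obtain g where g: "reach adj ?I w (g, False)"
  proof (cases "snd w")
    case True
    then have "adj i w = (fst (adj i w), False)" by (auto simp: rot_adj_def split: prod.splits)
    then show ?thesis using that reach_single[OF i, of adj w] by metis
  next
    case False
    then have "w = (fst w, False)" by (cases w) simp
    then show ?thesis using that reach_refl by metis
  qed
  then have "reach adj ?I w' (g, False)" using eq by auto
  then have "reach adj ?I (g, False) w'" by (rule reach_sym) (use assms in auto)
  then have "reach adj ?I w w'" by (rule reach_trans[OF g])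
  then show "j = k \<and> reach adj ?I w w'" using jk by simp
next
  assume *: "j = k \<and> reach adj {i. i < n \<and> Suc i \<noteq> k} w w'"
  let ?I = "{i. i < n \<and> Suc i \<noteq> k}"
  have 1: "reach adj ?I w w'" using * by blast
  have 2: "reach adj ?I w' w" by (rule reach_sym[OF 1]) (use assms in auto)
  have "reach adj ?I w (g, False) \<longleftrightarrow> reach adj ?I w' (g, False)" for g
    using reach_trans[OF 1] reach_trans[OF 2] by blast
  then show "rot_face j w = rot_face k w'" using * by (simp add: rot_face_def)
qed

lemma intersection:
  assumes "w \<in> W" "w' \<in> W" "J \<subseteq> {..<n}" "\<And>i. i \<in> J \<Longrightarrow> reach adj ({..<n} - {i}) w w'"
  shows "reach adj ({..<n} - J) w w'"
  by (rule intersection_from[of _ _ 0]) (use assms rot_connected in \<open>auto simp: atLeast0LessThan\<close>)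

lemma rot_model: "flag_model n W adj rot_poset rot_face"
proof
  have N: "{i. i < n \<and> Suc i \<noteq> 0} = {..<n}" "{i. i < n \<and> Suc i \<noteq> n + 1} = {..<n}" by auto
  show "W \<noteq> {}" by auto
  show "(x, y) \<in> rot_poset \<longleftrightarrow>
      (\<exists>w\<in>W. \<exists>j k. j \<le> k \<and> k \<le> n + 1 \<and> x = rot_face j w \<and> y = rot_face k w)" for x y
    unfolding rot_poset_def by blast
  show "j = k" if "w \<in> W" "w' \<in> W" "j \<le> n + 1" "k \<le> n + 1" "rot_face j w = rot_face k w'" for w w' j k
    using that rot_face_eq_iff by blast
  show "rot_face 0 w = rot_face 0 w'" if "w \<in> W" "w' \<in> W" for w w'
    unfolding rot_face_eq_iff[OF that] N using rot_connected[OF that] by simp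
  show "rot_face (n + 1) w = rot_face (n + 1) w'" if "w \<in> W" "w' \<in> W" for w w'
    unfolding rot_face_eq_iff[OF that] N using rot_connected[OF that] by simp
  show "rot_face k (adj i w) = rot_face k w \<longleftrightarrow> k \<noteq> Suc i" if w: "w \<in> W" and i: "i < n" and k: "k \<le> n + 1" for w i k
  proof -
    have aw: "adj i w \<in> W" using closed[OF w i] .
    have "rot_face k w \<noteq> rot_face k (adj i w)" if "k = Suc i"
    proof
      assume "rot_face k w = rot_face k (adj i w)"
      then have r: "reach adj {l. l < n \<and> Suc l \<noteq> k} w (adj i w)"
        using rot_face_eq_iff[OF w aw] by blast
      \<comment> \<open>If the face were kept, then for each single colour the flag and its
        neighbour would be joined without that colour. By the intersection property they would be
        equal, although adjacency changes the copy.\<close>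
      have "reach adj ({..<n} - {..<n}) w (adj i w)"
      proof (rule intersection[OF w aw])
        fix l assume "l \<in> {..<n}"
        show "reach adj ({..<n} - {l}) w (adj i w)"
        proof (cases "l = i")
          case True
          then show ?thesis by (intro reach_mono[OF r]) (use that in auto)
        next
          case False
          then show ?thesis using i by (intro reach_single) auto
        qed
      qed simp
      then have "adj i w = w" using reach_empty by fastforce
      then show False by (cases w; cases "snd w") auto
    qed
    moreover have "rot_face k w = rot_face k (adj i w)" if "k \<noteq> Suc i"
      unfolding rot_face_eq_iff[OF w aw] using that i by (auto intro: reach_single)
    ultimately show ?thesis by metis
  qed
  show "reach adj ({..<n} - J) w w'"
    if w: "w \<in> W" "w' \<in> W" and J: "J \<subseteq> {..<n}"
      and e: "\<And>i. i \<in> J \<Longrightarrow> rot_face (Suc i) w = rot_face (Suc i) w'" for w w' J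
  proof (rule intersection[OF w J])
    fix i assume "i \<in> J"
    have "reach adj {l. l < n \<and> Suc l \<noteq> Suc i} w w'" using e[OF \<open>i \<in> J\<close>] rot_face_eq_iff[OF w] by blast
    then show "reach adj ({..<n} - {i}) w w'" by (rule reach_mono) auto
  qed
qed

sublocale M: flag_model n W adj rot_poset rot_face
  by (rule rot_model)

section \<open>Automorphisms from right multiplication\<close>

definition rmult :: "'a \<Rightarrow> 'a \<times> bool \<Rightarrow> 'a \<times> bool" where
  "rmult g w = (fst w \<otimes> g, snd w)"

lemma rmult_closed: "g \<in> carrier G \<Longrightarrow> w \<in> W \<Longrightarrow> rmult g w \<in> W"
  by (auto simp: rmult_def)

lemma rmult_rmult: "g \<in> carrier G \<Longrightarrow> h \<in> carrier G \<Longrightarrow> w \<in> W \<Longrightarrow> rmult h (rmult g w) = rmult (g \<otimes> h) w"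
  by (auto simp: rmult_def m_assoc)

lemma rmult_one: "w \<in> W \<Longrightarrow> rmult \<one> w = w"
  by (auto simp: rmult_def)

text \<open>Adjacency multiplies on the left, so this is associativity.\<close>

lemma rmult_adj: "g \<in> carrier G \<Longrightarrow> w \<in> W \<Longrightarrow> i < n \<Longrightarrow> rmult g (adj i w) = adj i (rmult g w)"
  using t_closed[of i] by (auto simp: rmult_def rot_adj_def m_assoc)

lemma rmult_bij:
  assumes g: "g \<in> carrier G"
  shows "bij_betw (rmult g) W W"
  by (rule bij_betw_byWitness[where f' = "rmult (inv g)"])
    (use g in \<open>auto simp: rmult_rmult rmult_one rmult_closed image_subset_iff\<close>)

definition rot_aut :: "'a \<Rightarrow> int \<times> 'a set \<Rightarrow> int \<times> 'a set" where
  "rot_aut g = (SOME f. f \<in> carrier (aut_group rot_poset) \<and>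
     (\<forall>w \<in> W. \<forall>k \<le> n + 1. f (rot_face k w) = rot_face k (rmult g w)))"

lemma rot_aut:
  assumes g: "g \<in> carrier G"
  shows "rot_aut g \<in> carrier (aut_group rot_poset)"
    and "w \<in> W \<Longrightarrow> k \<le> n + 1 \<Longrightarrow> rot_aut g (rot_face k w) = rot_face k (rmult g w)"
proof -
  have "\<exists>f. f \<in> carrier (aut_group rot_poset) \<and>
     (\<forall>w \<in> W. \<forall>k \<le> n + 1. f (rot_face k w) = rot_face k (rmult g w))"
    using M.flag_map_aut[OF rmult_bij[OF g] rmult_adj[OF g]] by metis
  from someI_ex[OF this] show "rot_aut g \<in> carrier (aut_group rot_poset)"
    "w \<in> W \<Longrightarrow> k \<le> n + 1 \<Longrightarrow> rot_aut g (rot_face k w) = rot_face k (rmult g w)"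
    unfolding rot_aut_def by blast+
qed

lemma rot_aut_fl:
  assumes "g \<in> carrier G" "w \<in> W"
  shows "rot_aut g ` M.fl w = M.fl (rmult g w)"
  by (rule M.aut_image_fl) (rule rot_aut(2)[OF assms])

lemma rot_aut_hom:
  assumes g: "g \<in> carrier G" and h: "h \<in> carrier G"
  shows "rot_aut (g \<otimes> h) = rot_aut g \<otimes>\<^bsub>aut_group rot_poset\<^esub> rot_aut h"
proof -
  interpret A: group "aut_group rot_poset" by (rule aut_group_group)
  have w: "(\<one>, False) \<in> W" by simp
  show ?thesis
  proof (rule M.aut_eqI[OF _ _ w])
    show "rot_aut (g \<otimes> h) \<in> carrier (aut_group rot_poset)" using rot_aut g h by simp
    show "rot_aut g \<otimes>\<^bsub>aut_group rot_poset\<^esub> rot_aut h \<in> carrier (aut_group rot_poset)"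
      using rot_aut g h by simp
    have "(rot_aut g \<otimes>\<^bsub>aut_group rot_poset\<^esub> rot_aut h) ` M.fl (\<one>, False) = rot_aut h ` rot_aut g ` M.fl (\<one>, False)"
      by (simp add: mult_aut_group image_comp)
    also have "\<dots> = M.fl (rmult (g \<otimes> h) (\<one>, False))"
      by (simp add: rot_aut_fl[OF g w] rot_aut_fl[OF h rmult_closed[OF g w]] rmult_rmult[OF g h w])
    also have "\<dots> = rot_aut (g \<otimes> h) ` M.fl (\<one>, False)"
      using rot_aut_fl[of "g \<otimes> h"] g h w by simp
    finally show "rot_aut (g \<otimes> h) ` M.fl (\<one>, False) =
      (rot_aut g \<otimes>\<^bsub>aut_group rot_poset\<^esub> rot_aut h) ` M.fl (\<one>, False)" by simp
  qed
qed

lemma rot_aut_inj: "inj_on rot_aut (carrier G)"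
proof (rule inj_onI)
  fix g h assume gh: "g \<in> carrier G" "h \<in> carrier G" and e: "rot_aut g = rot_aut h"
  have w: "(\<one>, False) \<in> W" by simp
  have "M.fl (rmult g (\<one>, False)) = M.fl (rmult h (\<one>, False))"
    using rot_aut_fl[OF gh(1) w] rot_aut_fl[OF gh(2) w] e by simp
  then have "rmult g (\<one>, False) = rmult h (\<one>, False)"
    by (rule inj_onD[OF M.inj_fl _ rmult_closed[OF gh(1) w] rmult_closed[OF gh(2) w]])
  then show "g = h" using gh by (simp add: rmult_def)
qed

end

text \<open>Chirality is stated for arbitrary maps of the flag graph, so that it can be pulled back
  along an embedding of flag graphs. Excluding one image of the base flag is enough, as right
  multiplication moves any flag of the copy \<open>True\<close> to
  \<open>(\<one>, True)\<close>.\<close>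

locale chiral_rotation_group = rotation_group +
  assumes no_reflection: "\<lbrakk>\<And>w. w \<in> W \<Longrightarrow> \<theta> w \<in> W; \<And>w i. w \<in> W \<Longrightarrow> i < n \<Longrightarrow> \<theta> (adj i w) = adj i (\<theta> w)\<rbrakk>
     \<Longrightarrow> \<theta> (\<one>, False) \<noteq> (\<one>, True)"
begin

lemma rot_aut_surj:
  assumes f: "f \<in> carrier (aut_group rot_poset)"
  obtains g where "g \<in> carrier G" "f = rot_aut g"
proof -
  have w: "(\<one>, False) \<in> W" by simp
  obtain \<theta> where \<theta>: "\<And>w. w \<in> W \<Longrightarrow> \<theta> w \<in> W"
    "\<And>w k. w \<in> W \<Longrightarrow> k \<le> n + 1 \<Longrightarrow> f (rot_face k w) = rot_face k (\<theta> w)"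
    "\<And>w i. w \<in> W \<Longrightarrow> i < n \<Longrightarrow> \<theta> (adj i w) = adj i (\<theta> w)"
    using M.aut_flag_map[OF f] by metis
  obtain g e where ge: "\<theta> (\<one>, False) = (g, e)" by fastforce
  have g: "g \<in> carrier G" using \<theta>(1)[OF w] ge by simp
  have "\<not> e"
  proof
    assume e
    let ?\<theta> = "\<lambda>w. rmult (inv g) (\<theta> w)"
    have "?\<theta> (\<one>, False) \<noteq> (\<one>, True)"
      by (rule no_reflection) (use \<theta> g in \<open>auto simp: rmult_closed rmult_adj\<close>)
    then show False using ge g \<open>e\<close> by (simp add: rmult_def)
  qed
  then have "\<theta> (\<one>, False) = rmult g (\<one>, False)" using ge g by (simp add: rmult_def)
  moreover have "f ` M.fl (\<one>, False) = M.fl (\<theta> (\<one>, False))"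
    by (rule M.aut_image_fl) (rule \<theta>(2)[OF w])
  ultimately have "f ` M.fl (\<one>, False) = rot_aut g ` M.fl (\<one>, False)"
    using rot_aut_fl[OF g w] by simp
  then have "f = rot_aut g" by (rule M.aut_eqI[OF f rot_aut(1)[OF g] w])
  then show thesis using that g by blast
qed

lemma rot_aut_iso: "rot_aut \<in> iso G (aut_group rot_poset)"
proof -
  have "rot_aut \<in> hom G (aut_group rot_poset)"
    by (rule homI) (use rot_aut(1) rot_aut_hom in auto)
  moreover have "rot_aut ` carrier G = carrier (aut_group rot_poset)"
    using rot_aut(1) rot_aut_surj by blast
  ultimately show ?thesis using rot_aut_inj by (simp add: iso_def bij_betw_def)
qed

lemma rot_flag_orbit:
  assumes h: "h \<in> carrier G"
  shows "flag_orbit rot_poset (M.fl (h, e)) = M.fl ` (carrier G \<times> {e})"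
proof (intro equalityI subsetI)
  fix C assume "C \<in> flag_orbit rot_poset (M.fl (h, e))"
  then obtain f where f: "f \<in> carrier (aut_group rot_poset)" "C = f ` M.fl (h, e)"
    by (auto simp: flag_orbit_def)
  obtain g where g: "g \<in> carrier G" "f = rot_aut g" using rot_aut_surj[OF f(1)] .
  have "C = M.fl (rmult g (h, e))" using rot_aut_fl[OF g(1)] f g h by simp
  moreover have "rmult g (h, e) \<in> carrier G \<times> {e}" using g h by (simp add: rmult_def)
  ultimately show "C \<in> M.fl ` (carrier G \<times> {e})" by (rule image_eqI)
next
  fix C assume "C \<in> M.fl ` (carrier G \<times> {e})"
  then obtain h' where h': "h' \<in> carrier G" "C = M.fl (h', e)" by blast
  let ?g = "inv h \<otimes> h'"
  have g: "?g \<in> carrier G" using h h' by simp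
  have "rot_aut ?g ` M.fl (h, e) = C"
    using rot_aut_fl[OF g, of "(h, e)"] h h' by (simp add: rmult_def inv_mult_cancel)
  then show "C \<in> flag_orbit rot_poset (M.fl (h, e))"
    unfolding flag_orbit_def
    by (intro CollectI exI[of _ "rot_aut ?g"] conjI) (simp_all add: rot_aut(1)[OF g])
qed

lemma rot_orbits_differ: "M.fl ` (carrier G \<times> {e}) \<noteq> M.fl ` (carrier G \<times> {\<not> e})"
proof
  assume *: "M.fl ` (carrier G \<times> {e}) = M.fl ` (carrier G \<times> {\<not> e})"
  have "M.fl (\<one>, e) \<in> M.fl ` (carrier G \<times> {e})" by simp
  then have "M.fl (\<one>, e) \<in> M.fl ` (carrier G \<times> {\<not> e})" by (rule subsetD[OF equalityD1[OF *]])
  then obtain h where "h \<in> carrier G" "M.fl (\<one>, e) = M.fl (h, \<not> e)" by (elim imageE SigmaE) simp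
  then have "(\<one>, e) = (h, \<not> e)" using inj_onD[OF M.inj_fl, of "(\<one>, e)" "(h, \<not> e)"] by simp
  then show False by simp
qed

text \<open>Right multiplication is transitive on each copy, no automorphism exchanges the copies,
  and every adjacency changes the copy.\<close>

lemma rot_chiral: "chiral_polytope n rot_poset"
  unfolding chiral_polytope_def
proof (intro conjI allI impI)
  show "polytope n rot_poset" by (rule M.polytope)
  have "flag_orbit rot_poset ` flags rot_poset = {M.fl ` (carrier G \<times> {False}), M.fl ` (carrier G \<times> {True})}"
  proof (intro equalityI subsetI)
    fix X assume "X \<in> flag_orbit rot_poset ` flags rot_poset"
    then obtain h e where "h \<in> carrier G" "X = flag_orbit rot_poset (M.fl (h, e))"
      by (auto simp: M.flags_eq)
    then show "X \<in> {M.fl ` (carrier G \<times> {False}), M.fl ` (carrier G \<times> {True})}"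
      using rot_flag_orbit by (cases e) auto
  next
    fix X assume "X \<in> {M.fl ` (carrier G \<times> {False}), M.fl ` (carrier G \<times> {True})}"
    then obtain e where e: "X = flag_orbit rot_poset (M.fl (\<one>, e))"
      using rot_flag_orbit[OF one_closed] by (metis insertE singletonD)
    have "M.fl (\<one>, e) \<in> flags rot_poset" unfolding M.flags_eq by (rule imageI) simp
    then show "X \<in> flag_orbit rot_poset ` flags rot_poset" using e by (rule image_eqI[rotated])
  qed
  then show "card (flag_orbit rot_poset ` flags rot_poset) = 2"
    using rot_orbits_differ[of False] by simp
next
  fix i C D assume "i_adjacent rot_poset i C D"
  then obtain w j where w: "w \<in> W" "j < n" "C = M.fl w" "D = M.fl (adj j w)"
    unfolding M.i_adjacent_iff by blast
  obtain g e where g: "w = (g, e)" "g \<in> carrier G" using w by auto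
  obtain h where h: "adj j w = (h, \<not> e)" "h \<in> carrier G"
    using closed[OF w(1,2)] g by (cases e) auto
  show "flag_orbit rot_poset C \<noteq> flag_orbit rot_poset D"
    using rot_orbits_differ rot_flag_orbit g h w by simp
qed

lemma rot_rotations: "abstract_rotations n rot_poset (M.fl (\<one>, False)) (rot_aut \<circ> s)"
  unfolding abstract_rotations_def
proof (intro ballI conjI)
  fix i assume i: "i \<in> {1..<n}"
  have s: "s i \<in> carrier G" using s_closed i by simp
  then show "(rot_aut \<circ> s) i \<in> carrier (aut_group rot_poset)" using rot_aut(1) by simp
  obtain j where j: "i = Suc j" "j < n" using i by (cases i) auto
  have c: "t j \<in> carrier G" "t i \<in> carrier G" using t_closed[of j] t_closed[of i] i j(2) by simp_all
  have 1: "adj i (\<one>, False) = (t i, True)" using c by simp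
  have 2: "adj j (t i, True) = (s i, False)" using c s j by (simp add: m_assoc[symmetric])
  have "adj_flag rot_poset (int j) (adj_flag rot_poset (int i) (M.fl (\<one>, False))) = M.fl (s i, False)"
    using M.adj_flag_fl[of "(\<one>, False)" i] M.adj_flag_fl[of "(t i, True)" j] 1 2 c i j by simp
  moreover have "(rot_aut \<circ> s) i ` M.fl (\<one>, False) = M.fl (s i, False)"
    using rot_aut_fl[OF s, of "(\<one>, False)"] s by (simp add: rmult_def)
  ultimately show "(rot_aut \<circ> s) i ` M.fl (\<one>, False) =
      adj_flag rot_poset (int i - 1) (adj_flag rot_poset (int i) (M.fl (\<one>, False)))"
    using j by simp
qed

end

section \<open>The rotation group of a chiral polytope\<close>

locale chiral_flags = polytope_flags d K for d :: nat and K :: "'f rel" +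
  fixes \<Phi> :: "'f set" and \<sigma> :: "nat \<Rightarrow> 'f \<Rightarrow> 'f"
  assumes d2: "d \<ge> 2"
    and chiral: "chiral_polytope d K"
    and base: "\<Phi> \<in> flags K"
    and rotations: "abstract_rotations d K \<Phi> \<sigma>"
begin

abbreviation \<Gamma> where "\<Gamma> \<equiv> aut_group K"

sublocale M: flag_model d "flags K" af K fc
  by (rule flag_model)

sublocale G: group \<Gamma>
  by (rule aut_group_group)

lemma aut_flag:
  assumes f: "f \<in> carrier \<Gamma>" and C: "C \<in> flags K"
  shows "f ` C \<in> flags K" and "i < d \<Longrightarrow> f ` af i C = af i (f ` C)"
proof -
  obtain \<theta> where \<theta>: "\<And>w. w \<in> flags K \<Longrightarrow> \<theta> w \<in> flags K"
    "\<And>w k. w \<in> flags K \<Longrightarrow> k \<le> d + 1 \<Longrightarrow> f (fc k w) = fc k (\<theta> w)"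
    "\<And>w i. w \<in> flags K \<Longrightarrow> i < d \<Longrightarrow> \<theta> (af i w) = af i (\<theta> w)"
    using M.aut_flag_map[OF f] by metis
  have im: "f ` D = \<theta> D" if "D \<in> flags K" for D
    using M.aut_image_fl[of f D "\<theta> D"] \<theta>(1,2) that fl_flag by simp
  show "f ` C \<in> flags K" using im \<theta>(1) C by simp
  show "f ` af i C = af i (f ` C)" if "i < d"
    using im[OF C] im[OF M.closed[OF C that]] \<theta>(3)[OF C that] by simp
qed

lemma mult_image: "(f \<otimes>\<^bsub>\<Gamma>\<^esub> g) ` C = g ` f ` C"
  by (simp add: mult_aut_group image_comp)

lemma one_image: "\<one>\<^bsub>\<Gamma>\<^esub> ` C = C"
  by (simp add: one_aut_group)

lemma inv_image: "f \<in> carrier \<Gamma> \<Longrightarrow> (inv\<^bsub>\<Gamma>\<^esub> f) ` f ` C = C"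
  using mult_image[of f "inv\<^bsub>\<Gamma>\<^esub> f" C] one_image by simp

sublocale R: rotation_data \<Gamma> d \<sigma>
  by unfold_locales (use rotations in \<open>auto simp: abstract_rotations_def\<close>)

definition flag_of :: "('f \<Rightarrow> 'f) \<times> bool \<Rightarrow> 'f set" where
  "flag_of = (\<lambda>(g, e). g ` (if e then af 0 \<Phi> else \<Phi>))"

lemma base0: "af 0 \<Phi> \<in> flags K"
  using M.closed[OF base, of 0] d2 by simp

lemma orbit_eq:
  assumes "f \<in> carrier \<Gamma>"
  shows "flag_orbit K (f ` C) = flag_orbit K C"
proof (intro equalityI subsetI)
  fix D assume "D \<in> flag_orbit K (f ` C)"
  then obtain g where "g \<in> carrier \<Gamma>" "D = g ` f ` C" by (auto simp: flag_orbit_def)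
  then show "D \<in> flag_orbit K C"
    unfolding flag_orbit_def using mult_image[of f g C] G.m_closed[OF assms, of g] by blast
next
  fix D assume "D \<in> flag_orbit K C"
  then obtain g where g: "g \<in> carrier \<Gamma>" "D = g ` C" by (auto simp: flag_orbit_def)
  have "(inv\<^bsub>\<Gamma>\<^esub> f \<otimes>\<^bsub>\<Gamma>\<^esub> g) ` f ` C = D" using mult_image inv_image assms g by simp
  moreover have "inv\<^bsub>\<Gamma>\<^esub> f \<otimes>\<^bsub>\<Gamma>\<^esub> g \<in> carrier \<Gamma>" using assms g by simp
  ultimately show "D \<in> flag_orbit K (f ` C)" unfolding flag_orbit_def by blast
qed

lemma in_orbit: "C \<in> flag_orbit K C"
  unfolding flag_orbit_def using one_image[of C] G.one_closed by blast

lemma orbits_differ: "flag_orbit K \<Phi> \<noteq> flag_orbit K (af 0 \<Phi>)"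
proof -
  have "i_adjacent K (int 0) \<Phi> (af 0 \<Phi>)"
    unfolding M.i_adjacent_iff using base d2 fl_flag[OF base] fl_flag[OF base0] by force
  then show ?thesis using chiral unfolding chiral_polytope_def by blast
qed

lemma orbit_cases:
  assumes C: "C \<in> flags K"
  obtains g where "g \<in> carrier \<Gamma>" "C = g ` \<Phi> \<or> C = g ` af 0 \<Phi>"
proof -
  have "card (flag_orbit K ` flags K) = 2" using chiral by (simp add: chiral_polytope_def)
  then obtain X Y where XY: "flag_orbit K ` flags K = {X, Y}" by (auto simp: card_2_iff)
  have mem: "flag_orbit K D \<in> {X, Y}" if "D \<in> flags K" for D
    using XY that by (metis imageI)
  have "flag_orbit K C = flag_orbit K \<Phi> \<or> flag_orbit K C = flag_orbit K (af 0 \<Phi>)"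
    using mem[OF C] mem[OF base] mem[OF base0] orbits_differ by auto
  then have "C \<in> flag_orbit K \<Phi> \<or> C \<in> flag_orbit K (af 0 \<Phi>)" using in_orbit[of C] by metis
  then show thesis using that unfolding flag_orbit_def by blast
qed

text \<open>There are two orbits, represented by \<open>\<Phi>\<close> and
  \<open>af 0 \<Phi>\<close> because adjacent flags are inequivalent, and the group acts freely on
  each.\<close>

lemma flag_of_bij: "bij_betw flag_of R.W (flags K)"
  unfolding bij_betw_def
proof
  have free: "g = h" if "g \<in> carrier \<Gamma>" "h \<in> carrier \<Gamma>" "C \<in> flags K" "g ` C = h ` C" for g h C
    by (rule M.aut_eqI[OF that(1-3)]) (use that fl_flag in simp)
  show "inj_on flag_of R.W"
  proof (rule inj_onI)
    fix v w assume v: "v \<in> R.W" and w: "w \<in> R.W" and e: "flag_of v = flag_of w"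
    obtain g x where g: "v = (g, x)" "g \<in> carrier \<Gamma>" using v by auto
    obtain h y where h: "w = (h, y)" "h \<in> carrier \<Gamma>" using w by auto
    have o: "flag_orbit K (if x then af 0 \<Phi> else \<Phi>) = flag_orbit K (if y then af 0 \<Phi> else \<Phi>)"
      using e g h orbit_eq[OF g(2)] orbit_eq[OF h(2)] unfolding flag_of_def by (metis old.prod.case)
    have xy: "x = y" using o orbits_differ by (cases x; cases y) auto
    then have "g = h" using free[OF g(2) h(2), of "if x then af 0 \<Phi> else \<Phi>"] e g h base base0
      by (cases x) (auto simp: flag_of_def)
    then show "v = w" using g h xy by simp
  qed
  show "flag_of ` R.W = flags K"
  proof (intro equalityI subsetI)
    fix C assume "C \<in> flag_of ` R.W"
    then show "C \<in> flags K" using aut_flag(1) base base0 by (auto simp: flag_of_def split: if_splits)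
  next
    fix C assume "C \<in> flags K"
    then obtain g where g: "g \<in> carrier \<Gamma>" "C = g ` \<Phi> \<or> C = g ` af 0 \<Phi>" by (rule orbit_cases)
    then have "C = flag_of (g, False) \<or> C = flag_of (g, True)" by (simp add: flag_of_def)
    then show "C \<in> flag_of ` R.W" using g(1) by (metis SigmaI UNIV_I image_eqI)
  qed
qed

lemma flag_of_flag: "w \<in> R.W \<Longrightarrow> flag_of w \<in> flags K"
  using bij_betwE[OF flag_of_bij] by blast

lemma flag_of_inj: "flag_of v = flag_of w \<Longrightarrow> v \<in> R.W \<Longrightarrow> w \<in> R.W \<Longrightarrow> v = w"
  using flag_of_bij unfolding bij_betw_def by (meson inj_onD)

text \<open>Automorphisms commute with adjacencies, so applying \<open>\<sigma> (Suc i)\<close> to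
  \<open>af 0 (af i \<Phi>)\<close> puts \<open>af i (af (Suc i) \<Phi>)\<close> in place of
  \<open>\<Phi>\<close>, and the two \<open>af i\<close> cancel.\<close>

lemma prod_image: "i < d \<Longrightarrow> R.t i ` \<Phi> = af 0 (af i \<Phi>)"
proof (induction i)
  case 0
  then show ?case using M.invol[OF base, of 0] by (simp add: one_image)
next
  case (Suc i)
  have s: "\<sigma> (Suc i) \<in> carrier \<Gamma>" using R.s_closed Suc by simp
  have fl: "af (Suc i) \<Phi> \<in> flags K" "af i \<Phi> \<in> flags K" using M.closed[OF base Suc.prems] M.closed[OF base Suc_lessD[OF Suc.prems]] .
  have si: "\<sigma> (Suc i) ` \<Phi> = af i (af (Suc i) \<Phi>)"
    using rotations Suc.prems unfolding abstract_rotations_def by force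
  have "R.t (Suc i) ` \<Phi> = \<sigma> (Suc i) ` af 0 (af i \<Phi>)" using Suc by (simp add: mult_image)
  also have "\<dots> = af 0 (af i (\<sigma> (Suc i) ` \<Phi>))" using aut_flag(2)[OF s fl(2), of 0] aut_flag(2)[OF s base, of i] Suc.prems by simp
  also have "\<dots> = af 0 (af (Suc i) \<Phi>)" using si M.invol[OF fl(1)] Suc.prems by simp
  finally show ?case .
qed

text \<open>Group elements commute with adjacencies, so it suffices to express the
  \<open>i\<close>-adjacent flags of the two orbit representatives by \<open>R.t i\<close>.\<close>

lemma flag_of_adj:
  assumes w: "w \<in> R.W" and i: "i < d"
  shows "flag_of (R.adj i w) = af i (flag_of w)"
proof -
  obtain g e where g: "w = (g, e)" "g \<in> carrier \<Gamma>" using w by auto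
  have d0: "0 < d" using d2 by simp
  have ti: "R.t i \<in> carrier \<Gamma>" using R.t_closed[OF i] .
  have fl: "af i \<Phi> \<in> flags K" "af i (af 0 \<Phi>) \<in> flags K" using M.closed base base0 i by auto
  show ?thesis
  proof (cases e)
    case False
    have "flag_of (R.adj i w) = g ` R.t i ` af 0 \<Phi>" using g False by (simp add: flag_of_def mult_image)
    also have "R.t i ` af 0 \<Phi> = af 0 (R.t i ` \<Phi>)" using aut_flag(2)[OF ti base d0] .
    also have "\<dots> = af i \<Phi>" using prod_image[OF i] M.invol[OF fl(1) d0] by simp
    also have "g ` af i \<Phi> = af i (g ` \<Phi>)" using aut_flag(2)[OF g(2) base i] .
    finally show ?thesis using g False by (simp add: flag_of_def)
  next
    case True
    have "R.t i ` af i (af 0 \<Phi>) = af i (R.t i ` af 0 \<Phi>)" using aut_flag(2)[OF ti base0 i] .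
    also have "R.t i ` af 0 \<Phi> = af 0 (R.t i ` \<Phi>)" using aut_flag(2)[OF ti base d0] .
    also have "\<dots> = af i \<Phi>" using prod_image[OF i] M.invol[OF fl(1) d0] by simp
    also have "af i (af i \<Phi>) = \<Phi>" using M.invol[OF base i] .
    finally have *: "(inv\<^bsub>\<Gamma>\<^esub> (R.t i)) ` \<Phi> = af i (af 0 \<Phi>)" using inv_image[OF ti] by metis
    have "flag_of (R.adj i w) = g ` af i (af 0 \<Phi>)"
      using g True * by (simp add: flag_of_def mult_image)
    also have "\<dots> = af i (g ` af 0 \<Phi>)" using aut_flag(2)[OF g(2) base0 i] .
    finally show ?thesis using g True by (simp add: flag_of_def)
  qed
qed

lemma adj_closed: "w \<in> R.W \<Longrightarrow> i < d \<Longrightarrow> R.adj i w \<in> R.W"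
  using R.t_closed by (auto simp: rot_adj_def)

sublocale FS: flag_system d R.W R.adj
proof
  show "R.adj i w \<in> R.W" if "w \<in> R.W" "i < d" for w i using that by (rule adj_closed)
  show "R.adj i (R.adj i w) = w" if "w \<in> R.W" "i < d" for w i
    by (rule flag_of_inj) (use that adj_closed in \<open>simp_all add: flag_of_adj M.invol flag_of_flag\<close>)
  show "R.adj i (R.adj j w) = R.adj j (R.adj i w)" if w: "w \<in> R.W" "j < d" "i + 2 \<le> j" for w i j
  proof (rule flag_of_inj)
    have i: "i < d" using w by simp
    have "flag_of (R.adj i (R.adj j w)) = af i (af j (flag_of w))"
      by (simp only: flag_of_adj[OF adj_closed[OF w(1,2)] i] flag_of_adj[OF w(1,2)])
    also have "\<dots> = af j (af i (flag_of w))" using M.comm[OF flag_of_flag[OF w(1)] w(2,3)] .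
    also have "\<dots> = flag_of (R.adj j (R.adj i w))"
      by (simp only: flag_of_adj[OF adj_closed[OF w(1) i] w(2)] flag_of_adj[OF w(1) i])
    finally show "flag_of (R.adj i (R.adj j w)) = flag_of (R.adj j (R.adj i w))" .
    show "R.adj i (R.adj j w) \<in> R.W" "R.adj j (R.adj i w) \<in> R.W"
      using adj_closed w i by blast+
  qed
qed

abbreviation gfc where "gfc \<equiv> (\<lambda>k w. fc k (flag_of w))"

sublocale MG: flag_model d R.W R.adj K gfc
  by (rule flag_model_transport[OF flag_model FS.flag_system_axioms flag_of_bij flag_of_adj])

lemma base_in: "R.base_flag e \<in> R.W"
  by simp

lemma generate_rotations: "generate \<Gamma> (\<sigma> ` {1..<d}) = carrier \<Gamma>"
proof (intro equalityI subsetI)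
  show "x \<in> carrier \<Gamma>" if "x \<in> generate \<Gamma> (\<sigma> ` {1..<d})" for x
    by (rule G.generate_in_carrier[OF _ that]) (use R.s_closed in auto)
  fix g assume g: "g \<in> carrier \<Gamma>"
  have d: "{1..<d} = {Suc 0..d - 1}" using d2 by auto
  have "(g, False) \<in> R.W" using g by simp
  then have "reach R.adj {..<d} (R.base_flag False) (g, False)" by (rule MG.connected[OF base_in])
  then have "reach R.adj {0..d - 1} (R.base_flag False) (g, False)" by (rule reach_mono) auto
  from R.reach_interval[OF G.one_closed _ _ HOL.refl this]
  show "g \<in> generate \<Gamma> (\<sigma> ` {1..<d})" using g d2 unfolding d by simp
qed

sublocale RG: rotation_group \<Gamma> d \<sigma>
proof
  show "2 \<le> d" by (rule d2)
  show "generate \<Gamma> (\<sigma> ` {1..<d}) = carrier \<Gamma>" by (rule generate_rotations)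
  show "inv\<^bsub>\<Gamma>\<^esub> (R.t i) \<otimes>\<^bsub>\<Gamma>\<^esub> R.t j = inv\<^bsub>\<Gamma>\<^esub> (R.t j) \<otimes>\<^bsub>\<Gamma>\<^esub> R.t i"
    if "i + 2 \<le> j" "j < d" for i j
    using FS.comm[OF base_in[of False] that(2,1)] R.t_closed[of i] R.t_closed[of j] that by simp
  show "R.t i \<noteq> R.t j" if "i < j" "j < d" for i j
  proof
    assume "R.t i = R.t j"
    then have "R.adj i (R.base_flag False) = R.adj j (R.base_flag False)" by simp
    then show False
      using MG.fc_step[OF base_in[of False], of i "Suc i"] MG.fc_step[OF base_in[of False], of j "Suc i"] that by simp
  qed
  show "generate \<Gamma> (\<sigma> ` {1..k}) \<inter> generate \<Gamma> (\<sigma> ` {Suc b..<d}) \<subseteq> generate \<Gamma> (\<sigma> ` {Suc b..k})"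
    if bk: "b \<le> k" "k < d" for b k
  proof
    fix x assume x: "x \<in> generate \<Gamma> (\<sigma> ` {1..k}) \<inter> generate \<Gamma> (\<sigma> ` {Suc b..<d})"
    have d: "{Suc b..<d} = {Suc b..d - 1}" using bk by auto
    have x1: "x \<in> generate \<Gamma> (\<sigma> ` {Suc 0..k})" and x2: "x \<in> generate \<Gamma> (\<sigma> ` {Suc b..d - 1})"
      using x unfolding d by auto
    have xG: "x \<in> carrier \<Gamma>" using x1 G.generate_in_carrier R.gens_closed[OF bk(2)] by blast
    have xW: "(x, False) \<in> R.W" using xG by simp
    have r1: "reach R.adj {0..k} (R.base_flag False) (x, False)"
      using R.reach_generate[OF x1 bk(2) G.one_closed] xG by simp
    have r2: "reach R.adj {b..d - 1} (R.base_flag False) (x, False)"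
      using R.reach_generate[OF x2 _ G.one_closed] xG bk by simp
    \<comment> \<open>Each path keeps the faces whose colours it avoids, so the base flag and its
      image under \<open>x\<close> share all faces of colour below \<open>b\<close> or above
      \<open>k\<close>; strong connectivity then yields a path with colours in
      \<open>{b..k}\<close>.\<close>
    have "reach R.adj ({..<d} - {i. i < d \<and> (i < b \<or> k < i)}) (R.base_flag False) (x, False)"
    proof (rule MG.fc_reach[OF base_in xW])
      fix i assume i: "i \<in> {i. i < d \<and> (i < b \<or> k < i)}"
      then consider "i < b" "i < d" | "k < i" "i < d" by auto
      then have "gfc (Suc i) (x, False) = gfc (Suc i) (R.base_flag False)"
      proof cases
        case 1
        show ?thesis by (rule MG.fc_const[OF r2]) (use 1 bk base_in in auto)
      next
        case 2
        show ?thesis by (rule MG.fc_const[OF r1]) (use 2 bk base_in in auto)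
      qed
      then show "gfc (Suc i) (R.base_flag False) = gfc (Suc i) (x, False)" by simp
    qed auto
    then have "reach R.adj {b..k} (R.base_flag False) (x, False)" by (rule reach_mono) auto
    from R.reach_interval[OF G.one_closed bk HOL.refl this]
    show "x \<in> generate \<Gamma> (\<sigma> ` {Suc b..k})" using xG by simp
  qed
qed

text \<open>A reflection of the flag graph is an involution because its square fixes the base flag.\<close>

sublocale CG: chiral_rotation_group \<Gamma> d \<sigma>
proof
  fix \<theta> assume W: "\<And>w. w \<in> R.W \<Longrightarrow> \<theta> w \<in> R.W"
    and eq: "\<And>w i. w \<in> R.W \<Longrightarrow> i < d \<Longrightarrow> \<theta> (R.adj i w) = R.adj i (\<theta> w)"
  show "\<theta> (R.base_flag False) \<noteq> (R.base_flag True)"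
  proof
    assume \<theta>1: "\<theta> (R.base_flag False) = R.base_flag True"
    have d0: "0 < d" using d2 by simp
    have a0: "R.adj 0 (R.base_flag False) = R.base_flag True" "R.adj 0 (R.base_flag True) = R.base_flag False"
      by simp_all
    have "\<theta> (\<theta> (R.base_flag False)) = R.base_flag False"
      using eq[OF base_in[of False] d0] \<theta>1 a0 by simp
    note \<theta>2 = this
    have inv: "\<theta> (\<theta> w) = w" if w: "w \<in> R.W" for w
      using MG.connected[OF base_in[of False] w]
    proof (induction rule: reach_induct)
      case refl
      show ?case by (rule \<theta>2)
    next
      case (step y i)
      have y: "y \<in> R.W" by (rule FS.reach_closed[OF step.hyps(1)]) (use base_in in auto)
      show ?case using eq[OF y] eq[OF W[OF y]] step by simp
    qed
    have "bij_betw \<theta> R.W R.W"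
      by (rule bij_betw_byWitness[where f' = \<theta>]) (use inv W in \<open>simp_all add: image_subset_iff del: mem_Sigma_iff\<close>)
    then obtain f where f: "f \<in> carrier \<Gamma>" "\<And>w k. w \<in> R.W \<Longrightarrow> k \<le> d + 1 \<Longrightarrow> f (gfc k w) = gfc k (\<theta> w)"
      using MG.flag_map_aut[of \<theta>] eq by metis
    have "f ` MG.fl (R.base_flag False) = MG.fl (R.base_flag True)"
      by (rule MG.aut_image_fl) (use f(2)[OF base_in[of False]] \<theta>1 in simp)
    moreover have "MG.fl w = flag_of w" if "w \<in> R.W" for w
      using flag_fc[OF flag_of_flag[OF that]] by (simp add: MG.fl_def)
    ultimately have "f ` \<Phi> = af 0 \<Phi>" using base_in by (simp add: flag_of_def one_image)
    then show False using orbit_eq[OF f(1), of \<Phi>] orbits_differ by simp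
  qed
qed

end

section \<open>The automorphism of the facet group\<close>

text \<open>
  The elements \<open>tail_prod i = s (i + 1) \<dots> s (n - 2)\<close> generate the facet group, and conjugation by
  the last reflection of the facet inverts each of them.
\<close>

context rotation_group
begin

abbreviation H where "H \<equiv> facet_group G n s"

definition tail_prod :: "nat \<Rightarrow> 'a" where
  "tail_prod i = inv (t i) \<otimes> t (n - 2)"

lemma facet_group_eq: "H = generate G (s ` {Suc 0..n - 2})"
  by (simp add: facet_group_def)

lemma facet_gens_closed: "s ` {Suc 0..n - 2} \<subseteq> carrier G"
  by (rule gens_closed) (use n2 in simp)

lemma facet_subgroup: "subgroup H G"
  unfolding facet_group_eq by (rule generate_is_subgroup[OF facet_gens_closed])

lemma facet_closed: "x \<in> H \<Longrightarrow> x \<in> carrier G"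
  using subgroup.mem_carrier[OF facet_subgroup] .

lemma tail_prod_interval: "i \<le> n - 2 \<Longrightarrow> tail_prod i \<in> generate G (s ` {Suc i..n - 2})"
  unfolding tail_prod_def by (rule prod_in_generate) (use n2 in auto)

lemma tail_prod_in: "i \<le> n - 2 \<Longrightarrow> tail_prod i \<in> H"
  unfolding facet_group_eq using tail_prod_interval[of i] mono_generate[of "s ` {Suc i..n - 2}" "s ` {Suc 0..n - 2}"]
  by (force intro: facet_gens_closed)

lemma tail_prod_closed: "i \<le> n - 2 \<Longrightarrow> tail_prod i \<in> carrier G"
  using tail_prod_in facet_closed by blast

lemma tail_prod_last: "tail_prod (n - 2) = \<one>"
  using t_closed[of "n - 2"] n2 by (simp add: tail_prod_def)

lemma tail_prod_rec:
  assumes "Suc i \<le> n - 2"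
  shows "tail_prod i = s (Suc i) \<otimes> tail_prod (Suc i)"
proof -
  have c: "t i \<in> carrier G" "s (Suc i) \<in> carrier G" "t (n - 2) \<in> carrier G"
    using t_closed[of i] t_closed[of "n - 2"] s_closed[of "Suc i"] assms by auto
  then show ?thesis by (simp add: tail_prod_def inv_mult_group m_assoc inv_mult_cancel)
qed

lemma gen_tail_prod:
  assumes "Suc i \<le> n - 2"
  shows "s (Suc i) = tail_prod i \<otimes> inv (tail_prod (Suc i))"
proof -
  have "s (Suc i) \<in> carrier G" using s_closed[of "Suc i"] assms by simp
  then show ?thesis using tail_prod_rec[OF assms] tail_prod_closed[OF assms] by (simp add: m_assoc)
qed

lemma tail_prod_inv:
  assumes "i + 2 \<le> n - 2"
  shows "inv (tail_prod i) = tail_prod i"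
proof -
  have "t i \<in> carrier G" "t (n - 2) \<in> carrier G"
    using t_closed[of i] t_closed[of "n - 2"] assms by auto
  then show ?thesis using rel[of i "n - 2"] assms by (simp add: tail_prod_def inv_mult_group)
qed

definition facet_hom :: "('a \<Rightarrow> 'a) \<Rightarrow> bool" where
  "facet_hom \<beta> \<longleftrightarrow> (\<forall>x \<in> H. \<beta> x \<in> H) \<and> (\<forall>x \<in> H. \<forall>y \<in> H. \<beta> (x \<otimes> y) = \<beta> x \<otimes> \<beta> y)"

lemma facet_iso_iff:
  "\<beta> \<in> iso (G\<lparr>carrier := H\<rparr>) (G\<lparr>carrier := H\<rparr>) \<longleftrightarrow> facet_hom \<beta> \<and> bij_betw \<beta> H H"
  by (auto simp: iso_def hom_def facet_hom_def)

lemma facet_hom_props: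
  assumes "facet_hom \<beta>"
  shows facet_hom_closed: "x \<in> H \<Longrightarrow> \<beta> x \<in> H"
    and facet_hom_mult: "x \<in> H \<Longrightarrow> y \<in> H \<Longrightarrow> \<beta> (x \<otimes> y) = \<beta> x \<otimes> \<beta> y"
    and facet_hom_one: "\<beta> \<one> = \<one>"
    and facet_hom_inv: "x \<in> H \<Longrightarrow> \<beta> (inv x) = inv (\<beta> x)"
proof -
  interpret H: subgroup H G by (rule facet_subgroup)
  show cl: "\<beta> x \<in> H" if "x \<in> H" for x using assms that by (auto simp: facet_hom_def)
  show mult: "\<beta> (x \<otimes> y) = \<beta> x \<otimes> \<beta> y" if "x \<in> H" "y \<in> H" for x y
    using assms that by (auto simp: facet_hom_def)
  have "\<beta> \<one> \<otimes> \<beta> \<one> = \<beta> \<one>" using mult[of \<one> \<one>] by simp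
  then show one: "\<beta> \<one> = \<one>" using cl[of \<one>] by (simp add: l_cancel_one)
  show "\<beta> (inv x) = inv (\<beta> x)" if "x \<in> H"
  proof -
    have "\<beta> (inv x) \<otimes> \<beta> x = \<one>" using mult[of "inv x" x] one that by simp
    then show ?thesis using inv_equality[of "\<beta> (inv x)" "\<beta> x"] cl that by simp
  qed
qed

text \<open>For \<open>i + 2 \<le> n - 2\<close> the product \<open>tail_prod i\<close> equals its
  inverse by \<open>rel\<close>, so inverting it means fixing it. The square in the value at
  \<open>s (n - 3)\<close> compensates the inversion of \<open>s (n - 2)\<close>: it is what keeps
  \<open>s (n - 3) \<otimes> s (n - 2)\<close> fixed.\<close>

lemma facet_hom_inverts:
  assumes n3: "n \<ge> 3" and \<beta>: "facet_hom \<beta>"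
    and b1: "\<beta> (s (n - 2)) = inv (s (n - 2))"
    and b2: "n \<ge> 4 \<Longrightarrow> \<beta> (s (n - 3)) = s (n - 3) \<otimes> s (n - 2) [^] (2::nat)"
    and b3: "\<And>j. 1 \<le> j \<Longrightarrow> j < n - 3 \<Longrightarrow> \<beta> (s j) = s j"
    and i: "i \<le> n - 2"
  shows "\<beta> (tail_prod i) = inv (tail_prod i)"
proof -
  interpret H: subgroup H G by (rule facet_subgroup)
  note hom = facet_hom_props[OF \<beta>]
  have sH: "s j \<in> H" if "1 \<le> j" "j \<le> n - 2" for j
    unfolding facet_group_eq by (rule generate.incl) (use that in auto)
  have X1: "tail_prod (n - 3) = s (n - 2)"
    using tail_prod_rec[of "n - 3"] n3 tail_prod_last sH[of "n - 2"]
    by (simp add: numeral_3_eq_3 numeral_2_eq_2 Suc_diff_Suc)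
  have low: "\<beta> (tail_prod i) = tail_prod i" if "i + 2 \<le> n - 2" for i
    using that
  proof (induction "n - i" arbitrary: i rule: less_induct)
    case less
    have X: "tail_prod i = s (Suc i) \<otimes> tail_prod (Suc i)" using tail_prod_rec less.prems by simp
    have c: "s (Suc i) \<in> H" "tail_prod (Suc i) \<in> H" using sH tail_prod_in less.prems by auto
    show ?case
    proof (cases "i + 2 = n - 2")
      case True
      then have e: "Suc i = n - 3" "n \<ge> 4" by auto
      have c': "s (n - 3) \<in> H" "s (n - 2) \<in> H" using sH e by auto
      have "\<beta> (tail_prod i) = s (n - 3) \<otimes> s (n - 2) [^] (2::nat) \<otimes> inv (s (n - 2))"
        using X hom(2)[OF c] b1 b2[OF e(2)] X1 e by simp
      also have "\<dots> = s (n - 3) \<otimes> s (n - 2)"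
        using c' by (simp add: numeral_2_eq_2 m_assoc)
      finally show ?thesis using X X1 e by simp
    next
      case False
      then have "\<beta> (tail_prod (Suc i)) = tail_prod (Suc i)" by (intro less.hyps) (use less.prems in auto)
      moreover have "\<beta> (s (Suc i)) = s (Suc i)" by (rule b3) (use False less.prems in auto)
      ultimately show ?thesis using X hom(2)[OF c] by simp
    qed
  qed
  consider "i = n - 2" | "i = n - 3" | "i + 2 \<le> n - 2" using i n3 by linarith
  then show ?thesis
  proof cases
    case 1
    then show ?thesis using tail_prod_last hom(3) by simp
  next
    case 2
    then show ?thesis using X1 b1 by simp
  next
    case 3
    then show ?thesis using low tail_prod_inv by simp
  qed
qed

text \<open>The converse of \<open>facet_hom_inverts\<close>; it shows that a homomorphism obtained
  from a reflection meets the specification in \<open>facet_bar\<close>.\<close>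

lemma facet_hom_gens:
  assumes n3: "n \<ge> 3" and \<beta>: "facet_hom \<beta>"
    and inverts: "\<And>i. i \<le> n - 2 \<Longrightarrow> \<beta> (tail_prod i) = inv (tail_prod i)"
  shows "\<beta> (s (n - 2)) = inv (s (n - 2))"
    and "n \<ge> 4 \<Longrightarrow> \<beta> (s (n - 3)) = s (n - 3) \<otimes> s (n - 2) [^] (2::nat)"
    and "1 \<le> j \<Longrightarrow> j < n - 3 \<Longrightarrow> \<beta> (s j) = s j"
proof -
  interpret H: subgroup H G by (rule facet_subgroup)
  note hom = facet_hom_props[OF \<beta>]
  have sH: "s j \<in> H" if "1 \<le> j" "j \<le> n - 2" for j
    unfolding facet_group_eq by (rule generate.incl) (use that in auto)
  have bs: "\<beta> (s (Suc i)) = inv (tail_prod i) \<otimes> tail_prod (Suc i)" if i: "Suc i \<le> n - 2" for i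
  proof -
    have c: "tail_prod i \<in> H" "tail_prod (Suc i) \<in> H" using tail_prod_in i by auto
    then show ?thesis using gen_tail_prod[OF i] hom(2)[of "tail_prod i" "inv (tail_prod (Suc i))"]
      hom(4)[OF c(2)] inverts[of i] inverts[of "Suc i"] i by simp
  qed
  have e: "Suc (n - 3) = n - 2" using n3 by simp
  have X1: "tail_prod (n - 3) = s (n - 2)"
    using tail_prod_rec[of "n - 3"] e tail_prod_last sH[of "n - 2"] n3 by simp
  show "\<beta> (s (n - 2)) = inv (s (n - 2))"
    using bs[of "n - 3"] e X1 tail_prod_last sH[of "n - 2"] n3 by simp
  show "\<beta> (s (n - 3)) = s (n - 3) \<otimes> s (n - 2) [^] (2::nat)" if n4: "n \<ge> 4"
  proof -
    have e': "Suc (n - 4) = n - 3" using n4 by simp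
    have "\<beta> (s (n - 3)) = tail_prod (n - 4) \<otimes> s (n - 2)"
      using bs[of "n - 4"] e' X1 tail_prod_inv[of "n - 4"] n4 by simp
    also have "tail_prod (n - 4) = s (n - 3) \<otimes> s (n - 2)"
      using tail_prod_rec[of "n - 4"] e' X1 n4 by simp
    finally show ?thesis using sH[of "n - 3"] sH[of "n - 2"] n4 by (simp add: numeral_2_eq_2 m_assoc)
  qed
  show "\<beta> (s j) = s j" if j: "1 \<le> j" "j < n - 3"
  proof -
    obtain i where i: "j = Suc i" using j by (cases j) auto
    then have "\<beta> (s j) = tail_prod i \<otimes> inv (tail_prod (Suc i))"
      using bs[of i] tail_prod_inv[of i] tail_prod_inv[of "Suc i"] j by simp
    then show ?thesis using gen_tail_prod[of i] i j by simp
  qed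
qed

lemma facet_induct [consumes 1, case_names tail_prod inv mult]:
  assumes x: "x \<in> H" and X: "\<And>i. i \<le> n - 2 \<Longrightarrow> Q (tail_prod i)"
    and I: "\<And>x. x \<in> H \<Longrightarrow> Q x \<Longrightarrow> Q (inv x)"
    and M: "\<And>x y. x \<in> H \<Longrightarrow> y \<in> H \<Longrightarrow> Q x \<Longrightarrow> Q y \<Longrightarrow> Q (x \<otimes> y)"
  shows "Q x"
proof -
  interpret H: subgroup H G by (rule facet_subgroup)
  have s: "Q (s j)" "s j \<in> H" if j: "j \<in> {Suc 0..n - 2}" for j
  proof -
    obtain i where i: "j = Suc i" "Suc i \<le> n - 2" using j by (cases j) auto
    have c: "tail_prod i \<in> H" "tail_prod (Suc i) \<in> H" using tail_prod_in i by auto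
    have "Q (tail_prod i \<otimes> inv (tail_prod (Suc i)))"
      by (intro M I X) (use c i in auto)
    then show "Q (s j)" using gen_tail_prod[OF i(2)] i by simp
    show "s j \<in> H" unfolding facet_group_eq by (rule generate.incl) (use j in auto)
  qed
  have "x \<in> generate G (s ` {Suc 0..n - 2})" using x facet_group_eq by simp
  then have "x \<in> H \<and> Q x"
  proof (induction rule: generate.induct)
    case one
    show ?case using X[of "n - 2"] tail_prod_last by simp
  next
    case (incl h)
    then show ?case using s by blast
  next
    case (inv h)
    then show ?case using s I by blast
  next
    case (eng x y)
    then show ?case using M by simp
  qed
  then show ?thesis by simp
qed

lemma facet_hom_invol:
  assumes \<beta>: "facet_hom \<beta>" and inverts: "\<And>i. i \<le> n - 2 \<Longrightarrow> \<beta> (tail_prod i) = inv (tail_prod i)"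
    and x: "x \<in> H"
  shows "\<beta> (\<beta> x) = x"
  using x
proof (induction rule: facet_induct)
  case (tail_prod i)
  then show ?case using inverts facet_hom_inv[OF \<beta> tail_prod_in] tail_prod_closed by simp
next
  case (inv x)
  then show ?case using facet_hom_inv[OF \<beta>] facet_hom_closed[OF \<beta>] by simp
next
  case (mult x y)
  then show ?case using facet_hom_mult[OF \<beta>] facet_hom_closed[OF \<beta>] by simp
qed

text \<open>
  If \<open>\<theta>\<close> sends the base flag to its \<open>(n - 2)\<close>-adjacent flag, then moving a flag \<open>(g, False)\<close> to
  \<open>(x \<otimes> g, False)\<close> multiplies its \<open>\<theta>\<close>-image by an element depending only on \<open>x\<close>.
\<close>

lemma facet_hom_exists:
  assumes V: "V \<subseteq> W" "(\<one>, False) \<in> V" "\<And>w i. w \<in> V \<Longrightarrow> i \<le> n - 2 \<Longrightarrow> adj i w \<in> V"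
    and \<theta>V: "\<And>w. w \<in> V \<Longrightarrow> \<theta> w \<in> V"
    and \<theta>a: "\<And>w i. w \<in> V \<Longrightarrow> i \<le> n - 2 \<Longrightarrow> \<theta> (adj i w) = adj i (\<theta> w)"
    and \<theta>1: "\<theta> (\<one>, False) = adj (n - 2) (\<one>, False)"
  shows "\<exists>\<beta>. facet_hom \<beta> \<and> (\<forall>i \<le> n - 2. \<beta> (tail_prod i) = inv (tail_prod i))"
proof -
  interpret H: subgroup H G by (rule facet_subgroup)
  \<comment> \<open>\<open>Z x y\<close> says that left multiplication of flags by \<open>x\<close>
    turns under \<open>\<theta>\<close> into left multiplication by \<open>y\<close>, uniformly in
    the flag. Uniformity makes the relation multiplicative, and two-step paths settle it for
    generators.\<close>
  define Z where "Z x y \<longleftrightarrow> y \<in> carrier G \<and> (\<forall>g u. (g, False) \<in> V \<and> \<theta> (g, False) = (u, True) \<longrightarrow>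
    (x \<otimes> g, False) \<in> V \<and> \<theta> (x \<otimes> g, False) = (y \<otimes> u, True))" for x y
  have Zc: "y \<in> carrier G" if "Z x y" for x y
    using that unfolding Z_def by (rule conjunct1)
  have pair: "(adj j (adj i (g, False))) \<in> V \<and> \<theta> (adj j (adj i (g, False))) = adj j (adj i (u, True))"
    if "(g, False) \<in> V" "\<theta> (g, False) = (u, True)" "i \<le> n - 2" "j \<le> n - 2" for g u i j
    using V(3)[OF V(3)[OF that(1,3)] that(4)] \<theta>a[OF V(3)[OF that(1,3)] that(4)] \<theta>a[OF that(1,3)] that(2)
    by (simp only:)
  have cl: "g \<in> carrier G \<and> u \<in> carrier G" if "(g, False) \<in> V" "\<theta> (g, False) = (u, True)" for g u
    using V(1) \<theta>V[OF that(1)] that by auto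
  have gens: "Z (inv (t j) \<otimes> t i) (t j \<otimes> inv (t i))" if ij: "i \<le> n - 2" "j \<le> n - 2" for i j
  proof -
    have c: "t i \<in> carrier G" "t j \<in> carrier G" using t_closed ij n2 by auto
    show ?thesis unfolding Z_def using pair[OF _ _ ij] cl c by (auto simp: m_assoc)
  qed
  have Zmult: "Z (x \<otimes> x') (y \<otimes> y')" if "Z x y" "Z x' y'" "x \<in> carrier G" "x' \<in> carrier G" for x y x' y'
    unfolding Z_def
  proof (intro conjI allI impI; (elim conjE)?)
    show "y \<otimes> y' \<in> carrier G" using that by (simp add: Z_def)
    fix g u assume gu: "(g, False) \<in> V" "\<theta> (g, False) = (u, True)"
    then have 1: "(x' \<otimes> g, False) \<in> V" "\<theta> (x' \<otimes> g, False) = (y' \<otimes> u, True)" using that(2) unfolding Z_def by auto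
    then have "(x \<otimes> (x' \<otimes> g), False) \<in> V" "\<theta> (x \<otimes> (x' \<otimes> g), False) = (y \<otimes> (y' \<otimes> u), True)"
      using that(1) unfolding Z_def by auto
    then show "(x \<otimes> x' \<otimes> g, False) \<in> V" "\<theta> (x \<otimes> x' \<otimes> g, False) = (y \<otimes> y' \<otimes> u, True)"
      using that cl[OF gu] by (simp_all add: Z_def m_assoc)
  qed
  have ex: "\<exists>y. Z x y" if "x \<in> H" for x
  proof -
    have "x \<in> generate G (s ` {Suc 0..n - 2})" using that facet_group_eq by simp
    then show ?thesis
    proof (induction rule: generate.induct)
      case one
      have "Z (inv (t 0) \<otimes> t 0) (t 0 \<otimes> inv (t 0))" by (rule gens) auto
      then show ?case by auto
    next
      case (incl h)
      then obtain j where "j \<in> {Suc 0..n - 2}" "h = s j" by blast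
      then obtain i where i: "h = s (Suc i)" "Suc i \<le> n - 2" by (cases j) auto
      have c: "t i \<in> carrier G" "s (Suc i) \<in> carrier G" using t_closed[of i] s_closed[of "Suc i"] i by auto
      have "inv (t i) \<otimes> t (Suc i) = h" using c i by (simp add: inv_mult_cancel)
      then show ?case using gens[of "Suc i" i] i by auto
    next
      case (inv h)
      then obtain j where "j \<in> {Suc 0..n - 2}" "h = s j" by blast
      then obtain i where i: "h = s (Suc i)" "Suc i \<le> n - 2" by (cases j) auto
      have c: "t i \<in> carrier G" "s (Suc i) \<in> carrier G" using t_closed[of i] s_closed[of "Suc i"] i by auto
      have "inv (t (Suc i)) \<otimes> t i = inv h" using c i by (simp add: inv_mult_group m_assoc)
      then show ?case using gens[of i "Suc i"] i by auto
    next
      case (eng x y)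
      have "x \<in> carrier G" "y \<in> carrier G"
        using eng.hyps generate_in_carrier[OF facet_gens_closed] by auto
      then show ?case using eng.IH Zmult by blast
    qed
  qed
  \<comment> \<open>\<open>\<theta>\<close> takes the base flag to \<open>(t (n - 2), True)\<close>.
    Removing this factor turns the partner \<open>y\<close> of \<open>x\<close> into its conjugate
    by \<open>t (n - 2)\<close>, so \<open>\<beta>\<close> inherits multiplicativity from
    \<open>Z\<close>.\<close>
  define \<beta> where "\<beta> x = inv (t (n - 2)) \<otimes> fst (\<theta> (x, False))" for x
  have tc: "t (n - 2) \<in> carrier G" using t_closed n2 by simp
  have b: "\<beta> x = inv (t (n - 2)) \<otimes> (y \<otimes> t (n - 2))" if "Z x y" "x \<in> carrier G" for x y
  proof -
    have "\<theta> (\<one>, False) = (t (n - 2), True)" using \<theta>1 tc by simp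
    then have "\<theta> (x \<otimes> \<one>, False) = (y \<otimes> t (n - 2), True)" using that(1) V(2) unfolding Z_def by blast
    then show ?thesis using that(2) by (simp add: \<beta>_def)
  qed
  have mult: "\<beta> (x \<otimes> x') = \<beta> x \<otimes> \<beta> x'" and closed: "\<beta> x \<in> carrier G" if xH: "x \<in> H" "x' \<in> H" for x x'
  proof -
    obtain y where y1: "Z x y" using ex[OF xH(1)] by (rule exE)
    obtain y' where y2: "Z x' y'" using ex[OF xH(2)] by (rule exE)
    note y = y1 y2
    have c: "y \<in> carrier G" "y' \<in> carrier G" "x \<in> carrier G" "x' \<in> carrier G"
      using Zc[OF y1] Zc[OF y2] xH facet_closed by auto
    show "\<beta> x \<in> carrier G" using b[OF y(1)] c tc by simp
    show "\<beta> (x \<otimes> x') = \<beta> x \<otimes> \<beta> x'"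
      using b[OF y(1)] b[OF y(2)] b[OF Zmult[OF y]] c tc by (simp add: m_assoc inv_mult_cancel)
  qed
  have inverts: "\<beta> (tail_prod i) = inv (tail_prod i)" if i: "i \<le> n - 2" for i
  proof -
    have c: "t i \<in> carrier G" using t_closed i n2 by simp
    have "Z (tail_prod i) (t i \<otimes> inv (t (n - 2)))" unfolding tail_prod_def by (rule gens) (use i in auto)
    then have "\<beta> (tail_prod i) = inv (t (n - 2)) \<otimes> (t i \<otimes> inv (t (n - 2)) \<otimes> t (n - 2))"
      using b tail_prod_closed[OF i] by blast
    also have "\<dots> = inv (tail_prod i)" using c tc by (simp add: tail_prod_def inv_mult_group m_assoc)
    finally show ?thesis .
  qed
  have "\<beta> \<one> \<otimes> \<beta> \<one> = \<beta> \<one>" using mult[of \<one> \<one>] by simp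
  then have one: "\<beta> \<one> = \<one>" using closed[of \<one> \<one>] by (simp add: l_cancel_one)
  have inv: "\<beta> (inv x) = inv (\<beta> x)" if "x \<in> H" for x
  proof -
    have "\<beta> (inv x) \<otimes> \<beta> x = \<one>" using mult[of "inv x" x] one that by simp
    then show ?thesis using inv_equality[of "\<beta> (inv x)" "\<beta> x"] closed that by simp
  qed
  have "\<beta> x \<in> H" if "x \<in> H" for x
    using that by (induction rule: facet_induct) (simp_all add: inverts tail_prod_in inv mult)
  then have "facet_hom \<beta>" using mult by (simp add: facet_hom_def)
  then show ?thesis using inverts by blast
qed

text \<open>The choice operator in \<open>facet_bar\<close> needs a witness that is bijective on the
  facet group; a homomorphism inverting all \<open>tail_prod i\<close> is its own inverse
  there.\<close>

lemma facet_bar_props: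
  assumes n3: "n \<ge> 3" and ex: "\<exists>\<beta>. facet_hom \<beta> \<and> (\<forall>i \<le> n - 2. \<beta> (tail_prod i) = inv (tail_prod i))"
  shows "facet_hom (facet_bar G n s)" and "\<And>i. i \<le> n - 2 \<Longrightarrow> facet_bar G n s (tail_prod i) = inv (tail_prod i)"
proof -
  let ?P = "\<lambda>\<beta>. \<beta> \<in> iso (G\<lparr>carrier := H\<rparr>) (G\<lparr>carrier := H\<rparr>) \<and>
     \<beta> (s (n - 2)) = inv (s (n - 2)) \<and>
     (n \<ge> 4 \<longrightarrow> \<beta> (s (n - 3)) = s (n - 3) \<otimes> s (n - 2) [^] (2::nat)) \<and>
     (\<forall>j. 1 \<le> j \<and> j < n - 3 \<longrightarrow> \<beta> (s j) = s j)"
  obtain \<beta> where \<beta>: "facet_hom \<beta>" "\<And>i. i \<le> n - 2 \<Longrightarrow> \<beta> (tail_prod i) = inv (tail_prod i)"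
    using ex by blast
  have "bij_betw \<beta> H H"
    by (rule bij_betw_byWitness[where f' = \<beta>])
      (use facet_hom_invol[OF \<beta>] facet_hom_closed[OF \<beta>(1)] in auto)
  then have "?P \<beta>" using facet_iso_iff \<beta>(1) facet_hom_gens[OF n3 \<beta>] by simp
  then have P: "?P (facet_bar G n s)" unfolding facet_bar_def by (rule someI[where P = ?P])
  then show hom: "facet_hom (facet_bar G n s)" using facet_iso_iff by blast
  show "facet_bar G n s (tail_prod i) = inv (tail_prod i)" if "i \<le> n - 2" for i
    by (rule facet_hom_inverts[OF n3 hom _ _ _ that]) (use P in auto)
qed

end

text \<open>Colour \<open>d - 2\<close> does not change the base facet. As the facet is regular, it
  has an automorphism taking the base flag to its \<open>(d - 2)\<close>-adjacent flag, and the
  action of that automorphism on the flags through the facet is the map required by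
  \<open>facet_hom_exists\<close>.\<close>

lemma (in chiral_flags) facet_reflection:
  assumes d3: "d \<ge> 3"
    and reg: "\<And>F. F \<in> facets d K \<Longrightarrow> regular_polytope (d - 1) (face_section K F)"
  shows "\<exists>\<beta>. RG.facet_hom \<beta> \<and> (\<forall>i \<le> d - 2. \<beta> (RG.tail_prod i) = inv\<^bsub>\<Gamma>\<^esub> (RG.tail_prod i))"
proof -
  obtain m where m: "d = Suc m" "m \<ge> 2" using d3 by (cases d) auto
  let ?F = "gfc d (R.base_flag False)"
  let ?V = "{w \<in> R.W. gfc d w = ?F}"
  interpret S: flag_model m ?V R.adj "face_section K ?F" gfc
    by (rule MG.section_model[OF m(1) base_in])
  have "?F \<in> Field K" using MG.Field_eq base_in by force
  moreover have "face_rank K ?F = int d - 1" using MG.face_rank_fc[OF base_in, of d] by simp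
  ultimately have "?F \<in> facets d K" by (simp add: facets_def)
  then have "regular_polytope m (face_section K ?F)" using reg m by fastforce
  then have reg': "flag_orbit (face_section K ?F) C = flags (face_section K ?F)"
    if "C \<in> flags (face_section K ?F)" for C
    using that by (simp add: regular_polytope_def)
  have V1: "R.base_flag False \<in> ?V" using base_in by simp
  have V2: "R.adj (d - 2) (R.base_flag False) \<in> ?V" using S.closed[OF V1] m by simp
  have "S.fl (R.base_flag False) \<in> flags (face_section K ?F)"
    unfolding S.flags_eq using V1 by (rule imageI)
  from reg'[OF this]
  have "S.fl (R.adj (d - 2) (R.base_flag False)) \<in> flag_orbit (face_section K ?F) (S.fl (R.base_flag False))"
    unfolding S.flags_eq using imageI[OF V2, of S.fl] by (rule ssubst)
  then obtain f where f: "f \<in> carrier (aut_group (face_section K ?F))"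
    "f ` S.fl (R.base_flag False) = S.fl (R.adj (d - 2) (R.base_flag False))"
    unfolding flag_orbit_def by (elim CollectE exE conjE) simp
  obtain \<theta> where \<theta>: "\<And>w. w \<in> ?V \<Longrightarrow> \<theta> w \<in> ?V"
    "\<And>w k. w \<in> ?V \<Longrightarrow> k \<le> m + 1 \<Longrightarrow> f (gfc k w) = gfc k (\<theta> w)"
    "\<And>w i. w \<in> ?V \<Longrightarrow> i < m \<Longrightarrow> \<theta> (R.adj i w) = R.adj i (\<theta> w)"
  proof (rule S.aut_flag_map[OF f(1)], goal_cases)
    case (1 \<theta>)
    show ?thesis by (rule that) (fact 1)+
  qed
  have "f ` S.fl (R.base_flag False) = S.fl (\<theta> (R.base_flag False))"
    by (rule S.aut_image_fl) (rule \<theta>(2)[OF V1])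
  then have e: "S.fl (\<theta> (R.base_flag False)) = S.fl (R.adj (d - 2) (R.base_flag False))"
    by (rule HOL.trans[OF HOL.sym f(2)])
  have i: "i < m" if "i \<le> d - 2" for i using that m by simp
  show ?thesis
  proof (rule RG.facet_hom_exists[of ?V \<theta>])
    show "?V \<subseteq> R.W" by (rule Collect_restrict)
    show "\<theta> (R.base_flag False) = R.adj (d - 2) (R.base_flag False)"
      by (rule S.fl_eqD[OF equalityD1[OF e] \<theta>(1)[OF V1] V2])
  qed (fact V1 S.closed[OF _ i] \<theta>(1) \<theta>(3)[OF _ i])+
qed

section \<open>The matching\<close>

locale extension = chiral_rotation_group +
  fixes c :: "'a set \<Rightarrow> 'a"
  assumes n3: "n \<ge> 3"
    and admissible: "admissible_choice G n s c"
    and reflection: "\<exists>\<beta>. facet_hom \<beta> \<and> (\<forall>i \<le> n - 2. \<beta> (tail_prod i) = inv (tail_prod i))"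
begin

abbreviation bar where "bar \<equiv> facet_bar G n s"
abbreviation E where "E \<equiv> tail_group G n s"
abbreviation seeds where "seeds \<equiv> seed_matching G n s c"
abbreviation FM where "FM \<equiv> full_matching G n s c"

lemma bar_hom: "facet_hom bar"
  and bar_tail_prod: "i \<le> n - 2 \<Longrightarrow> bar (tail_prod i) = inv (tail_prod i)"
  using facet_bar_props[OF n3 reflection] by auto

lemmas bar_closed = facet_hom_closed[OF bar_hom]
  and bar_mult = facet_hom_mult[OF bar_hom]
  and bar_one = facet_hom_one[OF bar_hom]
  and bar_inv = facet_hom_inv[OF bar_hom]

lemma bar_bar: "x \<in> H \<Longrightarrow> bar (bar x) = x"
  by (rule facet_hom_invol[OF bar_hom bar_tail_prod])

sublocale H: subgroup H G
  by (rule facet_subgroup)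

lemma tail_subgroup: "1 \<le> j \<Longrightarrow> subgroup (E j) G"
  unfolding tail_group_def by (rule generate_is_subgroup) (use s_closed n3 in auto)

lemma tail_closed: "1 \<le> j \<Longrightarrow> x \<in> E j \<Longrightarrow> x \<in> carrier G"
  using subgroup.mem_carrier[OF tail_subgroup] .

lemma tail_mono: "1 \<le> j \<Longrightarrow> j \<le> k \<Longrightarrow> E k \<subseteq> E j"
  unfolding tail_group_def by (rule mono_generate) auto

lemma tail_one: "E 1 = carrier G"
proof -
  have "{1..n - 1} = {1..<n}" using n3 by auto
  then show ?thesis using gen by (simp add: tail_group_def)
qed

lemma gens_in_tail: "j \<le> i \<Longrightarrow> i < n \<Longrightarrow> s i \<in> E j"
  unfolding tail_group_def by (rule generate.incl) auto

lemma tail_facet: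
  assumes "1 \<le> j" "j < n" "x \<in> E j" "x \<in> H"
  shows "x \<in> generate G (s ` {j..n - 2})"
proof -
  obtain b where b: "j = Suc b" using assms(1) by (cases j) auto
  have "{Suc b..<n} = {j..n - 1}" "b \<le> n - 2" using b assms n3 by auto
  moreover have "x \<in> generate G (s ` {1..n - 2})" using assms(4) facet_group_eq by simp
  ultimately show ?thesis
    using ip[of b "n - 2"] assms b n3 by (auto simp: tail_group_def)
qed

text \<open>Different powers of the last rotation therefore lie in different cosets of the facet
  group, so the pairs of powers do not compete for a coset.\<close>

lemma tail_facet_trivial: "x \<in> E (n - 1) \<Longrightarrow> x \<in> H \<Longrightarrow> x = \<one>"
  using tail_facet[of "n - 1" x] n3 by (simp add: generate_empty)

text \<open>By the old intersection property \<open>x\<close> is a product of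
  \<open>s j, \<dots>, s (n - 2)\<close> and their inverses. As \<open>bar\<close> sends
  \<open>s (i + 1)\<close> to \<open>inv (tail_prod i) \<otimes> tail_prod (i + 1)\<close>, no
  generator of smaller index enters.\<close>

lemma bar_tail:
  assumes "1 \<le> j" "j < n" "x \<in> E j" "x \<in> H"
  shows "bar x \<in> E j"
proof -
  interpret Ej: subgroup "E j" G using tail_subgroup assms by simp
  have X: "tail_prod i \<in> E j" if "j \<le> Suc i" "i \<le> n - 2" for i
  proof -
    have "generate G (s ` {Suc i..n - 2}) \<subseteq> E j"
      unfolding tail_group_def by (rule mono_generate) (use that in auto)
    then show ?thesis using tail_prod_interval that by blast
  qed
  have gens: "bar (s l) \<in> E j \<and> s l \<in> H" if l: "l \<in> {j..n - 2}" for l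
  proof -
    obtain i where i: "l = Suc i" using assms l by (cases l) auto
    have c: "tail_prod i \<in> H" "tail_prod (Suc i) \<in> H" using tail_prod_in i l by auto
    have "bar (s l) = inv (tail_prod i) \<otimes> tail_prod (Suc i)"
      using gen_tail_prod[of i] bar_mult[of "tail_prod i" "inv (tail_prod (Suc i))"] bar_inv[of "tail_prod (Suc i)"]
        bar_tail_prod[of i] bar_tail_prod[of "Suc i"] tail_prod_closed[of "Suc i"] c i l by simp
    moreover have "s l \<in> H" unfolding facet_group_eq by (rule generate.incl) (use assms l in auto)
    ultimately show ?thesis using X[of i] X[of "Suc i"] i l by simp
  qed
  have "x \<in> generate G (s ` {j..n - 2})" by (rule tail_facet[OF assms])
  then have "bar x \<in> E j \<and> x \<in> H"
  proof (induction rule: generate.induct)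
    case one
    show ?case by (simp add: bar_one)
  next
    case (incl h)
    then show ?case using gens by auto
  next
    case (inv h)
    then show ?case using gens by (auto simp: bar_inv)
  next
    case (eng x y)
    then show ?case by (simp add: bar_mult)
  qed
  then show ?thesis by simp
qed

abbreviation \<omega> where "\<omega> \<equiv> s (n - 1)"

lemma last_closed: "\<omega> \<in> carrier G"
  using s_closed n3 by simp

lemma last_pow: "E (n - 1) = {\<omega> [^] (k :: int) | k. k \<in> UNIV}"
  unfolding tail_group_def using generate_pow[OF last_closed] by simp

lemma lcoset_iff:
  assumes "g \<in> carrier G"
  shows "x \<in> g <# H \<longleftrightarrow> x \<in> carrier G \<and> inv g \<otimes> x \<in> H"
proof
  assume "x \<in> g <# H"
  then obtain h where "h \<in> H" "x = g \<otimes> h" by (auto simp: l_coset_def)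
  then show "x \<in> carrier G \<and> inv g \<otimes> x \<in> H" using assms by (simp add: inv_mult_cancel)
next
  assume x: "x \<in> carrier G \<and> inv g \<otimes> x \<in> H"
  then have "x = g \<otimes> (inv g \<otimes> x)" using assms by (simp add: inv_mult_cancel)
  then show "x \<in> g <# H" using x unfolding l_coset_def by blast
qed

lemma lcosets_iff:
  assumes "A \<in> lcosets H" "x \<in> A" "y \<in> carrier G"
  shows "y \<in> A \<longleftrightarrow> inv x \<otimes> y \<in> H"
proof -
  obtain g where g: "g \<in> carrier G" "A = g <# H" using assms(1) by (auto simp: LCOSETS_def)
  have x: "x \<in> carrier G" "inv g \<otimes> x \<in> H" using lcoset_iff[OF g(1)] assms(2) g(2) by auto
  have e1: "inv g \<otimes> y = inv g \<otimes> x \<otimes> (inv x \<otimes> y)" using g x assms(3) by (simp add: m_assoc inv_mult_cancel)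
  have e2: "inv x \<otimes> y = inv (inv g \<otimes> x) \<otimes> (inv g \<otimes> y)"
    using g x assms(3) by (simp add: m_assoc inv_mult_cancel inv_mult_group)
  show ?thesis
    unfolding g(2) lcoset_iff[OF g(1)]
  proof
    assume "y \<in> carrier G \<and> inv g \<otimes> y \<in> H"
    then show "inv x \<otimes> y \<in> H" unfolding e2 by (intro H.m_closed[OF H.m_inv_closed[OF x(2)]]) simp
  next
    assume "inv x \<otimes> y \<in> H"
    then have "inv g \<otimes> y \<in> H" unfolding e1 by (rule H.m_closed[OF x(2)])
    then show "y \<in> carrier G \<and> inv g \<otimes> y \<in> H" using assms(3) by simp
  qed
qed

lemma lcosets_closed: "A \<in> lcosets H \<Longrightarrow> x \<in> A \<Longrightarrow> x \<in> carrier G"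
  using lcoset_iff by (auto simp: LCOSETS_def)

section \<open>One matched pair for each coset\<close>

lemma coset_classD:
  assumes "A \<in> coset_class G n s k"
  shows "A \<in> lcosets H" "A \<inter> E k \<noteq> {}" "A \<inter> E (k + 1) = {}"
  using assms unfolding coset_class_def by blast+

lemma choice:
  assumes "k \<in> {1..n - 2}" "A \<in> coset_class G n s k"
  shows "c A \<in> A" "c A \<in> E k"
  using admissible assms unfolding admissible_choice_def by blast+

lemma seeds_cases [consumes 1, case_names power coset]:
  assumes "(u, v) \<in> seeds"
  obtains "u \<in> E (n - 1)" "v = inv u"
  | k A where "k \<in> {1..n - 2}" "A \<in> coset_class G n s k" "u = c A" "v = c A"
proof -
  consider k :: int where "u = \<omega> [^] k" "v = \<omega> [^] (- k)"
    | k A where "k \<in> {1..n - 2}" "A \<in> coset_class G n s k" "u = c A" "v = c A"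
    using assms unfolding seed_matching_def by blast
  then show thesis
  proof cases
    case 1
    then have "u \<in> E (n - 1)" unfolding last_pow by blast
    moreover have "v = inv u" using 1 last_closed by (simp add: int_pow_neg)
    ultimately show thesis using that(1) by blast
  qed (use that(2) in blast)
qed

lemma seeds_power: "u \<in> E (n - 1) \<Longrightarrow> (u, inv u) \<in> seeds"
proof -
  assume "u \<in> E (n - 1)"
  then obtain k :: int where "u = \<omega> [^] k" unfolding last_pow by blast
  then have "u = \<omega> [^] k" "inv u = \<omega> [^] (- k)" using last_closed by (simp_all add: int_pow_neg)
  then show "(u, inv u) \<in> seeds" unfolding seed_matching_def by blast
qed

lemma seeds_choice: "k \<in> {1..n - 2} \<Longrightarrow> A \<in> coset_class G n s k \<Longrightarrow> (c A, c A) \<in> seeds"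
  unfolding seed_matching_def by blast

lemma seeds_closed: "(u, v) \<in> seeds \<Longrightarrow> u \<in> carrier G \<and> v \<in> carrier G"
proof (induction rule: seeds_cases)
  case power
  then show ?case using tail_closed[of "n - 1" u] n3 by simp
next
  case (coset k A)
  then show ?case using choice lcosets_closed coset_classD(1) by blast
qed

lemma seeds_sym: "(u, v) \<in> seeds \<Longrightarrow> (v, u) \<in> seeds"
proof -
  assume "(u, v) \<in> seeds"
  then show ?thesis
  proof (cases rule: seeds_cases)
    case power
    interpret El: subgroup "E (n - 1)" G by (rule tail_subgroup) (use n3 in simp)
    have "(inv u, inv (inv u)) \<in> seeds" by (rule seeds_power[OF El.m_inv_closed[OF power(1)]])
    then show ?thesis using power El.mem_carrier[OF power(1)] by simp
  next
    case coset
    then show ?thesis using seeds_choice by simp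
  qed
qed

lemma coset_class_disjoint:
  assumes "A \<in> coset_class G n s k" "k < j" "x \<in> A"
  shows "x \<notin> E j"
  using coset_classD(3)[OF assms(1)] tail_mono[of "k + 1" j] assms by auto

text \<open>The coset of \<open>u\<close> meets \<open>E j\<close>. Its seed was chosen in the tail
  group of largest index that the coset meets, and tail groups shrink as the index grows, so the
  seed lies in \<open>E j\<close> too.\<close>

lemma seeds_tail:
  assumes uv: "(u, v) \<in> seeds" and \<alpha>: "\<alpha> \<in> H" and j: "1 \<le> j" "j < n" and u: "u \<otimes> \<alpha> \<in> E j"
  shows "u \<in> E j \<and> v \<in> E j"
  using uv
proof (cases rule: seeds_cases)
  case power
  interpret Ej: subgroup "E j" G by (rule tail_subgroup[OF j(1)])
  have "u \<in> E j" by (rule subsetD[OF tail_mono power(1)]) (use j in auto)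
  then show ?thesis using power by simp
next
  case (coset k A)
  have A: "A \<in> lcosets H" "u \<in> A" using coset_classD(1) choice coset by auto
  have uc: "u \<in> carrier G" using seeds_closed uv by blast
  have "u \<otimes> \<alpha> \<in> A" using lcosets_iff[OF A, of "u \<otimes> \<alpha>"] \<alpha> uc by (simp add: inv_mult_cancel)
  then have "j \<le> k" using coset_class_disjoint[OF coset(2), of j] u by (meson not_le_imp_less)
  then show ?thesis using choice[OF coset(1,2)] tail_mono[OF j(1)] coset by blast
qed

lemma seeds_unique:
  assumes uv: "(u, v) \<in> seeds" "(u', v') \<in> seeds" and e: "inv u \<otimes> u' \<in> H"
  shows "u = u' \<and> v = v'"
proof -
  interpret El: subgroup "E (n - 1)" G by (rule tail_subgroup) (use n3 in simp)
  have uc: "u \<in> carrier G" "u' \<in> carrier G" using seeds_closed uv by blast+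
  have e': "inv u' \<otimes> u \<in> H" using H.m_inv_closed[OF e] uc by (simp add: inv_mult_group)
  \<comment> \<open>A coset with a chosen representative avoids \<open>E (k + 1)\<close> and
    therefore all powers of the last rotation, so no coset receives seeds of both kinds.\<close>
  have mixed: False if "x \<in> E (n - 1)" "k \<in> {1..n - 2}" "A \<in> coset_class G n s k" "inv (c A) \<otimes> x \<in> H" "x \<in> carrier G" for x k A
  proof -
    have "x \<in> A" using lcosets_iff[OF coset_classD(1)[OF that(3)] choice(1)[OF that(2,3)] that(5)] that(4) by simp
    moreover have "k < n - 1" using that(2) n3 by auto
    ultimately show False using coset_class_disjoint[OF that(3)] that(1) by blast
  qed
  from uv(1) show ?thesis
  proof (cases rule: seeds_cases)
    case 1: power
    from uv(2) show ?thesis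
    proof (cases rule: seeds_cases)
      case power
      have "inv u \<otimes> u' = \<one>"
        by (rule tail_facet_trivial[OF El.m_closed[OF El.m_inv_closed[OF 1(1)] power(1)] e])
      moreover have "u' = u \<otimes> (inv u \<otimes> u')" using uc by (simp add: inv_mult_cancel)
      ultimately have "u' = u" using uc by simp
      then show ?thesis using 1 power by simp
    next
      case (coset k A)
      then show ?thesis using mixed[OF 1(1) coset(1,2)] e' uc by blast
    qed
  next
    case 1: (coset k A)
    from uv(2) show ?thesis
    proof (cases rule: seeds_cases)
      case power
      then show ?thesis using mixed[OF power(1) 1(1,2)] e uc 1 by blast
    next
      case (coset l B)
      have A: "A \<in> lcosets H" "u \<in> A" and B: "B \<in> lcosets H" "u' \<in> B"
        using coset_classD(1) choice 1 coset by auto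
      have "u' \<in> A" using lcosets_iff[OF A uc(2)] e by simp
      have "x \<in> A \<longleftrightarrow> x \<in> B" for x
        using lcosets_iff[OF A(1) \<open>u' \<in> A\<close>] lcosets_iff[OF B] lcosets_closed[OF A(1)] lcosets_closed[OF B(1)] by metis
      then have "A = B" by blast
      then show ?thesis using 1 coset by simp
    qed
  qed
qed

lemma seeds_cover:
  assumes g: "g \<in> carrier G"
  obtains u v where "(u, v) \<in> seeds" "inv u \<otimes> g \<in> H"
proof -
  let ?A = "g <# H"
  have A: "?A \<in> lcosets H" using g by (auto simp: LCOSETS_def)
  have gA: "g \<in> ?A" using lcoset_iff[OF g] g by simp
  let ?K = "{k. 1 \<le> k \<and> k < n \<and> ?A \<inter> E k \<noteq> {}}"
  \<comment> \<open>The coset meets \<open>E 1\<close>, the whole group, so there is a last tail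
    group that it meets; the index of that group decides which rule provides the seed.\<close>
  define k where "k = Max ?K"
  have fin: "finite ?K" by (rule finite_subset[of _ "{..<n}"]) auto
  have "1 \<in> ?K" using tail_one gA g n3 by auto
  then have k: "k \<in> ?K" unfolding k_def using Max_in[OF fin] by blast
  show thesis
  proof (cases "k = n - 1")
    case True
    then obtain u where u: "u \<in> ?A" "u \<in> E (n - 1)" using k by blast
    then have "inv u \<otimes> g \<in> H" using lcosets_iff[OF A u(1) g] gA by simp
    then show thesis using that seeds_power[OF u(2)] by blast
  next
    case False
    then have kn: "k \<in> {1..n - 2}" using k by auto
    have "?A \<inter> E (k + 1) = {}"
    proof (rule ccontr)
      assume "?A \<inter> E (k + 1) \<noteq> {}"
      then have "k + 1 \<in> ?K" using kn by auto
      then have "k + 1 \<le> k" unfolding k_def using Max_ge[OF fin] by blast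
      then show False by simp
    qed
    then have cc: "?A \<in> coset_class G n s k" using A k unfolding coset_class_def by blast
    have "inv (c ?A) \<otimes> g \<in> H" using lcosets_iff[OF A choice(1)[OF kn cc] g] gA by simp
    then show thesis using that seeds_choice[OF kn cc] by blast
  qed
qed

section \<open>The matching as a map\<close>

lemma FM_iff: "(g, h) \<in> FM \<longleftrightarrow> (\<exists>u v \<alpha>. (u, v) \<in> seeds \<and> \<alpha> \<in> H \<and> g = u \<otimes> \<alpha> \<and> h = v \<otimes> bar \<alpha>)"
  unfolding full_matching_def by blast

text \<open>Seeds are pairs of mutually inverse powers or of equal elements, and \<open>bar\<close>
  is an involution on the facet group; hence a single map \<open>mt\<close> describes the matching
  in both directions.\<close>

lemma FM_sym: "(g, h) \<in> FM \<Longrightarrow> (h, g) \<in> FM"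
  unfolding FM_iff using seeds_sym bar_closed bar_bar by metis

lemma FM_closed: "(g, h) \<in> FM \<Longrightarrow> g \<in> carrier G \<and> h \<in> carrier G"
  unfolding FM_iff using seeds_closed bar_closed H.mem_carrier by blast

lemma FM_unique:
  assumes "(g, h) \<in> FM" "(g, h') \<in> FM"
  shows "h = h'"
proof -
  obtain u v \<alpha> where 1: "(u, v) \<in> seeds" "\<alpha> \<in> H" "g = u \<otimes> \<alpha>" "h = v \<otimes> bar \<alpha>" using assms(1) FM_iff by blast
  obtain u' v' \<alpha>' where 2: "(u', v') \<in> seeds" "\<alpha>' \<in> H" "g = u' \<otimes> \<alpha>'" "h' = v' \<otimes> bar \<alpha>'" using assms(2) FM_iff by blast
  have cl: "u \<in> carrier G" "u' \<in> carrier G" "\<alpha> \<in> carrier G" "\<alpha>' \<in> carrier G"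
    using seeds_closed 1 2 H.mem_carrier by blast+
  have "u' = u \<otimes> \<alpha> \<otimes> inv \<alpha>'" using 1 2 cl by (metis inv_solve_right m_closed)
  then have "inv u \<otimes> u' = \<alpha> \<otimes> inv \<alpha>'" using cl by (simp add: m_assoc inv_mult_cancel)
  then have "inv u \<otimes> u' \<in> H" using 1 2 by simp
  then have "u = u'" "v = v'" using seeds_unique[OF 1(1) 2(1)] by auto
  moreover have "\<alpha> = \<alpha>'" using 1(3) 2(3) \<open>u = u'\<close> cl by simp
  ultimately show ?thesis using 1 2 by simp
qed

lemma FM_total:
  assumes "g \<in> carrier G"
  obtains h where "(g, h) \<in> FM"
proof -
  obtain u v where uv: "(u, v) \<in> seeds" "inv u \<otimes> g \<in> H" using seeds_cover[OF assms] .
  have "g = u \<otimes> (inv u \<otimes> g)" using seeds_closed[OF uv(1)] assms by (simp add: inv_mult_cancel)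
  then show thesis using that uv FM_iff by blast
qed

definition mt :: "'a \<Rightarrow> 'a" where
  "mt g = (THE h. (g, h) \<in> FM)"

lemma mt_iff: "g \<in> carrier G \<Longrightarrow> (g, h) \<in> FM \<longleftrightarrow> h = mt g"
proof -
  assume g: "g \<in> carrier G"
  obtain h' where h': "(g, h') \<in> FM" using FM_total[OF g] .
  have "mt g = h'" unfolding mt_def
  proof (rule the_equality)
    show "(g, h') \<in> FM" by (rule h')
    show "h = h'" if "(g, h) \<in> FM" for h using that h' by (rule FM_unique)
  qed
  then show ?thesis using h' FM_unique by blast
qed

lemma mt_closed: "g \<in> carrier G \<Longrightarrow> mt g \<in> carrier G"
  using mt_iff FM_closed by blast

lemma mt_mt: "g \<in> carrier G \<Longrightarrow> mt (mt g) = g"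
  using mt_iff FM_sym mt_closed by metis

lemma mt_facet:
  assumes g: "g \<in> carrier G" and \<alpha>: "\<alpha> \<in> H"
  shows "mt (g \<otimes> \<alpha>) = mt g \<otimes> bar \<alpha>"
proof -
  have "(g, mt g) \<in> FM" using mt_iff[OF g] by simp
  then obtain u v \<gamma> where 1: "(u, v) \<in> seeds" "\<gamma> \<in> H" "g = u \<otimes> \<gamma>" "mt g = v \<otimes> bar \<gamma>" using FM_iff by blast
  have cl: "u \<in> carrier G" "v \<in> carrier G" using seeds_closed 1 by blast+
  have "g \<otimes> \<alpha> = u \<otimes> (\<gamma> \<otimes> \<alpha>)" "mt g \<otimes> bar \<alpha> = v \<otimes> bar (\<gamma> \<otimes> \<alpha>)"
    using 1 \<alpha> cl by (simp_all add: m_assoc bar_mult bar_closed)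
  then have "(g \<otimes> \<alpha>, mt g \<otimes> bar \<alpha>) \<in> FM" unfolding FM_iff using 1 \<alpha> H.m_closed by blast
  then show ?thesis using mt_iff[of "g \<otimes> \<alpha>"] g \<alpha> by simp
qed

lemma mt_tail:
  assumes j: "1 \<le> j" "j < n" and g: "g \<in> E j"
  shows "mt g \<in> E j"
proof -
  interpret Ej: subgroup "E j" G by (rule tail_subgroup[OF j(1)])
  have "(g, mt g) \<in> FM" using mt_iff[of g] g by simp
  then obtain u v \<alpha> where 1: "(u, v) \<in> seeds" "\<alpha> \<in> H" "g = u \<otimes> \<alpha>" "mt g = v \<otimes> bar \<alpha>" using FM_iff by blast
  have uv: "u \<in> E j" "v \<in> E j" using seeds_tail[OF 1(1,2) j] g 1(3) by auto
  have "\<alpha> = inv u \<otimes> g" using 1 uv by (simp add: inv_mult_cancel)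
  then have "\<alpha> \<in> E j" using uv g by simp
  then have "bar \<alpha> \<in> E j" by (rule bar_tail[OF j _ 1(2)])
  then show ?thesis using uv 1 by simp
qed

lemma mt_power: "u \<in> E (n - 1) \<Longrightarrow> mt u = inv u"
proof -
  assume u: "u \<in> E (n - 1)"
  interpret El: subgroup "E (n - 1)" G by (rule tail_subgroup) (use n3 in simp)
  have "u = u \<otimes> \<one>" "inv u = inv u \<otimes> bar \<one>" using u by (simp_all add: bar_one)
  then have "(u, inv u) \<in> FM" unfolding FM_iff using seeds_power[OF u] H.one_closed by blast
  then show ?thesis using mt_iff[of u "inv u"] u by simp
qed

section \<open>The extended group\<close>

abbreviation X where "X \<equiv> two_copies G"
abbreviation S where "S \<equiv> perm_group X"
abbreviation \<tau> where "\<tau> \<equiv> tau G n s c"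
abbreviation \<eta> where "\<eta> \<equiv> eta G n s c"

text \<open>The operation of the same name inside \<open>eta\<close>, but indexed by group elements,
  which makes it an injective homomorphism of the old group into the permutations.\<close>

definition shift :: "'a \<Rightarrow> 'a \<times> bool \<Rightarrow> 'a \<times> bool" where
  "shift x = (\<lambda>(g, e). if g \<in> carrier G then (g \<otimes> x, e) else (g, e))"

lemma shift_simps: "g \<in> carrier G \<Longrightarrow> shift x (g, e) = (g \<otimes> x, e)"
  "g \<notin> carrier G \<Longrightarrow> shift x (g, e) = (g, e)"
  by (simp_all add: shift_def)

lemma tau_simps: "g \<in> carrier G \<Longrightarrow> \<tau> (g, e) = (mt g, \<not> e)"
  "g \<notin> carrier G \<Longrightarrow> \<tau> (g, e) = (g, e)"
proof -
  assume g: "g \<in> carrier G"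
  have "(h, g) \<in> FM \<longleftrightarrow> (g, h) \<in> FM" for h using FM_sym by blast
  then have "(THE h. (h, g) \<in> FM) = mt g" unfolding mt_def by simp
  then show "\<tau> (g, e) = (mt g, \<not> e)" using g by (simp add: tau_def mt_def)
qed (simp add: tau_def)

lemma mem_X [simp]: "(g, e) \<in> X \<longleftrightarrow> g \<in> carrier G"
  by (simp add: two_copies_def)

sublocale S: group S
  by (rule perm_group_group)

lemma permutesI: "(\<And>w. w \<in> X \<Longrightarrow> f w \<in> X \<and> h w \<in> X \<and> h (f w) = w \<and> f (h w) = w) \<Longrightarrow> (\<And>w. w \<notin> X \<Longrightarrow> f w = w)
  \<Longrightarrow> f permutes X"
  by (rule bij_imp_permutes, rule bij_betw_byWitness[where f' = h]) auto

lemma shift_permutes: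
  assumes "x \<in> carrier G"
  shows "shift x permutes X"
proof (rule permutesI[where h = "shift (inv x)"])
  fix w assume "w \<in> X"
  then show "shift x w \<in> X \<and> shift (inv x) w \<in> X \<and> shift (inv x) (shift x w) = w \<and> shift x (shift (inv x) w) = w"
    using assms by (cases w) (simp add: shift_simps m_assoc)
next
  fix w assume "w \<notin> X"
  then show "shift x w = w" by (cases w) (simp add: shift_simps)
qed

lemma tau_permutes: "\<tau> permutes X"
proof (rule permutesI[where h = \<tau>])
  fix w assume "w \<in> X"
  then show "\<tau> w \<in> X \<and> \<tau> w \<in> X \<and> \<tau> (\<tau> w) = w \<and> \<tau> (\<tau> w) = w"
    by (cases w) (simp add: tau_simps mt_closed mt_mt)
next
  fix w assume "w \<notin> X"
  then show "\<tau> w = w" by (cases w) (simp add: tau_simps)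
qed

lemma shift_in: "x \<in> carrier G \<Longrightarrow> shift x \<in> carrier S"
  and tau_in: "\<tau> \<in> carrier S"
  using shift_permutes tau_permutes by (simp_all add: carrier_perm_group)

sublocale SH: group_hom G S shift
proof
  show "shift \<in> hom G S"
  proof (rule homI)
    fix x y assume xy: "x \<in> carrier G" "y \<in> carrier G"
    show "shift (x \<otimes> y) = shift x \<otimes>\<^bsub>S\<^esub> shift y"
      unfolding mult_perm_group
    proof
      fix w
      show "shift (x \<otimes> y) w = (shift y \<circ> shift x) w"
        using xy by (cases w) (simp add: shift_def m_assoc)
    qed
  qed (rule shift_in)
qed

declare SH.hom_inv [simp del]

lemma shift_inj:
  assumes e: "shift x = shift y" and xy: "x \<in> carrier G" "y \<in> carrier G"
  shows "x = y"
proof -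
  have "shift x (\<one>, False) = shift y (\<one>, False)" by (simp only: e)
  then show ?thesis using xy by (simp add: shift_simps)
qed

lemma tau_tau: "\<tau> \<otimes>\<^bsub>S\<^esub> \<tau> = \<one>\<^bsub>S\<^esub>"
  unfolding mult_perm_group one_perm_group
proof
  fix w
  show "(\<tau> \<circ> \<tau>) w = id w"
    by (cases w; cases "fst w \<in> carrier G") (simp_all add: tau_simps mt_closed mt_mt)
qed

lemma inv_tau: "inv\<^bsub>S\<^esub> \<tau> = \<tau>"
  using S.inv_equality[OF tau_tau tau_in tau_in] .

lemma shift_tau:
  assumes x: "x \<in> H" and b: "bar x = inv x"
  shows "shift x \<otimes>\<^bsub>S\<^esub> \<tau> = \<tau> \<otimes>\<^bsub>S\<^esub> shift (inv x)"
  unfolding mult_perm_group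
proof
  fix w
  show "(\<tau> \<circ> shift x) w = (shift (inv x) \<circ> \<tau>) w"
    using x b by (cases w; cases "fst w \<in> carrier G") (simp_all add: tau_simps shift_simps mt_closed mt_facet)
qed

lemma eta_low: "k < n \<Longrightarrow> \<eta> k = shift (s k)"
  and eta_last: "\<eta> n = inv\<^bsub>S\<^esub> (shift \<omega>) \<otimes>\<^bsub>S\<^esub> \<tau>"
  by (simp_all add: eta_def Let_def shift_def)

lemma eta_last_shift: "\<eta> n = shift (inv \<omega>) \<otimes>\<^bsub>S\<^esub> \<tau>"
  using eta_last SH.hom_inv[OF last_closed] by simp

lemma eta_in: "k \<in> {1..n} \<Longrightarrow> \<eta> k \<in> carrier S"
  using eta_low[of k] eta_last_shift shift_in s_closed[of k] last_closed tau_in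
  by (cases "k = n") auto

lemma eta_prod_low: "i < n \<Longrightarrow> rot_prod S \<eta> i = shift (t i)"
proof (induction i)
  case (Suc i)
  then show ?case using t_closed[of i] s_closed[of "Suc i"] by (simp add: eta_low)
qed simp

text \<open>\<open>\<eta> n\<close> starts with the inverse of the last rotation, which cancels the
  last factor of \<open>t (n - 1)\<close>. What remains differs from the shift by
  \<open>t (n - 2)\<close> by the matching alone.\<close>

lemma eta_prod_last: "rot_prod S \<eta> n = shift (t (n - 2)) \<otimes>\<^bsub>S\<^esub> \<tau>"
proof -
  have n: "n = Suc (n - 1)" "n - 1 = Suc (n - 2)" using n3 by auto
  have c: "t (n - 2) \<in> carrier G" "t (n - 1) \<in> carrier G" using t_closed n3 by auto
  have t: "t (n - 1) = t (n - 2) \<otimes> \<omega>" using n(2) rot_prod.simps(2)[of G s "n - 2"] by simp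
  have "rot_prod S \<eta> n = rot_prod S \<eta> (n - 1) \<otimes>\<^bsub>S\<^esub> \<eta> n"
    using n(1) rot_prod.simps(2)[of S \<eta> "n - 1"] by simp
  also have "\<dots> = shift (t (n - 1)) \<otimes>\<^bsub>S\<^esub> (shift (inv \<omega>) \<otimes>\<^bsub>S\<^esub> \<tau>)"
    using eta_prod_low[of "n - 1"] eta_last_shift n3 by simp
  also have "\<dots> = shift (t (n - 1) \<otimes> inv \<omega>) \<otimes>\<^bsub>S\<^esub> \<tau>"
    using c last_closed shift_in tau_in by (simp add: S.m_assoc)
  also have "t (n - 1) \<otimes> inv \<omega> = t (n - 2)" using t c last_closed by (simp add: m_assoc)
  finally show ?thesis .
qed

text \<open>Only \<open>j = n\<close> is new. There the product is the shift by
  \<open>tail_prod i\<close> followed by the matching; conjugation by the matching inverts that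
  shift, so the product is its own inverse.\<close>

lemma eta_rel:
  assumes "i + 2 \<le> j" "j < Suc n"
  shows "inv\<^bsub>S\<^esub> (rot_prod S \<eta> i) \<otimes>\<^bsub>S\<^esub> rot_prod S \<eta> j = inv\<^bsub>S\<^esub> (rot_prod S \<eta> j) \<otimes>\<^bsub>S\<^esub> rot_prod S \<eta> i"
proof (cases "j = n")
  case False
  then have ij: "i < n" "j < n" using assms by auto
  have "shift (inv (t i) \<otimes> t j) = shift (inv (t j) \<otimes> t i)" using rel[OF assms(1) ij(2)] by (rule arg_cong)
  then show ?thesis using ij t_closed by (simp add: eta_prod_low SH.hom_inv)
next
  case True
  have i: "i \<le> n - 2" "i < n" using assms True by auto
  have c: "t i \<in> carrier G" "t (n - 2) \<in> carrier G" using t_closed i n3 by auto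
  have ix: "inv (tail_prod i) = inv (t (n - 2)) \<otimes> t i" using c by (simp add: tail_prod_def inv_mult_group)
  have "inv\<^bsub>S\<^esub> (rot_prod S \<eta> i) \<otimes>\<^bsub>S\<^esub> rot_prod S \<eta> n = inv\<^bsub>S\<^esub> shift (t i) \<otimes>\<^bsub>S\<^esub> (shift (t (n - 2)) \<otimes>\<^bsub>S\<^esub> \<tau>)"
    using eta_prod_low[OF i(2)] eta_prod_last by simp
  also have "\<dots> = shift (tail_prod i) \<otimes>\<^bsub>S\<^esub> \<tau>"
    using c shift_in tau_in by (simp add: tail_prod_def S.m_assoc SH.hom_inv)
  also have "\<dots> = \<tau> \<otimes>\<^bsub>S\<^esub> shift (inv (tail_prod i))"
    using shift_tau[OF tail_prod_in bar_tail_prod] i by simp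
  also have "\<dots> = \<tau> \<otimes>\<^bsub>S\<^esub> (inv\<^bsub>S\<^esub> shift (t (n - 2)) \<otimes>\<^bsub>S\<^esub> shift (t i))"
    unfolding ix using c by (simp add: SH.hom_inv)
  also have "\<dots> = inv\<^bsub>S\<^esub> (shift (t (n - 2)) \<otimes>\<^bsub>S\<^esub> \<tau>) \<otimes>\<^bsub>S\<^esub> shift (t i)"
    using c shift_in tau_in by (simp add: S.inv_mult_group inv_tau S.m_assoc)
  finally show ?thesis using True eta_prod_low[OF i(2)] eta_prod_last by simp
qed

text \<open>The product of all \<open>n\<close> generators is the only one that changes the copy;
  the others are shifts.\<close>

lemma eta_prod_inj:
  assumes "i < j" "j < Suc n"
  shows "rot_prod S \<eta> i \<noteq> rot_prod S \<eta> j"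
proof (cases "j = n")
  case False
  then show ?thesis using assms prod_inj[of i j] shift_inj[of "t i" "t j"] t_closed by (auto simp: eta_prod_low)
next
  case True
  have "rot_prod S \<eta> i (\<one>, False) = (t i, False)"
    using eta_prod_low[of i] assms True t_closed[of i] by (simp add: shift_simps)
  moreover have "snd (rot_prod S \<eta> j (\<one>, False)) = True"
    using eta_prod_last True t_closed[of "n - 2"] n3 by (simp add: mult_perm_group shift_simps tau_simps)
  ultimately show ?thesis by auto
qed

text \<open>Equality of images, not inclusion, is required of the generators: \<open>Y\<close> may
  be infinite, and an inclusion would not pass to inverses.\<close>

lemma generate_preserves:
  assumes x: "x \<in> generate S K" and K: "\<And>f. f \<in> K \<Longrightarrow> f \<in> carrier S \<and> f ` Y = Y"
  shows "x ` Y = Y"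
  using x
proof (induction rule: generate.induct)
  case (inv f)
  have f: "f \<in> carrier S" "f ` Y = Y" using K inv by auto
  have "(inv\<^bsub>S\<^esub> f) ` f ` Y = (f \<otimes>\<^bsub>S\<^esub> inv\<^bsub>S\<^esub> f) ` Y" by (simp add: mult_perm_group image_comp)
  also have "\<dots> = Y" using f by (simp add: one_perm_group)
  finally show ?case using f by simp
next
  case (eng x y)
  have "(x \<otimes>\<^bsub>S\<^esub> y) ` Y = y ` x ` Y" by (simp add: mult_perm_group image_comp)
  then show ?case using eng by simp
qed (use K in \<open>auto simp: one_perm_group\<close>)

lemma involution_image: "(\<And>w. w \<in> Y \<Longrightarrow> f w \<in> Y \<and> f (f w) = w) \<Longrightarrow> f ` Y = Y"
  by (metis (no_types) equalityI image_eqI image_subsetI subsetI)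

lemma eta_preserves_tail:
  assumes j: "1 \<le> j" "j < n" and k: "k \<in> {j..n}"
  shows "\<eta> k ` (E j \<times> UNIV) = E j \<times> UNIV"
proof -
  interpret Ej: subgroup "E j" G by (rule tail_subgroup[OF j(1)])
  have sh: "shift x ` (E j \<times> UNIV) = E j \<times> UNIV" if x: "x \<in> E j" for x
  proof (intro equalityI subsetI)
    show "w \<in> E j \<times> UNIV" if "w \<in> shift x ` (E j \<times> UNIV)" for w
      using that x by (auto simp: shift_simps)
    show "w \<in> shift x ` (E j \<times> UNIV)" if "w \<in> E j \<times> UNIV" for w
    proof (rule image_eqI[where x = "shift (inv x) w"])
      show "w = shift x (shift (inv x) w)" "shift (inv x) w \<in> E j \<times> UNIV"
        using that x by (auto simp: shift_simps m_assoc)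
    qed
  qed
  have ta: "\<tau> ` (E j \<times> UNIV) = E j \<times> UNIV"
    by (rule involution_image) (auto simp: tau_simps mt_mt mt_tail[OF j] mt_closed)
  show ?thesis
  proof (cases "k = n")
    case True
    have "inv \<omega> \<in> E j" using gens_in_tail[of j "n - 1"] j by simp
    then have "\<tau> ` shift (inv \<omega>) ` (E j \<times> UNIV) = E j \<times> UNIV" using sh ta by simp
    then show ?thesis using True eta_last_shift by (simp add: mult_perm_group image_comp)
  next
    case False
    then show ?thesis using eta_low[of k] sh gens_in_tail[of j k] k by simp
  qed
qed

text \<open>\<open>(\<one>, False)\<close> is shifted to \<open>(inv \<omega>, False)\<close>, whose
  partner is \<open>(\<omega>, True)\<close> since powers are matched with their inverses;
  \<open>(\<omega>, True)\<close> is shifted to \<open>(\<one>, True)\<close>, whose partner is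
  \<open>(\<one>, False)\<close>.\<close>

lemma eta_last_preserves: "\<eta> n ` {(\<one>, False), (\<omega>, True)} = {(\<one>, False), (\<omega>, True)}"
proof -
  interpret El: subgroup "E (n - 1)" G by (rule tail_subgroup) (use n3 in simp)
  have w: "\<omega> \<in> E (n - 1)" by (rule gens_in_tail) (use n3 in auto)
  have "\<eta> n (\<one>, False) = (\<omega>, True)" "\<eta> n (\<omega>, True) = (\<one>, False)"
    using mt_power[OF El.m_inv_closed[OF w]] mt_power[OF El.one_closed] last_closed
    by (simp_all add: eta_last_shift mult_perm_group shift_simps tau_simps)
  then show ?thesis by auto
qed

lemma eta_generate_low:
  assumes "k < n"
  shows "generate S (\<eta> ` {Suc b..k}) = shift ` generate G (s ` {Suc b..k})"
proof -
  have "\<eta> ` {Suc b..k} = shift ` s ` {Suc b..k}"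
    unfolding image_image by (rule image_cong) (use eta_low assms in auto)
  then show ?thesis using SH.generate_img[OF gens_closed[OF assms], of b] by simp
qed

text \<open>
  If the shift by \<open>\<gamma>\<close> lies in the subgroup generated by \<open>\<eta> (b + 1), \<dots>, \<eta> n\<close>, then it preserves the
  set \<open>E (b + 1) \<times> UNIV\<close> or, if \<open>b = n - 1\<close>, the set \<open>{(\<one>, False), (\<omega>, True)}\<close>; looking at the
  image of \<open>(\<one>, False)\<close> confines \<open>\<gamma>\<close> to \<open>E (b + 1)\<close> or to \<open>{\<one>}\<close>.
\<close>

lemma eta_ip:
  assumes bk: "b \<le> k" "k < Suc n"
  shows "generate S (\<eta> ` {1..k}) \<inter> generate S (\<eta> ` {Suc b..<Suc n}) \<subseteq> generate S (\<eta> ` {Suc b..k})"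
proof (cases "k = n \<or> b = 0")
  case True
  \<comment> \<open>In either case one of the two intersected subgroups already equals the
    right-hand side.\<close>
  then show ?thesis by (auto simp: atLeastLessThanSuc_atLeastAtMost)
next
  case False
  then have k: "k < n" "1 \<le> b" "b < n" using bk by auto
  show ?thesis
  proof
    fix x assume x: "x \<in> generate S (\<eta> ` {1..k}) \<inter> generate S (\<eta> ` {Suc b..<Suc n})"
    then obtain \<gamma> where \<gamma>: "\<gamma> \<in> generate G (s ` {Suc 0..k})" "x = shift \<gamma>"
      using eta_generate_low[OF k(1), of 0] by auto
    have \<gamma>G: "\<gamma> \<in> carrier G" using \<gamma> generate_in_carrier[OF gens_closed[OF k(1)]] by blast
    have x1: "x (\<one>, e) = (\<gamma>, e)" for e using \<gamma> \<gamma>G by (simp add: shift_simps)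
    have x2: "x \<in> generate S (\<eta> ` {Suc b..n})" using x by (simp add: atLeastLessThanSuc_atLeastAtMost)
    have "\<gamma> \<in> generate G (s ` {Suc b..k})"
    proof (cases "Suc b < n")
      case True
      interpret Ej: subgroup "E (Suc b)" G by (rule tail_subgroup) simp
      have "x ` (E (Suc b) \<times> UNIV) = E (Suc b) \<times> UNIV"
      proof (rule generate_preserves[OF x2], elim imageE, intro conjI)
        fix f i assume f: "f = \<eta> i" "i \<in> {Suc b..n}"
        show "f \<in> carrier S" using f eta_in[of i] by simp
        show "f ` (E (Suc b) \<times> UNIV) = E (Suc b) \<times> UNIV"
          unfolding f(1) by (rule eta_preserves_tail[OF _ True f(2)]) simp
      qed
      moreover have "(\<one>, False) \<in> E (Suc b) \<times> UNIV" by simp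
      ultimately have "x (\<one>, False) \<in> E (Suc b) \<times> UNIV" by blast
      then have "\<gamma> \<in> E (Suc b)" using x1 by simp
      moreover have "{Suc b..<n} = {Suc b..n - 1}" using n3 by auto
      ultimately have "\<gamma> \<in> generate G (s ` {Suc b..<n})" by (simp add: tail_group_def)
      then show ?thesis using ip[OF bk(1) k(1)] \<gamma> by auto
    next
      case False
      then have b: "{Suc b..n} = {n}" using k by auto
      have "x ` {(\<one>, False), (\<omega>, True)} = {(\<one>, False), (\<omega>, True)}"
        by (rule generate_preserves[OF x2]) (use eta_in eta_last_preserves b n3 in auto)
      then have "x (\<one>, False) \<in> {(\<one>, False), (\<omega>, True)}" by blast
      \<comment> \<open>A shift keeps the copy, so the image of \<open>(\<one>, False)\<close>
        cannot be \<open>(\<omega>, True)\<close>.\<close>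
      then have "\<gamma> = \<one>" using x1 by simp
      then show ?thesis by (simp add: generate.one)
    qed
    then show "x \<in> generate S (\<eta> ` {Suc b..k})" using eta_generate_low[OF k(1)] \<gamma>(2) by blast
  qed
qed

section \<open>The generated group and its base facet\<close>

abbreviation D where "D \<equiv> eta_group G n s c"

lemma carrier_D: "carrier D = generate S (\<eta> ` {1..n})"
  and mult_D [simp]: "x \<otimes>\<^bsub>D\<^esub> y = x \<otimes>\<^bsub>S\<^esub> y"
  and one_D [simp]: "\<one>\<^bsub>D\<^esub> = \<one>\<^bsub>S\<^esub>"
  by (simp_all add: eta_group_def)

lemma eta_gens: "\<eta> ` {1..n} \<subseteq> carrier S"
  using eta_in by blast

lemma D_subgroup: "subgroup (carrier D) S"
  unfolding carrier_D by (rule S.generate_is_subgroup[OF eta_gens])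

lemma D_eq: "D = S\<lparr>carrier := carrier D\<rparr>"
  by (simp add: eta_group_def)

sublocale D: group D
  using S.subgroup_imp_group[OF D_subgroup] D_eq by simp

lemma inv_D: "x \<in> carrier D \<Longrightarrow> inv\<^bsub>D\<^esub> x = inv\<^bsub>S\<^esub> x"
  using S.m_inv_consistent[OF D_subgroup] D_eq by simp

lemma generate_D:
  assumes "J \<subseteq> {1..n}"
  shows "generate D (\<eta> ` J) = generate S (\<eta> ` J)"
proof -
  have "\<eta> ` J \<subseteq> carrier D" unfolding carrier_D using assms by (auto intro: generate.incl)
  then show ?thesis using S.generate_consistent[OF _ D_subgroup] D_eq by simp
qed

lemma rot_prod_D: "rot_prod D \<eta> i = rot_prod S \<eta> i"
  by (induction i) simp_all

sublocale DD: rotation_data D "Suc n" \<eta>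
proof
  show "\<eta> i \<in> carrier D" if "1 \<le> i" "i < Suc n" for i
    unfolding carrier_D by (rule generate.incl) (use that in auto)
qed

lemma shift_in_D: "x \<in> carrier G \<Longrightarrow> shift x \<in> carrier D"
proof -
  assume x: "x \<in> carrier G"
  have n: "n - 1 < n" "{1..<n} = {Suc 0..n - 1}" using n3 by auto
  have "shift x \<in> generate S (\<eta> ` {Suc 0..n - 1})"
    using eta_generate_low[OF n(1), of 0] gen x n(2) by simp
  moreover have "generate S (\<eta> ` {Suc 0..n - 1}) \<subseteq> generate S (\<eta> ` {1..n})"
    by (rule S.mono_generate) auto
  ultimately show ?thesis unfolding carrier_D by blast
qed

sublocale DR: rotation_group D "Suc n" \<eta>
proof
  have p: "rot_prod S \<eta> i \<in> carrier D" if "i < Suc n" for i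
    using DD.t_closed[OF that] rot_prod_D by simp
  show "2 \<le> Suc n" using n3 by simp
  show "generate D (\<eta> ` {1..<Suc n}) = carrier D"
    using generate_D[of "{1..n}"] carrier_D by (simp add: atLeastLessThanSuc_atLeastAtMost)
  show "inv\<^bsub>D\<^esub> (rot_prod D \<eta> i) \<otimes>\<^bsub>D\<^esub> rot_prod D \<eta> j = inv\<^bsub>D\<^esub> (rot_prod D \<eta> j) \<otimes>\<^bsub>D\<^esub> rot_prod D \<eta> i"
    if "i + 2 \<le> j" "j < Suc n" for i j
    using eta_rel[OF that] inv_D p that by (simp add: rot_prod_D)
  show "rot_prod D \<eta> i \<noteq> rot_prod D \<eta> j" if "i < j" "j < Suc n" for i j
    using eta_prod_inj[OF that] by (simp add: rot_prod_D)
  show "generate D (\<eta> ` {1..k}) \<inter> generate D (\<eta> ` {Suc b..<Suc n}) \<subseteq> generate D (\<eta> ` {Suc b..k})"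
    if "b \<le> k" "k < Suc n" for b k
    using eta_ip[OF that] generate_D[of "{1..k}"] generate_D[of "{Suc b..<Suc n}"] generate_D[of "{Suc b..k}"] that
    by (simp add: atLeastLessThanSuc_atLeastAtMost)
qed

definition emb :: "'a \<times> bool \<Rightarrow> ('a \<times> bool \<Rightarrow> 'a \<times> bool) \<times> bool" where
  "emb w = (shift (fst w), snd w)"

text \<open>Colours below \<open>n\<close> involve only
  \<open>\<eta> 1, \<dots>, \<eta> (n - 1)\<close>, which are shifts, so the old flag graph sits
  inside the new one.\<close>

lemma emb_adj:
  assumes w: "w \<in> W" and i: "i < n"
  shows "emb (adj i w) = DD.adj i (emb w)"
proof -
  have c: "t i \<in> carrier G" using t_closed i by simp
  have p: "rot_prod D \<eta> i = shift (t i)" using rot_prod_D eta_prod_low[OF i] by simp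
  show ?thesis
    using w c inv_D[OF shift_in_D[OF c]] by (cases w; cases "snd w") (simp_all add: emb_def p SH.hom_inv)
qed

lemma emb_inj: "inj_on emb W"
  by (rule inj_onI) (auto simp: emb_def dest: shift_inj)

lemma emb_in: "w \<in> W \<Longrightarrow> emb w \<in> DD.W"
  using shift_in_D by (auto simp: emb_def)

text \<open>
  A reflection of the new flag graph fixes the base facet, which is a copy of the old flag graph.
\<close>

sublocale DC: chiral_rotation_group D "Suc n" \<eta>
proof
  fix \<theta> assume W: "\<And>w. w \<in> DD.W \<Longrightarrow> \<theta> w \<in> DD.W"
    and eq: "\<And>w i. w \<in> DD.W \<Longrightarrow> i < Suc n \<Longrightarrow> \<theta> (DD.adj i w) = DD.adj i (\<theta> w)"
  show "\<theta> (\<one>\<^bsub>D\<^esub>, False) \<noteq> (\<one>\<^bsub>D\<^esub>, True)"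
  proof
    assume \<theta>1: "\<theta> (\<one>\<^bsub>D\<^esub>, False) = (\<one>\<^bsub>D\<^esub>, True)"
    have one: "emb (\<one>, e) = (\<one>\<^bsub>D\<^esub>, e)" for e by (simp add: emb_def)
    have b: "(\<one>, e) \<in> W" for e by simp
    \<comment> \<open>The base flag goes to its \<open>0\<close>-adjacent flag, which lies in the
      embedded old flag graph, and that graph is closed under colours below \<open>n\<close>; by
      connectivity \<open>\<theta>\<close> maps it into itself.\<close>
    have im: "\<exists>v \<in> W. \<theta> (emb w) = emb v" if w: "w \<in> W" for w
      using rot_connected[OF b[of False] w]
    proof (induction rule: reach_induct)
      case refl
      show ?case by (rule bexI[OF _ b[of True]]) (simp only: one \<theta>1)
    next
      case (step y i)
      then obtain v where v: "v \<in> W" "\<theta> (emb y) = emb v" by (elim bexE)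
      have y: "y \<in> W" by (rule reach_closed[OF step.hyps(1)]) (use b in auto)
      have i: "i < n" using step.hyps(2) by simp
      have "\<theta> (emb (adj i y)) = emb (adj i v)"
        using emb_adj[OF y i] emb_adj[OF v(1) i] eq[OF emb_in[OF y], of i] v(2) i by simp
      then show ?case using closed[OF v(1) i] by (rule bexI)
    qed
    define \<theta>' where "\<theta>' w = (SOME v. v \<in> W \<and> \<theta> (emb w) = emb v)" for w
    have \<theta>': "\<theta>' w \<in> W \<and> \<theta> (emb w) = emb (\<theta>' w)" if "w \<in> W" for w
      unfolding \<theta>'_def by (rule someI_ex) (use im[OF that] in \<open>simp add: Bex_def\<close>)
    have "\<theta>' (\<one>, False) \<noteq> (\<one>, True)"
    proof (rule no_reflection)
      show "\<theta>' w \<in> W" if "w \<in> W" for w using \<theta>'[OF that] by (rule conjunct1)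
      show "\<theta>' (adj i w) = adj i (\<theta>' w)" if w: "w \<in> W" and i: "i < n" for w i
      proof (rule inj_onD[OF emb_inj])
        have aw: "adj i w \<in> W" using closed[OF w i] .
        have "emb (\<theta>' (adj i w)) = \<theta> (emb (adj i w))" using \<theta>'[OF aw] by simp
        also have "\<dots> = DD.adj i (\<theta> (emb w))" using emb_adj[OF w i] eq[OF emb_in[OF w], of i] i by simp
        also have "\<dots> = emb (adj i (\<theta>' w))" using emb_adj[of "\<theta>' w" i] \<theta>'[OF w] i by simp
        finally show "emb (\<theta>' (adj i w)) = emb (adj i (\<theta>' w))" .
        show "\<theta>' (adj i w) \<in> W" using \<theta>'[OF aw] by (rule conjunct1)
        show "adj i (\<theta>' w) \<in> W" using closed \<theta>'[OF w] i by (metis (no_types))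
      qed
    qed
    moreover have "emb (\<theta>' (\<one>, False)) = emb (\<one>, True)" using \<theta>'[OF b[of False]] by (simp only: one \<theta>1)
    then have "\<theta>' (\<one>, False) = (\<one>, True)"
      by (rule inj_onD[OF emb_inj]) (use \<theta>'[OF b[of False]] b in blast)+
    ultimately show False by (rule notE)
  qed
qed

end

section \<open>Isomorphism type of the facets\<close>

lemma poset_isomorphic_sym:
  assumes "poset_isomorphic r s"
  shows "poset_isomorphic s r"
proof -
  obtain f where f: "bij_betw f (Field r) (Field s)"
    and rel: "\<And>x y. x \<in> Field r \<Longrightarrow> y \<in> Field r \<Longrightarrow> (x, y) \<in> r \<longleftrightarrow> (f x, f y) \<in> s"
    using assms unfolding poset_isomorphic_def by blast
  let ?g = "inv_into (Field r) f"
  have g: "?g y \<in> Field r" "f (?g y) = y" if "y \<in> Field s" for y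
    using that f by (auto simp: bij_betw_def inv_into_into f_inv_into_f)
  have "(x, y) \<in> s \<longleftrightarrow> (?g x, ?g y) \<in> r" if "x \<in> Field s" "y \<in> Field s" for x y
    using rel[OF g(1)[OF that(1)] g(1)[OF that(2)]] g(2) that by simp
  then show ?thesis
    unfolding poset_isomorphic_def using bij_betw_inv_into[OF f] by blast
qed

context extension
begin

abbreviation facet_flags where
  "facet_flags w \<equiv> {v \<in> DD.W. DR.rot_face (Suc n) v = DR.rot_face (Suc n) w}"

text \<open>The flags through one facet are those joined by colours below \<open>n\<close>. The old
  flag graph, embedded and translated by \<open>g\<close>, contains \<open>(g, False)\<close> and is
  connected and closed under these colours, so it consists of exactly these flags.\<close>

lemma facet_emb_bij:
  assumes g: "g \<in> carrier D"
  shows "bij_betw (\<lambda>w. DR.rmult g (emb w)) W (facet_flags (g, False))"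
    and "\<And>w i. w \<in> W \<Longrightarrow> i < n \<Longrightarrow> DR.rmult g (emb (adj i w)) = DD.adj i (DR.rmult g (emb w))"
proof -
  let ?\<theta> = "\<lambda>w. DR.rmult g (emb w)"
  show eq: "?\<theta> (adj i w) = DD.adj i (?\<theta> w)" if "w \<in> W" "i < n" for w i
    using emb_adj[OF that] DR.rmult_adj[OF g emb_in[OF that(1)], of i] that(2) by simp
  have I: "{i. i < Suc n \<and> Suc i \<noteq> Suc n} = {..<n}" by auto
  have g0: "(g, False) \<in> DD.W" using g by simp
  have b: "(\<one>, False) \<in> W" by simp
  have \<theta>1: "?\<theta> (\<one>, False) = (g, False)"
    using g D.l_one[OF g] by (simp add: emb_def DR.rmult_def)
  have \<theta>W: "?\<theta> w \<in> DD.W" if "w \<in> W" for w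
    using DR.rmult_closed[OF g emb_in[OF that]] .
  have face: "DR.rot_face (Suc n) v = DR.rot_face (Suc n) (g, False) \<longleftrightarrow> reach DD.adj {..<n} (g, False) v"
    if "v \<in> DD.W" for v
    using DR.rot_face_eq_iff[OF g0 that, of "Suc n" "Suc n"] unfolding I by auto
  show "bij_betw ?\<theta> W (facet_flags (g, False))"
    unfolding bij_betw_def
  proof
    show "inj_on ?\<theta> W"
    proof (rule inj_onI)
      fix v w assume vw: "v \<in> W" "w \<in> W" and e: "?\<theta> v = ?\<theta> w"
      have "emb v = emb w"
        by (rule inj_onD[OF _ e emb_in[OF vw(1)] emb_in[OF vw(2)]])
          (use DR.rmult_bij[OF g] in \<open>simp add: bij_betw_def\<close>)
      then show "v = w" by (rule inj_onD[OF emb_inj _ vw])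
    qed
    show "?\<theta> ` W = facet_flags (g, False)"
    proof (intro equalityI subsetI)
      fix v assume "v \<in> ?\<theta> ` W"
      then obtain w where w: "w \<in> W" "v = ?\<theta> w" by (rule imageE)
      have "reach adj {..<n} (\<one>, False) w" by (rule rot_connected[OF b w(1)])
      then have "reach DD.adj {..<n} (?\<theta> (\<one>, False)) (?\<theta> w)"
        by (rule reach_hom[where \<theta> = ?\<theta>, OF _ flag_system_axioms order_refl b]) (rule eq)
      then show "v \<in> facet_flags (g, False)"
        using face[OF \<theta>W[OF w(1)]] \<theta>W[OF w(1)] \<theta>1 w(2) by simp
    next
      fix v assume "v \<in> facet_flags (g, False)"
      then have "reach DD.adj {..<n} (g, False) v" using face by blast
      then show "v \<in> ?\<theta> ` W"
      proof (induction rule: reach_induct)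
        case refl
        show ?case by (rule image_eqI[where f = ?\<theta>, OF \<theta>1[symmetric] b])
      next
        case (step y i)
        then obtain w where w: "w \<in> W" "y = ?\<theta> w" by (elim imageE)
        have i: "i < n" using step.hyps(2) by simp
        show ?case
          by (rule image_eqI[where f = ?\<theta>, OF _ closed[OF w(1) i]]) (simp only: eq[OF w(1) i] w(2))
      qed
    qed
  qed
qed

lemma facet_isomorphic:
  assumes K: "flag_model n W adj K fK" and F: "F \<in> facets (Suc n) DR.rot_poset"
  shows "poset_isomorphic (face_section DR.rot_poset F) K"
proof -
  have FF: "F \<in> Field DR.rot_poset" and rank: "face_rank DR.rot_poset F = int (Suc n) - 1"
    using F by (simp_all add: facets_def)
  obtain k w where kw: "k \<le> Suc n + 1" "w \<in> DD.W" "F = DR.rot_face k w"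
    using FF by (rule DR.M.FieldE)
  have "k = Suc n" using DR.M.face_rank_fc[OF kw(2,1)] rank kw(3) by simp
  then have w: "w \<in> DD.W" "F = DR.rot_face (Suc n) w" using kw by simp_all
  obtain g e where ge: "w = (g, e)" "g \<in> carrier D" using w(1) by auto
  obtain h where h: "h \<in> carrier D" "F = DR.rot_face (Suc n) (h, False)"
  \<comment> \<open>Colour \<open>0\<close> keeps the facet, so a flag of the copy
    \<open>False\<close> can represent it.\<close>
  proof (cases e)
    case True
    have "DR.rot_face (Suc n) (DD.adj 0 w) = DR.rot_face (Suc n) w"
      using DR.M.fc_step[OF w(1), of 0 "Suc n"] n3 by simp
    moreover have "DD.adj 0 w = (g, False)" using ge True D.inv_one D.l_one[OF ge(2)] by simp
    ultimately show thesis using that[OF ge(2)] w by simp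
  next
    case False
    then show thesis using that[OF ge(2)] ge w by simp
  qed
  have h0: "(h, False) \<in> DD.W" using h by simp
  have M: "flag_model n (facet_flags (h, False)) DD.adj (face_section DR.rot_poset F) DR.rot_face"
    unfolding h(2) by (rule DR.M.section_model[OF HOL.refl h0])
  obtain f where f: "bij_betw f (Field K) (Field (face_section DR.rot_poset F))"
    "\<And>x y. x \<in> Field K \<Longrightarrow> y \<in> Field K \<Longrightarrow> (x, y) \<in> K \<longleftrightarrow> (f x, f y) \<in> face_section DR.rot_poset F"
    using flag_model_iso[OF K M facet_emb_bij[OF h(1)]] by metis
  then have "poset_isomorphic K (face_section DR.rot_poset F)" unfolding poset_isomorphic_def by blast
  then show ?thesis by (rule poset_isomorphic_sym)
qed

end

theorem theorem4p1:
  fixes K :: "'a rel" and d :: nat and \<Phi> :: "'a set"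
    and \<sigma> :: "nat \<Rightarrow> 'a \<Rightarrow> 'a" and c :: "('a \<Rightarrow> 'a) set \<Rightarrow> ('a \<Rightarrow> 'a)"
  assumes "d \<ge> 3"
    and "chiral_polytope d K"
    and "\<And>F. F \<in> facets d K \<Longrightarrow> regular_polytope (d - 1) (face_section K F)"
    and "\<Phi> \<in> flags K"
    and "abstract_rotations d K \<Phi> \<sigma>"
    and "admissible_choice (aut_group K) d \<sigma> c"
  shows "\<exists>(P :: ('a \<Rightarrow> 'a) coset_face rel) \<Psi> \<phi>.
           chiral_polytope (d + 1) P \<and>
           \<Psi> \<in> flags P \<and>
           \<phi> \<in> iso (eta_group (aut_group K) d \<sigma> c) (aut_group P) \<and>
           abstract_rotations (d + 1) P \<Psi> (\<phi> \<circ> eta (aut_group K) d \<sigma> c) \<and>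
           (\<forall>F \<in> facets (d + 1) P. poset_isomorphic (face_section P F) K)"
proof -
  interpret C: chiral_flags d K \<Phi> \<sigma>
    by unfold_locales (use assms in \<open>auto simp: chiral_polytope_def\<close>)
  interpret X: extension "aut_group K" d \<sigma> c
    by unfold_locales (use assms C.facet_reflection in auto)
  have "poset_isomorphic (face_section X.DR.rot_poset F) K" if "F \<in> facets (d + 1) X.DR.rot_poset" for F
    using X.facet_isomorphic[OF C.MG.flag_model_axioms, of F] that by simp
  moreover have "X.DR.M.fl (\<one>\<^bsub>eta_group (aut_group K) d \<sigma> c\<^esub>, False) \<in> flags X.DR.rot_poset"
    unfolding X.DR.M.flags_eq by (rule imageI) (use X.D.one_closed in blast)
  ultimately show ?thesis
    using X.DC.rot_chiral X.DC.rot_aut_iso X.DC.rot_rotations unfolding Suc_eq_plus1 by blast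
qed

end
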